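(* Let $(G,\tau)$ be a locally compact Hausdorff right topological group that has a compact strong normal system of subgroups. Then the right invariant Haar measure on $G$ (which exists) is unique up to multiplication by a positive scalar: any two non-zero (positive) Radon measures $\mu,\mu'$ on $G$ satisfying $\mu(Eg)=\mu(E)$ and $\mu'(Eg)=\mu'(E)$ for all $g\in G$ and all Borel $E\subset G$ satisfy $\mu'=c\mu$ for some $c>0$.
   Context: A right topological group is a group $G$ with a topology $\tau$ such that for every $x\in G$ the map $G\to G$, $g\mapsto gx$, is continuous. The $\sigma$-topology on $G$ is the quotient topology on $G$ induced by the map $(G,\tau)\times(G,\tau)\to G$, $(x,y)\mapsto x^{-1}y$; "$\sigma$-closed" means closed in $(G,\sigma)$. For a subgroup $K$, $G/K$ denotes the space of left cosets $\{xK : x\in G\}$ with the quotient topology from $\tau$ (and similarly for quotients of subgroups of $G$ with the subspace topology from $\tau$). A compact strong normal system of subgroups of $G$ is a family $\{L_\xi\}_{\xi\le\xi_0}$ of $\sigma$-closed normal subgroups of $G$, indexed by the ordinals $\xi\le \xi_0$ for some ordinal $\xi_0>0$, such that: (1) $L_0=G$, $L_{\xi_0}=\{e\}$, $L_\xi\supset L_{\xi+1}$ for $\xi<\xi_0$, and $L_\xi=\bigcap_{\eta<\xi}L_\eta$ for every limit ordinal $\xi\le\xi_0$; (2) $G/L_1=L_0/L_1$ is a locally compact Hausdorff topological group, each $L_\xi$ with $1\le \xi\le \xi_0$ is compact (in $\tau$), and $L_\xi/L_{\xi+1}$ is a compact Hausdorff topological group for $1\le\xi<\xi_0$; (3) for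 each $\xi<\xi_0$ the map $G/L_{\xi+1}\times L_\xi/L_{\xi+1}\to G/L_{\xi+1}$, $([x],[y])\mapsto[xy]$, is jointly continuous. *)

theory Defs
  imports "HOL-Analysis.Analysis" "HOL-Algebra.Coset"
begin

section \<open>Quotient topologies and topological groups\<close>

definition quotient_topology :: "'a topology \<Rightarrow> ('a \<Rightarrow> 'b) \<Rightarrow> 'b topology" where
  "quotient_topology X f =
     topology (\<lambda>U. U \<subseteq> f ` topspace X \<and> openin X {x \<in> topspace X. f x \<in> U})"

lemma openin_quotient_topology:
  "openin (quotient_topology X f) U \<longleftrightarrow>
     U \<subseteq> f ` topspace X \<and> openin X {x \<in> topspace X. f x \<in> U}"
proof -
  have "istopology (\<lambda>U. U \<subseteq> f ` topspace X \<and> openin X {x \<in> topspace X. f x \<in> U})"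
    unfolding istopology_def
  proof (intro conjI allI impI)
    fix S T
    assume "S \<subseteq> f ` topspace X \<and> openin X {x \<in> topspace X. f x \<in> S}"
      and "T \<subseteq> f ` topspace X \<and> openin X {x \<in> topspace X. f x \<in> T}"
    then have "openin X ({x \<in> topspace X. f x \<in> S} \<inter> {x \<in> topspace X. f x \<in> T})"
      by blast
    moreover have "{x \<in> topspace X. f x \<in> S} \<inter> {x \<in> topspace X. f x \<in> T} =
        {x \<in> topspace X. f x \<in> S \<inter> T}"
      by blast
    ultimately show "openin X {x \<in> topspace X. f x \<in> S \<inter> T}" by simp
  next
    fix \<K>
    assume "\<forall>K\<in>\<K>. K \<subseteq> f ` topspace X \<and> openin X {x \<in> topspace X. f x \<in> K}"
    then have "openin X (\<Union>K\<in>\<K>. {x \<in> topspace X. f x \<in> K})"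
      by blast
    moreover have "(\<Union>K\<in>\<K>. {x \<in> topspace X. f x \<in> K}) = {x \<in> topspace X. f x \<in> \<Union>\<K>}"
      by blast
    ultimately show "openin X {x \<in> topspace X. f x \<in> \<Union>\<K>}" by simp
  qed blast+
  then show ?thesis
    unfolding quotient_topology_def by simp
qed

lemma topspace_quotient_topology [simp]:
  "topspace (quotient_topology X f) = f ` topspace X"
proof
  show "topspace (quotient_topology X f) \<subseteq> f ` topspace X"
    by (auto simp: topspace_def[of "quotient_topology X f"] openin_quotient_topology)
  have "{x \<in> topspace X. f x \<in> f ` topspace X} = topspace X" by blast
  then have "openin (quotient_topology X f) (f ` topspace X)"
    by (simp add: openin_quotient_topology)
  then show "f ` topspace X \<subseteq> topspace (quotient_topology X f)"
    by (rule openin_subset)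
qed

lemma quotient_map_quotient_topology: "quotient_map X (quotient_topology X f) f"
  by (simp add: quotient_map_def openin_quotient_topology)

definition topological_group :: "('a, 'b) monoid_scheme \<Rightarrow> 'a topology \<Rightarrow> bool" where
  "topological_group G X \<longleftrightarrow>
     group G \<and> topspace X = carrier G \<and>
     continuous_map (prod_topology X X) X (\<lambda>(x, y). x \<otimes>\<^bsub>G\<^esub> y) \<and>
     continuous_map X X (\<lambda>x. inv\<^bsub>G\<^esub> x)"

definition right_topological_group :: "('a, 'b) monoid_scheme \<Rightarrow> 'a topology \<Rightarrow> bool" where
  "right_topological_group G \<tau> \<longleftrightarrow>
     group G \<and> topspace \<tau> = carrier G \<and>
     (\<forall>x\<in>carrier G. continuous_map \<tau> \<tau> (\<lambda>g. g \<otimes>\<^bsub>G\<^esub> x))"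

definition sigma_topology :: "('a, 'b) monoid_scheme \<Rightarrow> 'a topology \<Rightarrow> 'a topology" where
  "sigma_topology G \<tau> =
     quotient_topology (prod_topology \<tau> \<tau>) (\<lambda>(x, y). inv\<^bsub>G\<^esub> x \<otimes>\<^bsub>G\<^esub> y)"

text \<open>The points of this space are the left cosets \<open>x <# K\<close>. The factor group \<open>G Mod K\<close> of
  HOL-Algebra has right cosets as its elements; it is used below only for normal \<open>K\<close>, where
  the two kinds of cosets are the same sets.\<close>

definition coset_topology ::
    "('a, 'b) monoid_scheme \<Rightarrow> 'a topology \<Rightarrow> 'a set \<Rightarrow> 'a set topology" where
  "coset_topology G \<tau> K = quotient_topology \<tau> (\<lambda>x. x <#\<^bsub>G\<^esub> K)"

section \<open>Compact strong normal systems\<close>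

text \<open>The ordinals \<open>\<xi> \<le> \<xi>\<^sub>0\<close> are represented by the elements \<open>\<xi> \<le> \<xi>\<^sub>0\<close> of an arbitrary
  well-ordered type. \<open>ord_succ \<xi>\<close> is the successor whenever \<open>\<xi>\<close> is not the greatest element;
  it is used only for \<open>\<xi> < \<xi>\<^sub>0\<close>.\<close>

definition ord_zero :: "'i::wellorder" where
  "ord_zero = (LEAST \<xi>. True)"

definition ord_succ :: "'i::wellorder \<Rightarrow> 'i" where
  "ord_succ \<xi> = (LEAST \<eta>. \<xi> < \<eta>)"

definition ord_limit :: "'i::wellorder \<Rightarrow> bool" where
  "ord_limit \<xi> \<longleftrightarrow> \<xi> \<noteq> ord_zero \<and> (\<forall>\<eta><\<xi>. ord_succ \<eta> \<noteq> \<xi>)"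

definition compact_strong_normal_system ::
    "('a, 'b) monoid_scheme \<Rightarrow> 'a topology \<Rightarrow> 'i::wellorder \<Rightarrow> ('i \<Rightarrow> 'a set) \<Rightarrow> bool" where
  "compact_strong_normal_system G \<tau> \<xi>\<^sub>0 L \<longleftrightarrow>
     ord_zero < \<xi>\<^sub>0 \<and>
     (\<forall>\<xi>\<le>\<xi>\<^sub>0. L \<xi> \<lhd> G \<and> closedin (sigma_topology G \<tau>) (L \<xi>)) \<and>

     L ord_zero = carrier G \<and> L \<xi>\<^sub>0 = {\<one>\<^bsub>G\<^esub>} \<and>
     (\<forall>\<xi><\<xi>\<^sub>0. L (ord_succ \<xi>) \<subseteq> L \<xi>) \<and>
     (\<forall>\<xi>\<le>\<xi>\<^sub>0. ord_limit \<xi> \<longrightarrow> L \<xi> = (\<Inter>\<eta>\<in>{..<\<xi>}. L \<eta>)) \<and>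

     topological_group (G Mod L (ord_succ ord_zero)) (coset_topology G \<tau> (L (ord_succ ord_zero))) \<and>
     locally_compact_space (coset_topology G \<tau> (L (ord_succ ord_zero))) \<and>
     Hausdorff_space (coset_topology G \<tau> (L (ord_succ ord_zero))) \<and>
     (\<forall>\<xi>. ord_succ ord_zero \<le> \<xi> \<and> \<xi> \<le> \<xi>\<^sub>0 \<longrightarrow> compactin \<tau> (L \<xi>)) \<and>
     (\<forall>\<xi>. ord_succ ord_zero \<le> \<xi> \<and> \<xi> < \<xi>\<^sub>0 \<longrightarrow>
        (let H = G\<lparr>carrier := L \<xi>\<rparr>;
             Q = coset_topology H (subtopology \<tau> (L \<xi>)) (L (ord_succ \<xi>))
         in topological_group (H Mod L (ord_succ \<xi>)) Q \<and> compact_space Q \<and> Hausdorff_space Q)) \<and>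

     (\<forall>\<xi><\<xi>\<^sub>0.
        let K = L (ord_succ \<xi>); H = G\<lparr>carrier := L \<xi>\<rparr>
        in continuous_map
             (prod_topology (coset_topology G \<tau> K) (coset_topology H (subtopology \<tau> (L \<xi>)) K))
             (coset_topology G \<tau> K)
             (\<lambda>(A, B). A <#>\<^bsub>G\<^esub> B))"

section \<open>Radon and Haar measures\<close>

text \<open>A Radon measure is a Borel measure that is finite on compact sets, outer regular on all
  Borel sets and inner regular on open sets. (On spaces that are not sigma-compact this differs
  from requiring inner regularity on all Borel sets.)\<close>

definition radon_measure :: "'a topology \<Rightarrow> 'a measure \<Rightarrow> bool" where
  "radon_measure X M \<longleftrightarrow>
     sets M = sigma_sets (topspace X) {U. openin X U} \<and>
     (\<forall>K. compactin X K \<longrightarrow> emeasure M K < \<infinity>) \<and>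
     (\<forall>E\<in>sets M. emeasure M E = (INF U\<in>{U. openin X U \<and> E \<subseteq> U}. emeasure M U)) \<and>
     (\<forall>U. openin X U \<longrightarrow> emeasure M U = (SUP K\<in>{K. compactin X K \<and> K \<subseteq> U}. emeasure M K))"

definition right_haar_measure ::
    "('a, 'b) monoid_scheme \<Rightarrow> 'a topology \<Rightarrow> 'a measure \<Rightarrow> bool" where
  "right_haar_measure G \<tau> M \<longleftrightarrow>
     radon_measure \<tau> M \<and> emeasure M (space M) \<noteq> 0 \<and>
     (\<forall>g\<in>carrier G. \<forall>E\<in>sets M. emeasure M (E #>\<^bsub>G\<^esub> g) = emeasure M E)"

end

theory Submission
  imports Defs
begin

text \<open>A Haar functional on \<open>G/N\<close> is a right invariant positive functional on the cone of
  compactly supported nonnegative functions on \<open>G\<close> that are constant on the cosets of \<open>N\<close>.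
  Existence and uniqueness are proved for \<open>N = L \<xi>\<close> by transfinite induction.
  For \<open>\<xi> = 1\<close> this is Haar's theorem for the locally compact group \<open>G/L\<^sub>1\<close>. At a successor one
  averages over the compact group \<open>L \<xi>/L (\<xi> + 1)\<close>, which acts jointly continuously on
  \<open>G/L (\<xi> + 1)\<close>; its Haar functional is invariant under conjugation by \<open>G\<close>, so averaging commutes
  with right translations, and an invariant functional does not distinguish a function from its
  average because the average is a uniform limit of convex combinations of right translates. At a
  limit the functions invariant under some earlier \<open>L \<eta>\<close> are uniformly dense, once one knows
  that \<open>G/L \<xi> \<rightarrow> G/L\<^sub>1\<close> is proper. At \<open>\<xi>\<^sub>0\<close> the functionals are those of Radon
  measures on \<open>G\<close>.\<close>

section \<open>Compactly supported functions\<close>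

text \<open>In a right topological group only the maps g \<mapsto> gx are continuous, so a product
  of two compact sets need not be compact, and the uniform continuity behind Haar's covering
  argument is at hand only on the group G/L_1 and on the compact groups L_\<xi>/L_{\<xi>+1}. The
  obstacle that shapes the induction is support: a function with compact support on G/L_\<eta>, read
  on G/L_\<xi> for a later \<xi>, need not obviously have compact support there. This is the
  property \<open>proper_over\<close>, and it is carried through the induction as a third statement
  beside existence and uniqueness. At a successor it follows from joint continuity. At a limit it is
  extracted from the functionals built so far, and that is why existence and uniqueness are proved
  together: uniqueness makes the normalised functionals along the chain extend one another, so that
  their values on a decreasing family of functions can be compared. The condition that the L_\<xi>
  are \<sigma>-closed enters as closedness of the relation inv x y \<in> L_\<xi> in G \<times> G; it
  makes the supremum of a function over cosets continuous, which is the source of functions constant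
  on cosets.\<close>

definition Cc :: "'a topology \<Rightarrow> ('a \<Rightarrow> real) set" where
  "Cc X = {f. continuous_map X euclideanreal f \<and> (\<forall>x. 0 \<le> f x) \<and>
     (\<exists>C. compactin X C \<and> (\<forall>x. x \<notin> C \<longrightarrow> f x = 0))}"

lemma CcI:
  assumes "continuous_map X euclideanreal f" "\<And>x. 0 \<le> f x" "compactin X C" "\<And>x. x \<notin> C \<Longrightarrow> f x = 0"
  shows "f \<in> Cc X"
  using assms unfolding Cc_def by blast

lemma Cc_cont: "f \<in> Cc X \<Longrightarrow> continuous_map X euclideanreal f"
  unfolding Cc_def by blast

lemma Cc_nonneg: "f \<in> Cc X \<Longrightarrow> 0 \<le> f x"
  unfolding Cc_def by blast

lemma Cc_support:
  assumes "f \<in> Cc X"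
  obtains C where "compactin X C" "\<And>x. x \<notin> C \<Longrightarrow> f x = 0"
  using assms unfolding Cc_def by blast

lemma Cc_outside: "f \<in> Cc X \<Longrightarrow> x \<notin> topspace X \<Longrightarrow> f x = 0"
  by (meson Cc_support compactin_subset_topspace subsetD)

lemma Cc_mult:
  assumes f: "f \<in> Cc X" and g: "continuous_map X euclideanreal g" "\<And>x. x \<in> topspace X \<Longrightarrow> 0 \<le> g x"
  shows "(\<lambda>x. f x * g x) \<in> Cc X"
proof -
  obtain C where C: "compactin X C" "\<And>x. x \<notin> C \<Longrightarrow> f x = 0"
    using Cc_support[OF f] by metis
  show ?thesis
  proof (rule CcI[OF _ _ C(1)])
    show "continuous_map X euclideanreal (\<lambda>x. f x * g x)"
      by (intro continuous_map_real_mult Cc_cont[OF f] g)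
    show "0 \<le> f x * g x" for x
      using Cc_nonneg[OF f, of x] Cc_outside[OF f, of x] g(2)[of x]
      by (cases "x \<in> topspace X") auto
  qed (use C in auto)
qed

lemma Cc_bounded:
  assumes f: "f \<in> Cc X"
  obtains B where "B > 0" "\<And>x. f x \<le> B"
proof -
  obtain C where C: "compactin X C" "\<And>x. x \<notin> C \<Longrightarrow> f x = 0"
    using Cc_support[OF f] by metis
  have "compactin euclideanreal (f ` C)"
    using image_compactin[OF C(1) Cc_cont[OF f]] .
  then have "bounded (f ` C)" by (simp add: compact_imp_bounded)
  then obtain B where B: "\<And>x. x \<in> C \<Longrightarrow> \<bar>f x\<bar> \<le> B"
    unfolding bounded_iff by auto
  have "f x \<le> max B 1" for x
    using B[of x] C(2)[of x] by (cases "x \<in> C") (auto simp: abs_if split: if_splits)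
  then show ?thesis using that[of "max B 1"] by auto
qed

text \<open>A locally compact Hausdorff space is completely regular, so \<open>K\<close> can be
  separated from the complement of \<open>U \<inter> U'\<close> with \<open>U'\<close> relatively
  compact. The compact set \<open>C\<close> is returned as well: partitions of unity and the Riesz
  construction need supports that are compact inside \<open>U\<close>.\<close>

lemma Cc_urysohn:
  assumes lc: "locally_compact_space X" and h: "Hausdorff_space X"
    and K: "compactin X K" and U: "openin X U" and KU: "K \<subseteq> U"
  obtains f C where "f \<in> Cc X" "\<And>x. f x \<le> 1" "\<And>x. x \<in> K \<Longrightarrow> f x = 1"
    "compactin X C" "C \<subseteq> U" "\<And>x. x \<notin> C \<Longrightarrow> f x = 0"
proof -
  obtain U' L where L: "openin X U'" "compactin X L" "K \<subseteq> U'" "U' \<subseteq> L"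
    using lc h K locally_compact_space_compact_closed_compact[of X] by meson
  have cr: "completely_regular_space X"
    using lc h locally_compact_regular_imp_completely_regular_space by blast
  have cl: "closedin X (topspace X - U \<inter> U')"
    using U L by blast
  have dj: "disjnt K (topspace X - U \<inter> U')"
    using KU L by (auto simp: disjnt_def)
  obtain f where f: "continuous_map X euclideanreal f" "f ` (topspace X - U \<inter> U') \<subseteq> {0}" "f ` K \<subseteq> {1::real}"
    using Urysohn_completely_regular_compact_closed_alt[OF cr K cl dj, of 0 1]
    using disjnt_sym
    by metis
  \<comment> \<open>Cutting \<open>2 * f x - 1\<close> off to [0,1] makes the function vanish below
    level 1/2. Its support then lies in the closed set \<open>C\<close>, which stays inside
    \<open>U \<inter> U'\<close> because \<open>f\<close> is 0 outside.\<close>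
  define g where "g x = (if x \<in> topspace X then min 1 (max 0 (2 * f x - 1)) else 0)" for x
  define C where "C = {x \<in> topspace X. f x \<in> {1/2..}}"
  have Csub: "C \<subseteq> U \<inter> U'"
    using f(2) unfolding C_def by force
  have "closedin X C"
    unfolding C_def by (rule closedin_continuous_map_preimage[OF f(1)]) auto
  moreover have "C \<subseteq> L" using Csub L by blast
  ultimately have "compactin X C"
    using L(2) closed_compactin by blast
  moreover have gC: "g x = 0" if "x \<notin> C" for x
    using that unfolding C_def g_def by auto
  moreover have "continuous_map X euclideanreal g"
  proof -
    have "continuous_map X euclideanreal (\<lambda>x. min 1 (max 0 (2 * f x - 1)))"
      by (intro continuous_intros f)
    then show ?thesis
      by (rule continuous_map_eq) (simp add: g_def)
  qed
  moreover have "0 \<le> g x" for x unfolding g_def by auto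
  ultimately have "g \<in> Cc X" by (intro CcI)
  moreover have "g x = 1" if "x \<in> K" for x
    using that f(3) K compactin_subset_topspace unfolding g_def by force
  moreover have "g x \<le> 1" for x unfolding g_def by auto
  ultimately show ?thesis
    using that \<open>compactin X C\<close> Csub gC by blast
qed

text \<open>Each point of \<open>K\<close> gets a bump supported in some \<open>U i\<close>;
  finitely many of them exceed 1/2 somewhere at every point of \<open>K\<close>. They are grouped by
  the index \<open>i\<close> and divided by their total.\<close>

lemma Cc_partition_of_unity:
  assumes lc: "locally_compact_space X" and h: "Hausdorff_space X"
    and K: "compactin X K" and fin: "finite I" and U: "\<And>i. i \<in> I \<Longrightarrow> openin X (U i)"
    and KU: "K \<subseteq> (\<Union>i\<in>I. U i)"
  obtains p C where "\<And>i. i \<in> I \<Longrightarrow> p i \<in> Cc X" "\<And>i. i \<in> I \<Longrightarrow> compactin X (C i)"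
    "\<And>i. i \<in> I \<Longrightarrow> C i \<subseteq> U i" "\<And>i x. i \<in> I \<Longrightarrow> x \<notin> C i \<Longrightarrow> p i x = 0"
    "\<And>x. (\<Sum>i\<in>I. p i x) \<le> (1::real)" "\<And>x. x \<in> K \<Longrightarrow> (\<Sum>i\<in>I. p i x) = 1"
proof -
  have "\<exists>i f C. i \<in> I \<and> f \<in> Cc X \<and> f x = 1 \<and> compactin X C \<and> C \<subseteq> U i \<and> (\<forall>y. y \<notin> C \<longrightarrow> f y = 0)"
    if xK: "x \<in> K" for x
  proof -
    obtain i where i: "i \<in> I" "x \<in> U i" using KU xK by blast
    have "compactin X {x}" using xK K compactin_subset_topspace by fastforce
    then show ?thesis
      using Cc_urysohn[OF lc h _ U[OF i(1)], of "{x}"] i by (metis empty_subsetI insert_subset insertI1)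
  qed
  then obtain ix fx Cx where x: "\<And>x. x \<in> K \<Longrightarrow> ix x \<in> I \<and> fx x \<in> Cc X \<and> fx x x = 1 \<and>
      compactin X (Cx x) \<and> Cx x \<subseteq> U (ix x) \<and> (\<forall>y. y \<notin> Cx x \<longrightarrow> fx x y = (0::real))"
    by metis
  define W where "W x = {y \<in> topspace X. fx x y \<in> {1/2<..}}" for x
  have "openin X (W x)" if "x \<in> K" for x
    unfolding W_def by (rule openin_continuous_map_preimage[OF Cc_cont]) (use x that in auto)
  moreover have "K \<subseteq> \<Union>(W ` K)"
  proof
    fix y assume "y \<in> K"
    then have "y \<in> W y" using x[of y] compactin_subset_topspace[OF K] unfolding W_def by auto
    then show "y \<in> \<Union>(W ` K)" using \<open>y \<in> K\<close> by blast
  qed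
  ultimately obtain \<F> where "finite \<F>" "\<F> \<subseteq> W ` K" "K \<subseteq> \<Union>\<F>"
    using compactinD[OF K, of "W ` K"] by blast
  then obtain D where D: "finite D" "D \<subseteq> K" "K \<subseteq> (\<Union>x\<in>D. W x)"
    by (metis finite_subset_image)
  define F where "F y = (\<Sum>x\<in>D. fx x y)" for y
  \<comment> \<open>The denominator \<open>max (1/2) (F y)\<close> never vanishes, so the quotient
    is continuous everywhere; on \<open>K\<close> one has \<open>F y > 1/2\<close>, and there the
    division is by \<open>F y\<close> itself.\<close>
  define p where "p i y = (\<Sum>x\<in>{x\<in>D. ix x = i}. fx x y) * (1 / max (1/2) (F y))" for i y
  define C where "C i = (\<Union>x\<in>{x\<in>D. ix x = i}. Cx x)" for i
  have fxn: "0 \<le> fx x y" if "x \<in> D" for x y using Cc_nonneg[of "fx x" X] x[of x] D(2) that by auto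
  have Fc: "continuous_map X euclideanreal F"
    unfolding F_def using x D by (intro continuous_map_sum) (auto intro: Cc_cont)
  have Cc: "compactin X (C i)" for i
    unfolding C_def using D x by (intro compactin_Union) auto
  have p0: "p i y = 0" if "y \<notin> C i" for i y
    using that x D(2) unfolding p_def C_def by (auto intro!: sum.neutral)
  have "p i \<in> Cc X" for i
  proof (rule CcI[OF _ _ Cc[of i] p0])
    show "continuous_map X euclideanreal (p i)"
      unfolding p_def using x D
      by (intro continuous_map_real_mult continuous_map_sum continuous_map_real_divide continuous_intros Fc)
         (auto intro: Cc_cont)
    show "0 \<le> p i y" for y
      unfolding p_def using fxn by (intro mult_nonneg_nonneg sum_nonneg) (auto simp: le_max_iff_disj)
  qed
  moreover have S: "(\<Sum>i\<in>I. p i y) = F y / max (1/2) (F y)" for y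
  proof -
    have "(\<Sum>i\<in>I. p i y) = (\<Sum>i\<in>I. \<Sum>x\<in>{x\<in>D. ix x = i}. fx x y) * (1 / max (1/2) (F y))"
      unfolding p_def sum_distrib_right ..
    also have "(\<Sum>i\<in>I. \<Sum>x\<in>{x\<in>D. ix x = i}. fx x y) = F y"
      unfolding F_def using D x fin by (intro sum.group) auto
    finally show ?thesis by simp
  qed
  moreover have "F y / max (1/2) (F y) \<le> 1" for y
    by (simp add: divide_le_eq_1 le_max_iff_disj less_max_iff_disj)
  moreover have "F y / max (1/2) (F y) = 1" if "y \<in> K" for y
  proof -
    obtain x' where x': "x' \<in> D" "y \<in> W x'" using D(3) \<open>y \<in> K\<close> by blast
    then have "1/2 < fx x' y" unfolding W_def by auto
    also have "\<dots> \<le> F y" unfolding F_def using D x' fxn by (intro member_le_sum) auto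
    finally show ?thesis by (simp add: max_def)
  qed
  moreover have "C i \<subseteq> U i" for i
    unfolding C_def using x D(2) by blast
  ultimately show ?thesis
    by (intro that[of p C]) (simp_all only: Cc, simp add: p0)
qed

section \<open>Positive functionals on cones of functions\<close>

text \<open>Differences are required only when they are nonnegative. This replaces the vector space
  structure and is enough to make additive nonnegative functionals monotone.\<close>

definition fun_cone :: "('a \<Rightarrow> real) set \<Rightarrow> bool" where
  "fun_cone A \<longleftrightarrow> (\<lambda>x. 0) \<in> A \<and> (\<forall>f\<in>A. \<forall>x. 0 \<le> f x) \<and> (\<forall>f\<in>A. \<forall>g\<in>A. (\<lambda>x. f x + g x) \<in> A) \<and>
     (\<forall>f\<in>A. \<forall>c\<ge>0. (\<lambda>x. c * f x) \<in> A) \<and> (\<forall>f\<in>A. \<forall>g\<in>A. (\<forall>x. g x \<le> f x) \<longrightarrow> (\<lambda>x. f x - g x) \<in> A)"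

definition pos_functional :: "('a \<Rightarrow> real) set \<Rightarrow> (('a \<Rightarrow> real) \<Rightarrow> real) \<Rightarrow> bool" where
  "pos_functional A I \<longleftrightarrow> (\<forall>f\<in>A. 0 \<le> I f) \<and> (\<forall>f\<in>A. \<forall>g\<in>A. I (\<lambda>x. f x + g x) = I f + I g) \<and>
     (\<forall>f\<in>A. \<forall>c\<ge>0. I (\<lambda>x. c * f x) = c * I f)"

lemma fun_cone_zero: "fun_cone A \<Longrightarrow> (\<lambda>x. 0) \<in> A"
  and fun_cone_add: "fun_cone A \<Longrightarrow> f \<in> A \<Longrightarrow> g \<in> A \<Longrightarrow> (\<lambda>x. f x + g x) \<in> A"
  and fun_cone_scale: "fun_cone A \<Longrightarrow> f \<in> A \<Longrightarrow> 0 \<le> c \<Longrightarrow> (\<lambda>x. c * f x) \<in> A"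
  and fun_cone_diff: "fun_cone A \<Longrightarrow> f \<in> A \<Longrightarrow> g \<in> A \<Longrightarrow> (\<And>x. g x \<le> f x) \<Longrightarrow> (\<lambda>x. f x - g x) \<in> A"
  unfolding fun_cone_def by simp_all

lemma fun_cone_sum:
  assumes "fun_cone A" "\<And>i. i \<in> D \<Longrightarrow> f i \<in> A"
  shows "(\<lambda>x. \<Sum>i\<in>D. f i x) \<in> A"
  using assms by (induction D rule: infinite_finite_induct) (auto simp: fun_cone_def)

lemma pos_functional_nonneg: "pos_functional A I \<Longrightarrow> f \<in> A \<Longrightarrow> 0 \<le> I f"
  and pos_functional_add: "pos_functional A I \<Longrightarrow> f \<in> A \<Longrightarrow> g \<in> A \<Longrightarrow> I (\<lambda>x. f x + g x) = I f + I g"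
  and pos_functional_scale: "pos_functional A I \<Longrightarrow> f \<in> A \<Longrightarrow> 0 \<le> c \<Longrightarrow> I (\<lambda>x. c * f x) = c * I f"
  unfolding pos_functional_def by auto

lemma pos_functional_zero: "pos_functional A I \<Longrightarrow> fun_cone A \<Longrightarrow> I (\<lambda>x. 0) = 0"
  using pos_functional_scale[of A I "\<lambda>x. 0" 0] unfolding fun_cone_def by simp

lemma pos_functional_mono:
  assumes A: "fun_cone A" and I: "pos_functional A I" and fg: "f \<in> A" "g \<in> A" "\<And>x. f x \<le> g x"
  shows "I f \<le> I g"
proof -
  have d: "(\<lambda>x. g x - f x) \<in> A" by (rule fun_cone_diff[OF A fg(2,1,3)])
  have "I g = I (\<lambda>x. f x + (g x - f x))" by simp
  also have "\<dots> = I f + I (\<lambda>x. g x - f x)" by (rule pos_functional_add[OF I fg(1) d])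
  finally show ?thesis using pos_functional_nonneg[OF I d] by linarith
qed

lemma pos_functional_sum:
  assumes A: "fun_cone A" and I: "pos_functional A I" and f: "\<And>i. i \<in> D \<Longrightarrow> f i \<in> A"
  shows "I (\<lambda>x. \<Sum>i\<in>D. f i x) = (\<Sum>i\<in>D. I (f i))"
  using f
proof (induction D rule: infinite_finite_induct)
  case (insert i D)
  have "I (\<lambda>x. f i x + (\<Sum>i\<in>D. f i x)) = I (f i) + I (\<lambda>x. \<Sum>i\<in>D. f i x)"
    using insert by (intro pos_functional_add[OF I] fun_cone_sum[OF A]) auto
  then show ?case using insert by simp
qed (simp_all add: pos_functional_zero[OF I A])

text \<open>Constants have no compact support in general, so a uniform error \<open>e\<close> is
  written as \<open>e * u x\<close> with a fixed \<open>u\<close> of the cone that is at least 1 on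
  the region in question. Most passages to uniform limits below use this estimate.\<close>

lemma pos_functional_approx:
  assumes A: "fun_cone A" and I: "pos_functional A I" and f: "f \<in> A" "g \<in> A" "u \<in> A" "0 \<le> e"
    and b: "\<And>x. \<bar>f x - g x\<bar> \<le> e * u x"
  shows "\<bar>I f - I g\<bar> \<le> e * I u"
proof -
  have eu: "(\<lambda>x. e * u x) \<in> A" by (rule fun_cone_scale[OF A f(3,4)])
  have *: "I f \<le> I g + e * I u" if "f \<in> A" "g \<in> A" "\<And>x. \<bar>f x - g x\<bar> \<le> e * u x" for f g
  proof -
    have s: "(\<lambda>x. g x + e * u x) \<in> A" by (rule fun_cone_add[OF A that(2) eu])
    have "I f \<le> I (\<lambda>x. g x + e * u x)"
    proof (rule pos_functional_mono[OF A I that(1) s])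
      show "f x \<le> g x + e * u x" for x using that(3)[of x] by linarith
    qed
    then show ?thesis
      using pos_functional_add[OF I that(2) eu] pos_functional_scale[OF I f(3,4)] by linarith
  qed
  have "I g \<le> I f + e * I u"
    by (rule *[OF f(2,1)]) (use b in \<open>simp add: abs_minus_commute\<close>)
  moreover have "I f \<le> I g + e * I u" by (rule *[OF f(1,2) b])
  ultimately show ?thesis by linarith
qed

lemma fun_cone_Cc: "fun_cone (Cc X)"
  unfolding fun_cone_def
proof (intro conjI ballI allI impI)
  show "(\<lambda>x. 0) \<in> Cc X" by (rule CcI[of _ _ "{}"]) auto
  fix f assume f: "f \<in> Cc X"
  show "0 \<le> f x" for x by (rule Cc_nonneg[OF f])
  show "(\<lambda>x. c * f x) \<in> Cc X" if "0 \<le> c" for c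
    using Cc_mult[OF f, of "\<lambda>x. c"] that by (simp add: mult.commute)
  fix g assume g: "g \<in> Cc X"
  obtain C where C: "compactin X C" "\<And>x. x \<notin> C \<Longrightarrow> f x = 0"
    using Cc_support[OF f] by metis
  obtain D where D: "compactin X D" "\<And>x. x \<notin> D \<Longrightarrow> g x = 0"
    using Cc_support[OF g] by metis
  show "(\<lambda>x. f x + g x) \<in> Cc X"
    by (rule CcI[OF _ _ compactin_Un[OF C(1) D(1)]])
       (use C D in \<open>auto intro!: continuous_map_add Cc_cont[OF f] Cc_cont[OF g] add_nonneg_nonneg Cc_nonneg[OF f] Cc_nonneg[OF g]\<close>)
  show "(\<lambda>x. f x - g x) \<in> Cc X" if "\<forall>x. g x \<le> f x"
    by (rule CcI[OF _ _ compactin_Un[OF C(1) D(1)]])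
       (use C D that in \<open>auto intro!: continuous_map_diff Cc_cont[OF f] Cc_cont[OF g]\<close>)
qed

section \<open>Right topological groups\<close>

locale rt_group = group G for G (structure) +
  fixes X :: "'a topology"
  assumes topspace_X [simp]: "topspace X = carrier G"
    and right_cont: "\<And>s. s \<in> carrier G \<Longrightarrow> continuous_map X X (\<lambda>x. x \<otimes> s)"
    and lc: "locally_compact_space X" and haus: "Hausdorff_space X"
begin

text \<open>The value 0 off the carrier makes translates of functions vanishing there equal as
  functions on the whole type, so that translations compose without side conditions on
  arguments.\<close>

definition rt :: "'a \<Rightarrow> ('a \<Rightarrow> real) \<Rightarrow> 'a \<Rightarrow> real" where
  "rt s f = (\<lambda>x. if x \<in> carrier G then f (x \<otimes> s) else 0)"

text \<open>The functions on \<open>G/N\<close> of compact support, pulled back to \<open>G\<close>; the compact subsets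
  of \<open>G/N\<close> are the images of the compact subsets of \<open>G\<close>.\<close>

definition CN :: "'a set \<Rightarrow> ('a \<Rightarrow> real) set" where
  "CN N = {f. continuous_map X euclideanreal f \<and> (\<forall>x. 0 \<le> f x) \<and>
     (\<forall>x\<in>carrier G. \<forall>l\<in>N. f (x \<otimes> l) = f x) \<and>
     (\<exists>C. compactin X C \<and> (\<forall>x. x \<notin> C <#> N \<longrightarrow> f x = 0))}"

definition haar :: "('a \<Rightarrow> real) set \<Rightarrow> (('a \<Rightarrow> real) \<Rightarrow> real) \<Rightarrow> bool" where
  "haar A I \<longleftrightarrow> pos_functional A I \<and> (\<forall>f\<in>A. \<forall>s\<in>carrier G. I (rt s f) = I f) \<and> (\<exists>f\<in>A. I f \<noteq> 0)"

text \<open>The relation is the preimage of \<open>N\<close> under (x, y) \<mapsto> inv x y, so its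
  closedness is the \<sigma>-closedness of \<open>N\<close> read through the quotient map defining
  \<sigma>. It makes the space of cosets Hausdorff.\<close>

definition adm :: "'a set \<Rightarrow> bool" where
  "adm N \<longleftrightarrow> N \<lhd> G \<and>
     closedin (prod_topology X X) {(x, y). x \<in> carrier G \<and> y \<in> carrier G \<and> inv x \<otimes> y \<in> N}"

text \<open>For \<open>N' \<subseteq> N\<close> this says that the canonical map from G/N' to G/N is
  proper: preimages of compact sets are compact. Compactness of \<open>N\<close> alone does not
  settle it, because multiplication is continuous only in its left factor.\<close>

definition proper_over :: "'a set \<Rightarrow> 'a set \<Rightarrow> bool" where
  "proper_over N N' \<longleftrightarrow> (\<forall>C. compactin X C \<longrightarrow> (\<exists>C'. compactin X C' \<and> C <#> N \<subseteq> C' <#> N'))"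

text \<open>For bounded \<open>f\<close> vanishing off the carrier this is the least majorant of
  \<open>f\<close> that is constant on the cosets of \<open>N\<close>. It is the approximation of
  \<open>f\<close> from above used at limit ordinals.\<close>

definition coset_sup :: "'a set \<Rightarrow> ('a \<Rightarrow> real) \<Rightarrow> 'a \<Rightarrow> real" where
  "coset_sup N f = (\<lambda>x. if x \<in> carrier G then (SUP l\<in>N. f (x \<otimes> l)) else 0)"

lemma compact_carrier: "compactin X C \<Longrightarrow> C \<subseteq> carrier G"
  using compactin_subset_topspace by fastforce

lemma open_carrier: "openin X C \<Longrightarrow> C \<subseteq> carrier G"
  using openin_subset by fastforce

lemma rcos_image: "C #> s = (\<lambda>x. x \<otimes> s) ` C"
  unfolding r_coset_def by blast

lemma compactin_rcos: "compactin X C \<Longrightarrow> s \<in> carrier G \<Longrightarrow> compactin X (C #> s)"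
  unfolding rcos_image by (rule image_compactin[OF _ right_cont])

lemma right_homeomorphic: "s \<in> carrier G \<Longrightarrow> homeomorphic_map X X (\<lambda>x. x \<otimes> s)"
  unfolding homeomorphic_map_maps homeomorphic_maps_def
  by (rule exI[of _ "\<lambda>x. x \<otimes> inv s"]) (auto simp: right_cont m_assoc)

lemma openin_rcos: "openin X U \<Longrightarrow> s \<in> carrier G \<Longrightarrow> openin X (U #> s)"
  using homeomorphic_imp_open_map[OF right_homeomorphic, of s]
  unfolding rcos_image open_map_def by blast

lemma set_mult_iff: "x \<in> C <#> N \<longleftrightarrow> (\<exists>c\<in>C. \<exists>n\<in>N. x = c \<otimes> n)"
  unfolding set_mult_def by blast

lemma adm_normal: "adm N \<Longrightarrow> N \<lhd> G"
  unfolding adm_def by blast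

lemma normal_carrier: "N \<lhd> G \<Longrightarrow> N \<subseteq> carrier G"
  by (simp add: normal_imp_subgroup subgroup.subset)

lemma normal_one: "N \<lhd> G \<Longrightarrow> \<one> \<in> N"
  by (simp add: normal_imp_subgroup subgroup.one_closed)

text \<open>The witness is the conjugate inv s n s. It turns a right translate of a set
  \<open>C <#> N\<close> into a set of the same form.\<close>

lemma normal_swap_right:
  assumes N: "N \<lhd> G" and "c \<in> carrier G" "n \<in> N" "s \<in> carrier G"
  obtains n' where "n' \<in> N" "c \<otimes> n \<otimes> s = c \<otimes> s \<otimes> n'"
proof -
  have n: "n \<in> carrier G" using assms normal_carrier by blast
  have "inv s \<otimes> n \<otimes> s \<in> N" using normal.inv_op_closed1[OF N] assms by blast
  moreover have "c \<otimes> n \<otimes> s = c \<otimes> s \<otimes> (inv s \<otimes> n \<otimes> s)"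
    using assms n by (simp add: m_assoc inv_solve_left r_inv l_inv flip: m_assoc) (simp add: m_assoc)
  ultimately show ?thesis using that by blast
qed

lemma CNI:
  assumes "continuous_map X euclideanreal f" "\<And>x. 0 \<le> f x"
    "\<And>x l. x \<in> carrier G \<Longrightarrow> l \<in> N \<Longrightarrow> f (x \<otimes> l) = f x"
    "compactin X C" "\<And>x. x \<notin> C <#> N \<Longrightarrow> f x = 0"
  shows "f \<in> CN N"
  using assms unfolding CN_def by blast

lemma CN_cont: "f \<in> CN N \<Longrightarrow> continuous_map X euclideanreal f"
  and CN_nonneg: "f \<in> CN N \<Longrightarrow> 0 \<le> f x"
  and CN_inv: "f \<in> CN N \<Longrightarrow> x \<in> carrier G \<Longrightarrow> l \<in> N \<Longrightarrow> f (x \<otimes> l) = f x"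
  unfolding CN_def by simp_all

lemma CN_support:
  assumes "f \<in> CN N"
  obtains C where "compactin X C" "\<And>x. x \<notin> C <#> N \<Longrightarrow> f x = 0"
  using assms unfolding CN_def by blast

lemma CN_outside: "f \<in> CN N \<Longrightarrow> N \<lhd> G \<Longrightarrow> x \<notin> carrier G \<Longrightarrow> f x = 0"
proof -
  assume f: "f \<in> CN N" and N: "N \<lhd> G" and x: "x \<notin> carrier G"
  obtain C where C: "compactin X C" "\<And>x. x \<notin> C <#> N \<Longrightarrow> f x = 0"
    using CN_support[OF f] by metis
  then show "f x = 0"
    using x setmult_subset_G[OF compact_carrier[OF C(1)] normal_carrier[OF N]] by blast
qed

lemma CN_one: "CN {\<one>} = Cc X"
proof -
  have "C <#> {\<one>} = C" if "compactin X C" for C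
    using compact_carrier[OF that] unfolding set_mult_def by force
  then show ?thesis
    unfolding CN_def Cc_def by auto
qed

lemma CN_bounded:
  assumes f: "f \<in> CN N" and N: "N \<lhd> G"
  obtains B where "B > 0" "\<And>x. f x \<le> B"
proof -
  obtain C where C: "compactin X C" "\<And>x. x \<notin> C <#> N \<Longrightarrow> f x = 0"
    using CN_support[OF f] by metis
  have "compactin euclideanreal (f ` C)"
    using image_compactin[OF C(1) CN_cont[OF f]] .
  then have "bounded (f ` C)" by (simp add: compact_imp_bounded)
  then obtain B where B: "\<And>x. x \<in> C \<Longrightarrow> \<bar>f x\<bar> \<le> B"
    unfolding bounded_iff by auto
  have "f x \<le> max B 1" for x
  proof (cases "x \<in> C <#> N")
    case True
    then obtain c n where cn: "c \<in> C" "n \<in> N" "x = c \<otimes> n" unfolding set_mult_iff by blast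
    then have "f x = f c" using CN_inv[OF f] compact_carrier[OF C(1)] by blast
    then show ?thesis using B[OF cn(1)] by auto
  next
    case False
    then show ?thesis using C(2) by simp
  qed
  then show ?thesis using that[of "max B 1"] by auto
qed

lemma fun_cone_CN: "fun_cone (CN N)"
  unfolding fun_cone_def
proof (intro conjI ballI allI impI)
  show "(\<lambda>x. 0) \<in> CN N" by (rule CNI[of _ _ "{}"]) auto
  fix f assume f: "f \<in> CN N"
  show "0 \<le> f x" for x by (rule CN_nonneg[OF f])
  obtain C where C: "compactin X C" "\<And>x. x \<notin> C <#> N \<Longrightarrow> f x = 0"
    using CN_support[OF f] by metis
  show "(\<lambda>x. c * f x) \<in> CN N" if "0 \<le> c" for c
    by (rule CNI[OF _ _ _ C(1)])
       (use C that in \<open>auto intro!: continuous_map_real_mult_left CN_cont[OF f] mult_nonneg_nonneg CN_nonneg[OF f] simp: CN_inv[OF f]\<close>)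
  fix g assume g: "g \<in> CN N"
  obtain D where D: "compactin X D" "\<And>x. x \<notin> D <#> N \<Longrightarrow> g x = 0"
    using CN_support[OF g] by metis
  have CD: "f x = 0 \<and> g x = 0" if "x \<notin> (C \<union> D) <#> N" for x
    using C(2)[of x] D(2)[of x] that unfolding set_mult_iff by blast
  show "(\<lambda>x. f x + g x) \<in> CN N"
    by (rule CNI[OF _ _ _ compactin_Un[OF C(1) D(1)]])
       (use CD in \<open>auto intro!: continuous_map_add CN_cont[OF f] CN_cont[OF g] add_nonneg_nonneg
          CN_nonneg[OF f] CN_nonneg[OF g] simp: CN_inv[OF f] CN_inv[OF g]\<close>)
  show "(\<lambda>x. f x - g x) \<in> CN N" if "\<forall>x. g x \<le> f x"
    by (rule CNI[OF _ _ _ compactin_Un[OF C(1) D(1)]])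
       (use CD that in \<open>auto intro!: continuous_map_diff CN_cont[OF f] CN_cont[OF g]
          simp: CN_inv[OF f] CN_inv[OF g]\<close>)
qed

lemma rt_cont:
  assumes "continuous_map X euclideanreal f" "s \<in> carrier G"
  shows "continuous_map X euclideanreal (rt s f)"
proof -
  have "continuous_map X euclideanreal (f \<circ> (\<lambda>x. x \<otimes> s))"
    by (rule continuous_map_compose[OF right_cont assms(1)]) (rule assms(2))
  then show ?thesis
    by (rule continuous_map_eq) (simp add: rt_def)
qed

lemma rt_CN:
  assumes f: "f \<in> CN N" and N: "N \<lhd> G" and s: "s \<in> carrier G"
  shows "rt s f \<in> CN N"
proof -
  obtain C where C: "compactin X C" "\<And>x. x \<notin> C <#> N \<Longrightarrow> f x = 0"
    using CN_support[OF f] by metis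
  show ?thesis
  proof (rule CNI[OF rt_cont[OF CN_cont[OF f] s]])
    show "0 \<le> rt s f x" for x unfolding rt_def using CN_nonneg[OF f] by auto
    show "rt s f (x \<otimes> l) = rt s f x" if x: "x \<in> carrier G" and l: "l \<in> N" for x l
    proof -
      obtain l' where "l' \<in> N" "x \<otimes> l \<otimes> s = x \<otimes> s \<otimes> l'"
        using normal_swap_right[OF N x l s] .
      then show ?thesis
        using x l s CN_inv[OF f, of "x \<otimes> s" l'] normal_carrier[OF N] unfolding rt_def by auto
    qed
    show "compactin X (C #> inv s)" by (rule compactin_rcos[OF C(1)]) (simp add: s)
    fix x assume x: "x \<notin> (C #> inv s) <#> N"
    show "rt s f x = 0"
    proof (rule ccontr)
      assume "rt s f x \<noteq> 0"
      then have xc: "x \<in> carrier G" and "f (x \<otimes> s) \<noteq> 0" unfolding rt_def by (auto split: if_splits)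
      then obtain c n where cn: "c \<in> C" "n \<in> N" "x \<otimes> s = c \<otimes> n"
        using C(2) set_mult_iff by blast
      have cc: "c \<in> carrier G" "n \<in> carrier G"
        using cn compact_carrier[OF C(1)] normal_carrier[OF N] by auto
      obtain n' where n': "n' \<in> N" "c \<otimes> n \<otimes> inv s = c \<otimes> inv s \<otimes> n'"
        using normal_swap_right[OF N cc(1) cn(2) inv_closed[OF s]] .
      have "x = c \<otimes> inv s \<otimes> n'" using n' cn(3)[symmetric] xc s by (simp add: m_assoc)
      then show False using x cn(1) n'(1) unfolding set_mult_iff rcos_image by blast
    qed
  qed
qed

text \<open>Invariance under the smaller group is immediate; the support, compact modulo
  \<open>N\<close>, becomes compact modulo \<open>N'\<close> by properness.\<close>

lemma CN_mono:
  assumes p: "proper_over N N'" and NN: "N' \<subseteq> N"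
  shows "CN N \<subseteq> CN N'"
proof
  fix f assume f: "f \<in> CN N"
  obtain C where C: "compactin X C" "\<And>x. x \<notin> C <#> N \<Longrightarrow> f x = 0"
    using CN_support[OF f] by metis
  obtain C' where C': "compactin X C'" "C <#> N \<subseteq> C' <#> N'"
    using p C(1) unfolding proper_over_def by blast
  show "f \<in> CN N'"
    by (rule CNI[OF CN_cont[OF f] CN_nonneg[OF f] CN_inv[OF f] C'(1)]) (use C C' NN in auto)
qed

text \<open>With v in \<open>V\<close>, every x is v (inv v x), so the right translates of
  \<open>V\<close> cover the group, and they are open because right multiplications are
  homeomorphisms.\<close>

lemma translates_cover:
  assumes V: "openin X V" "V \<noteq> {}" and C: "compactin X C"
  obtains S where "finite S" "S \<subseteq> carrier G" "C \<subseteq> (\<Union>s\<in>S. V #> s)"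
proof -
  obtain v where v: "v \<in> V" "v \<in> carrier G" using V open_carrier by blast
  have "C \<subseteq> \<Union>((\<lambda>s. V #> s) ` carrier G)"
  proof
    fix x assume "x \<in> C"
    then have x: "x \<in> carrier G" using compact_carrier[OF C] by blast
    have "x = v \<otimes> (inv v \<otimes> x)" using x v by (simp flip: m_assoc)
    then show "x \<in> \<Union>((\<lambda>s. V #> s) ` carrier G)"
      using v x unfolding rcos_image by (metis (no_types, lifting) UN_I image_eqI inv_closed m_closed)
  qed
  moreover have "openin X U" if "U \<in> (\<lambda>s. V #> s) ` carrier G" for U
    using that openin_rcos[OF V(1)] by blast
  ultimately obtain \<F> where "finite \<F>" "\<F> \<subseteq> (\<lambda>s. V #> s) ` carrier G" "C \<subseteq> \<Union>\<F>"
    using compactinD[OF C, of "(\<lambda>s. V #> s) ` carrier G"] by blast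
  then show ?thesis using that by (metis finite_subset_image)
qed

lemma haar_pos_functional: "haar A I \<Longrightarrow> pos_functional A I"
  and haar_rt: "haar A I \<Longrightarrow> f \<in> A \<Longrightarrow> s \<in> carrier G \<Longrightarrow> I (rt s f) = I f"
  unfolding haar_def by blast+

text \<open>\<open>f\<close> exceeds half of \<open>f x0\<close> on an open set, finitely many right
  translates of which cover a compact set supporting \<open>g\<close> modulo \<open>N\<close>. The
  sum of the corresponding translates of \<open>f\<close> is bounded below there, and by invariance
  on the full cosets. This yields both finiteness of covering numbers and strict positivity of Haar
  functionals.\<close>

lemma CN_dominated:
  assumes N: "N \<lhd> G" and f: "f \<in> CN N" and x0: "f x0 > 0" and g: "g \<in> CN N"
  obtains k S where "0 \<le> k" "finite S" "S \<subseteq> carrier G" "\<And>x. g x \<le> k * (\<Sum>s\<in>S. rt s f x)"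
proof -
  obtain B where B: "B > 0" "\<And>x. g x \<le> B" using CN_bounded[OF g(1) N] by metis
  obtain C where C: "compactin X C" "\<And>x. x \<notin> C <#> N \<Longrightarrow> g x = 0"
    using CN_support[OF g(1)] by metis
  define V where "V = {x \<in> topspace X. f x \<in> {f x0 / 2<..}}"
  have V: "openin X V"
    unfolding V_def by (rule openin_continuous_map_preimage[OF CN_cont[OF f]]) auto
  have "x0 \<in> V" unfolding V_def using x0 CN_outside[OF f N] by force
  then obtain S where S: "finite S" "S \<subseteq> carrier G" "C \<subseteq> (\<Union>s\<in>S. V #> s)"
    using translates_cover[OF V _ C(1)] by blast
  \<comment> \<open>A point v s of \<open>V #> s\<close> is moved back to v by right translation
    with inv s, hence the inverses of the elements of \<open>S\<close>.\<close>
  define F where "F x = (\<Sum>s\<in>m_inv G ` S. rt s f x)" for x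
  have rtS: "rt s f \<in> CN N" if "s \<in> m_inv G ` S" for s
    using S that by (intro rt_CN[OF f N]) auto
  have F: "F \<in> CN N"
    unfolding F_def by (rule fun_cone_sum[OF fun_cone_CN rtS])
  define k where "k = B * 2 / f x0"
  have k: "0 \<le> k" using B x0 unfolding k_def by simp
  have Fge: "F c \<ge> f x0 / 2" if c: "c \<in> C" for c
  proof -
    obtain s v where s: "s \<in> S" "v \<in> V" "c = v \<otimes> s" using S(3) c unfolding rcos_image by blast
    have v: "v \<in> carrier G" using s(2) unfolding V_def by simp
    have "rt (inv s) f c = f v"
      using s v S(2) unfolding rt_def by (auto simp: m_assoc)
    moreover have "rt (inv s) f c \<le> F c"
      unfolding F_def using S s by (intro member_le_sum) (auto intro: CN_nonneg[OF rtS])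
    ultimately show ?thesis using s(2) unfolding V_def by auto
  qed
  have gF: "g x \<le> k * F x" for x
  proof (cases "x \<in> C <#> N")
    case True
    then obtain c n where cn: "c \<in> C" "n \<in> N" "x = c \<otimes> n" unfolding set_mult_iff by blast
    have "F x = F c" using CN_inv[OF F] cn compact_carrier[OF C(1)] by blast
    moreover have "B = k * (f x0 / 2)" unfolding k_def using x0 by simp
    ultimately show ?thesis
      using B(2)[of x] Fge[OF cn(1)] k by (metis mult_left_mono order_trans)
  next
    case False
    then show ?thesis using C(2) k CN_nonneg[OF F] by simp
  qed
  show ?thesis
    by (rule that[OF k _ _ gF[unfolded F_def]]) (use S in auto)
qed

text \<open>If \<open>I f = 0\<close>, then every function of the cone lies below a multiple of a
  sum of translates of \<open>f\<close> and is annihilated too, which contradicts that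
  \<open>I\<close> is not zero.\<close>

lemma haar_strictly_pos:
  assumes N: "N \<lhd> G" and I: "haar (CN N) I" and f: "f \<in> CN N" and x0: "f x0 > 0"
  shows "I f > 0"
proof (rule ccontr)
  note P = haar_pos_functional[OF I]
  assume "\<not> I f > 0"
  then have If: "I f = 0" using pos_functional_nonneg[OF P f] by simp
  obtain g where g: "g \<in> CN N" "I g \<noteq> 0" using I unfolding haar_def by blast
  obtain k S where k: "0 \<le> k" and S: "finite S" "S \<subseteq> carrier G"
    and gF: "\<And>x. g x \<le> k * (\<Sum>s\<in>S. rt s f x)"
    using CN_dominated[OF N f x0 g(1)] by blast
  define F where "F x = (\<Sum>s\<in>S. rt s f x)" for x
  have rtS: "rt s f \<in> CN N" if "s \<in> S" for s
    using S that by (intro rt_CN[OF f N]) auto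
  have F: "F \<in> CN N"
    unfolding F_def by (rule fun_cone_sum[OF fun_cone_CN rtS])
  have "I F = (\<Sum>s\<in>S. I (rt s f))"
    unfolding F_def by (rule pos_functional_sum[OF fun_cone_CN P rtS])
  also have "\<dots> = 0"
    using S haar_rt[OF I f] If by (intro sum.neutral) auto
  finally have IF: "I F = 0" .
  have "I g \<le> I (\<lambda>x. k * F x)"
    by (rule pos_functional_mono[OF fun_cone_CN P g(1) fun_cone_scale[OF fun_cone_CN F k]])
       (use gF in \<open>simp add: F_def\<close>)
  then show False
    using pos_functional_scale[OF P F k] IF g(2) pos_functional_nonneg[OF P g(1)] by simp
qed

section \<open>Suprema over cosets: continuous functions constant on the cosets of a closed normal
  subgroup\<close>

lemma closedin_projection:
  assumes R: "closedin (prod_topology X X) R" and D: "compactin X D"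
  shows "closedin X {x \<in> carrier G. \<exists>y\<in>D. (x, y) \<in> R}"
proof -
  let ?Y = "subtopology X D"
  have cs: "compact_space ?Y" using D by (simp add: compact_space_subtopology)
  have "closedin (prod_topology X ?Y) ((topspace X \<times> D) \<inter> R)"
    using R unfolding prod_topology_subtopology(2) by (rule closedin_subtopology_Int_closed)
  then have "closedin X (fst ` ((topspace X \<times> D) \<inter> R))"
    using closed_map_fst[OF cs] unfolding closed_map_def by blast
  moreover have "fst ` ((topspace X \<times> D) \<inter> R) = {x \<in> carrier G. \<exists>y\<in>D. (x, y) \<in> R}"
    using closedin_subset[OF R] by (force simp: image_iff)
  ultimately show ?thesis by simp
qed

lemma bdd_above_coset:
  assumes "f \<in> CN N'" "N' \<lhd> G"
  shows "bdd_above ((\<lambda>l. f (x \<otimes> l)) ` N)"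
proof -
  obtain B where "\<And>x. f x \<le> B" using CN_bounded[OF assms] by metis
  then show ?thesis by (intro bdd_aboveI2) auto
qed

lemma coset_sup_ge:
  assumes f: "f \<in> CN N'" "N' \<lhd> G" and "x \<in> carrier G" "l \<in> N"
  shows "f (x \<otimes> l) \<le> coset_sup N f x"
  using assms cSUP_upper[OF _ bdd_above_coset[OF f]] unfolding coset_sup_def by auto

lemma coset_sup_upper:
  assumes f: "f \<in> CN N'" "N' \<lhd> G" and N: "N \<lhd> G"
  shows "f x \<le> coset_sup N f x"
  using coset_sup_ge[OF f, of x \<one> N] normal_one[OF N] CN_outside[OF f]
  by (cases "x \<in> carrier G") (auto simp: coset_sup_def)

lemma coset_sup_le:
  assumes "N \<lhd> G" "x \<in> carrier G" "\<And>l. l \<in> N \<Longrightarrow> f (x \<otimes> l) \<le> a"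
  shows "coset_sup N f x \<le> a"
  using assms normal_one[OF assms(1)] unfolding coset_sup_def by (auto intro!: cSUP_least)

lemma coset_image:
  assumes N: "N \<lhd> G" and x: "x \<in> carrier G" and l: "l \<in> N"
  shows "(\<lambda>k. x \<otimes> l \<otimes> k) ` N = (\<lambda>k. x \<otimes> k) ` N"
proof -
  interpret N: subgroup N G by (rule normal_imp_subgroup[OF N])
  have "x \<otimes> l \<otimes> k \<in> (\<lambda>k. x \<otimes> k) ` N" if "k \<in> N" for k
    using that l x by (auto simp: m_assoc intro!: imageI)
  moreover have "x \<otimes> k \<in> (\<lambda>k. x \<otimes> l \<otimes> k) ` N" if "k \<in> N" for k
  proof -
    have "x \<otimes> k = x \<otimes> l \<otimes> (inv l \<otimes> k)"
      using that l x by (simp add: m_assoc) (simp flip: m_assoc)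
    then show ?thesis using that l by (auto intro!: image_eqI)
  qed
  ultimately show ?thesis by blast
qed

lemma coset_sup_support:
  assumes N: "N \<lhd> G" and N': "N' \<subseteq> N" and C: "compactin X C" "\<And>x. x \<notin> C <#> N' \<Longrightarrow> f x = 0"
    and x: "x \<notin> C <#> N"
  shows "coset_sup N f x = 0"
proof (cases "x \<in> carrier G")
  case True
  have "f (x \<otimes> l) = 0" if l: "l \<in> N" for l
  proof (rule ccontr)
    assume "f (x \<otimes> l) \<noteq> 0"
    then obtain c n where cn: "c \<in> C" "n \<in> N'" "x \<otimes> l = c \<otimes> n"
      using C(2) set_mult_iff by blast
    interpret N: subgroup N G by (rule normal_imp_subgroup[OF N])
    have "c \<in> carrier G" "n \<in> N" using cn N' compact_carrier[OF C(1)] by auto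
    then have "x = c \<otimes> (n \<otimes> inv l)"
      using cn(3) l True by (metis N.mem_carrier inv_closed inv_solve_right m_assoc m_closed)
    then show False using x cn(1) \<open>n \<in> N\<close> l unfolding set_mult_iff by blast
  qed
  then have "(\<lambda>l. f (x \<otimes> l)) ` N = {0}"
    using normal_one[OF N] by auto
  then show ?thesis
    using True by (simp add: coset_sup_def)
qed (simp add: coset_sup_def)

text \<open>The supremum is lower semicontinuous as a supremum of right translates of
  \<open>f\<close>. Upper semicontinuity is where \<open>adm\<close> is used: the superlevel sets
  are intersections of projections of the closed coset relation along compact sets.\<close>

lemma coset_sup_CN:
  assumes N: "adm N" and N': "N' \<lhd> G" "N' \<subseteq> N" and f: "f \<in> CN N'"
  shows "coset_sup N f \<in> CN N"
proof -
  note nN = adm_normal[OF N]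
  obtain C where C: "compactin X C" "\<And>x. x \<notin> C <#> N' \<Longrightarrow> f x = 0"
    using CN_support[OF f] by metis
  let ?R = "{(x, y). x \<in> carrier G \<and> y \<in> carrier G \<and> inv x \<otimes> y \<in> N}"
  have nonneg: "0 \<le> coset_sup N f x" for x
    using coset_sup_upper[OF f N'(1) nN, of x] CN_nonneg[OF f, of x] by linarith
  note supp = coset_sup_support[OF nN N'(2) C]
  have lsc: "openin X {x \<in> topspace X. a < coset_sup N f x}" for a
  proof -
    have "{x \<in> topspace X. a < coset_sup N f x} = (\<Union>l\<in>N. {x \<in> topspace X. rt l f x \<in> {a<..}})"
    proof -
      have ne: "N \<noteq> {}" using normal_one[OF nN] by blast
      have "a < coset_sup N f x \<longleftrightarrow> (\<exists>l\<in>N. a < rt l f x)" if "x \<in> carrier G" for x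
        using that less_cSUP_iff[OF ne bdd_above_coset[OF f N'(1), of x]]
        by (simp add: coset_sup_def rt_def)
      then show ?thesis by auto
    qed
    moreover have "openin X {x \<in> topspace X. rt l f x \<in> {a<..}}" if "l \<in> N" for l
      using that normal_carrier[OF nN]
      by (intro openin_continuous_map_preimage[OF rt_cont[OF CN_cont[OF f]]]) auto
    ultimately show ?thesis by auto
  qed
  have usc: "openin X {x \<in> topspace X. coset_sup N f x < a}" for a
  proof (cases "a \<le> 0")
    case True
    then have "{x \<in> topspace X. coset_sup N f x < a} = {}"
      using nonneg by (auto simp: not_less intro: order_trans)
    then show ?thesis by (simp only: openin_empty)
  next
    case False
    \<comment> \<open>\<open>D b\<close> consists of the points whose coset meets the compact set
      where \<open>f\<close> is at least \<open>b\<close>. All \<open>b < a\<close> are needed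
      because the supremum over a coset is not known to be attained; \<open>b > 0\<close> forces the
      relevant points into the support \<open>C <#> N'\<close>, whence they can be moved into
      \<open>C\<close>.\<close>
    define D where "D b = {x \<in> carrier G. \<exists>y\<in>{y \<in> C. b \<le> f y}. (x, y) \<in> ?R}" for b
    have eq: "{x \<in> topspace X. a \<le> coset_sup N f x} = (\<Inter>b\<in>{0<..<a}. D b)"
    proof (intro equalityI subsetI)
      fix x assume "x \<in> {x \<in> topspace X. a \<le> coset_sup N f x}"
      then have x: "x \<in> carrier G" "a \<le> coset_sup N f x" by auto
      show "x \<in> (\<Inter>b\<in>{0<..<a}. D b)"
      proof
        fix b assume b: "b \<in> {0<..<a}"
        then obtain l where l: "l \<in> N" "b < f (x \<otimes> l)"
          using coset_sup_le[OF nN x(1), of f b] x(2) by (fastforce simp: not_le)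
        then have "f (x \<otimes> l) \<noteq> 0" using b by auto
        then obtain c n where cn: "c \<in> C" "n \<in> N'" "x \<otimes> l = c \<otimes> n"
          using C(2) set_mult_iff by blast
        interpret N: subgroup N G by (rule normal_imp_subgroup[OF nN])
        have cc: "c \<in> carrier G" "n \<in> N" using cn N'(2) compact_carrier[OF C(1)] by auto
        have "f c = f (x \<otimes> l)" using cn CN_inv[OF f cc(1)] by simp
        moreover have "c = x \<otimes> (l \<otimes> inv n)"
          using cn(3) l(1) cc x(1) by (metis N.mem_carrier inv_closed inv_solve_right m_assoc m_closed)
        then have "inv x \<otimes> c = l \<otimes> inv n"
          using x(1) l(1) cc by (metis N.mem_carrier N.m_closed N.m_inv_closed inv_solve_left)
        then have "inv x \<otimes> c \<in> N" using l(1) cc by simp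
        ultimately show "x \<in> D b"
          using l cn(1) cc x(1) unfolding D_def by auto
      qed
    next
      fix x assume x: "x \<in> (\<Inter>b\<in>{0<..<a}. D b)"
      have "a / 2 \<in> {0<..<a}" using False by auto
      then have xc: "x \<in> carrier G" using x unfolding D_def by blast
      have "b \<le> coset_sup N f x" if b: "0 < b" "b < a" for b
      proof -
        obtain y where y: "y \<in> C" "b \<le> f y" "y \<in> carrier G" "inv x \<otimes> y \<in> N"
          using x b unfolding D_def by force
        have "f (x \<otimes> (inv x \<otimes> y)) \<le> coset_sup N f x"
          by (rule coset_sup_ge[OF f N'(1) xc y(4)])
        then show ?thesis using y xc by (simp flip: m_assoc)
      qed
      then have "a \<le> coset_sup N f x"
        using False by (metis dense_le_bounded not_le)
      then show "x \<in> {x \<in> topspace X. a \<le> coset_sup N f x}" using xc by simp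
    qed
    have "closedin X (D b)" for b
    proof -
      have "closedin X {y \<in> topspace X. f y \<in> {b..}}"
        by (rule closedin_continuous_map_preimage[OF CN_cont[OF f]]) auto
      then have "compactin X (C \<inter> {y \<in> topspace X. f y \<in> {b..}})"
        by (rule compact_Int_closedin[OF C(1)])
      also have "C \<inter> {y \<in> topspace X. f y \<in> {b..}} = {y \<in> C. b \<le> f y}"
        using compact_carrier[OF C(1)] by auto
      finally show ?thesis
        unfolding D_def using N unfolding adm_def by (intro closedin_projection) auto
    qed
    then have "closedin X {x \<in> topspace X. a \<le> coset_sup N f x}"
      unfolding eq using False by (intro closedin_INT) (auto intro: dense)
    then have "openin X (topspace X - {x \<in> topspace X. a \<le> coset_sup N f x})" by blast
    moreover have "topspace X - {x \<in> topspace X. a \<le> coset_sup N f x} = {x \<in> topspace X. coset_sup N f x < a}"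
      by auto
    ultimately show ?thesis by simp
  qed
  show ?thesis
  proof (rule CNI[OF _ nonneg _ C(1) supp])
    show "continuous_map X euclideanreal (coset_sup N f)"
      unfolding continuous_map_upper_lower_semicontinuous_lt using lsc usc by blast
    fix x l assume x: "x \<in> carrier G" and l: "l \<in> N"
    have "(\<lambda>k. f (x \<otimes> l \<otimes> k)) ` N = f ` (\<lambda>k. x \<otimes> l \<otimes> k) ` N"
      by (simp only: image_image)
    also have "\<dots> = (\<lambda>k. f (x \<otimes> k)) ` N"
      unfolding coset_image[OF nN x l] by (simp only: image_image)
    finally show "coset_sup N f (x \<otimes> l) = coset_sup N f x"
      using x l normal_carrier[OF nN] unfolding coset_sup_def by auto
  qed
qed

text \<open>The coset supremum of a Urysohn function does it. Such functions serve as the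
  \<open>u\<close> in uniform estimates.\<close>

lemma CN_unit:
  assumes N: "adm N" and C: "compactin X C"
  obtains u where "u \<in> CN N" "\<And>x. x \<in> C <#> N \<Longrightarrow> 1 \<le> u x"
proof -
  obtain f D where f: "f \<in> Cc X" "\<And>x. x \<in> C \<Longrightarrow> f x = 1"
    using Cc_urysohn[OF lc haus C openin_topspace compactin_subset_topspace[OF C]] by metis
  have f1: "f \<in> CN {\<one>}" using f CN_one by simp
  have u: "coset_sup N f \<in> CN N"
    by (rule coset_sup_CN[OF N one_is_normal _ f1]) (simp add: normal_one[OF adm_normal[OF N]])
  have "1 \<le> coset_sup N f x" if x: "x \<in> C <#> N" for x
  proof -
    obtain c n where cn: "c \<in> C" "n \<in> N" "x = c \<otimes> n" using x unfolding set_mult_iff by blast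
    have "coset_sup N f x = coset_sup N f c"
      using CN_inv[OF u] cn compact_carrier[OF C] by blast
    then show ?thesis
      using coset_sup_upper[OF f1 one_is_normal adm_normal[OF N], of c] f(2)[OF cn(1)] by simp
  qed
  then show ?thesis by (rule that[OF u])
qed

lemma CN_nonzero:
  assumes N: "adm N"
  obtains u where "u \<in> CN N" "1 \<le> u \<one>"
proof -
  have "compactin X {\<one>}" by simp
  then obtain u where "u \<in> CN N" "\<And>x. x \<in> {\<one>} <#> N \<Longrightarrow> 1 \<le> u x"
    using CN_unit[OF N] by blast
  moreover have "\<one> \<in> {\<one>} <#> N"
    using normal_one[OF adm_normal[OF N]] unfolding set_mult_iff by force
  ultimately show ?thesis using that by blast
qed

text \<open>Only nonvanishing on the smaller cone is in question, and strict positivity gives it on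
  any function positive at the identity.\<close>

lemma haar_restrict:
  assumes I: "haar (CN N') I" and N': "N' \<lhd> G" and N: "adm N" and s: "CN N \<subseteq> CN N'"
  shows "haar (CN N) I"
proof -
  obtain u where u: "u \<in> CN N" "1 \<le> u \<one>" using CN_nonzero[OF N] .
  then have "I u \<noteq> 0" using haar_strictly_pos[OF N' I, of u \<one>] s by auto
  moreover have "f \<in> CN N'" if "f \<in> CN N" for f using s that by blast
  ultimately show ?thesis
    using I u(1) unfolding haar_def pos_functional_def by blast
qed

text \<open>One nonempty open set suffices: any compact set is covered by finitely many right
  translates of \<open>V\<close>, and normality lets the translating element pass through
  \<open>N\<close> and \<open>N'\<close>. At limits this reduces properness to finding a single good
  \<open>V\<close>.\<close>

lemma proper_overI:
  assumes N: "N \<lhd> G" "N' \<lhd> G" and V: "openin X V" "V \<noteq> {}" and C: "compactin X C"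
    and sub: "V <#> N \<subseteq> C <#> N'"
  shows "proper_over N N'"
  unfolding proper_over_def
proof (intro allI impI)
  fix K assume K: "compactin X K"
  obtain S where S: "finite S" "S \<subseteq> carrier G" "K \<subseteq> (\<Union>s\<in>S. V #> s)"
    using translates_cover[OF V K] by blast
  have "K <#> N \<subseteq> (\<Union>s\<in>S. C #> s) <#> N'"
  proof
    fix x assume "x \<in> K <#> N"
    then obtain k n where kn: "k \<in> K" "n \<in> N" "x = k \<otimes> n" unfolding set_mult_iff by blast
    then obtain s v where s: "s \<in> S" "v \<in> V" "k = v \<otimes> s" using S(3) unfolding rcos_image by blast
    have cc: "v \<in> carrier G" "s \<in> carrier G" "n \<in> carrier G" "inv s \<in> carrier G"
      using s S(2) open_carrier[OF V(1)] kn normal_carrier[OF N(1)] by auto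
    have "s \<otimes> n \<otimes> inv s \<in> N"
      using normal.inv_op_closed2[OF N(1) cc(2) kn(2)] .
    then have "v \<otimes> (s \<otimes> n \<otimes> inv s) \<in> V <#> N"
      using s(2) set_mult_iff by blast
    then have "v \<otimes> (s \<otimes> n \<otimes> inv s) \<in> C <#> N'"
      using sub by blast
    then obtain c n' where c: "c \<in> C" "n' \<in> N'" "v \<otimes> (s \<otimes> n \<otimes> inv s) = c \<otimes> n'"
      unfolding set_mult_iff by blast
    have ccc: "c \<in> carrier G" using c compact_carrier[OF C] by blast
    obtain n'' where n'': "n'' \<in> N'" "c \<otimes> n' \<otimes> s = c \<otimes> s \<otimes> n''"
      using normal_swap_right[OF N(2) ccc c(2) cc(2)] .
    have "x = v \<otimes> (s \<otimes> n \<otimes> inv s) \<otimes> s" using kn s cc by (simp add: m_assoc)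
    then have "x = c \<otimes> s \<otimes> n''" using c(3) n''(2) by simp
    then show "x \<in> (\<Union>s\<in>S. C #> s) <#> N'"
      using c(1) s(1) n''(1) unfolding set_mult_iff rcos_image by blast
  qed
  moreover have "compactin X (\<Union>s\<in>S. C #> s)"
    using S compactin_rcos[OF C] by (intro compactin_Union) auto
  ultimately show "\<exists>C'. compactin X C' \<and> K <#> N \<subseteq> C' <#> N'" by blast
qed

end

section \<open>Haar functionals on locally compact groups\<close>

context rt_group
begin

text \<open>A list of pairs (weight, translating element) encodes a finite nonnegative combination
  of right translates. Repetitions are permitted, so sums and substitutions become list
  operations.\<close>

definition good_list :: "(real \<times> 'a) list \<Rightarrow> bool" where
  "good_list xs \<longleftrightarrow> (\<forall>p\<in>set xs. 0 \<le> fst p \<and> snd p \<in> carrier G)"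

definition weight :: "(real \<times> 'a) list \<Rightarrow> real" where
  "weight xs = (\<Sum>p\<leftarrow>xs. fst p)"

definition comb :: "(real \<times> 'a) list \<Rightarrow> ('a \<Rightarrow> real) \<Rightarrow> 'a \<Rightarrow> real" where
  "comb xs f x = (\<Sum>p\<leftarrow>xs. fst p * rt (snd p) f x)"

lemma comb_simps [simp]:
  "comb [] f = (\<lambda>x. 0)" "comb (p # xs) f = (\<lambda>x. fst p * rt (snd p) f x + comb xs f x)"
  "weight [] = 0" "weight (p # xs) = fst p + weight xs"
  "good_list []" "good_list (p # xs) \<longleftrightarrow> 0 \<le> fst p \<and> snd p \<in> carrier G \<and> good_list xs"
  unfolding comb_def weight_def good_list_def by auto

lemma weight_nonneg: "good_list xs \<Longrightarrow> 0 \<le> weight xs"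
  by (induction xs) auto

lemma comb_append: "comb (xs @ ys) f x = comb xs f x + comb ys f x"
  by (induction xs) auto

lemma weight_append: "weight (xs @ ys) = weight xs + weight ys"
  by (induction xs) auto

lemma good_list_append: "good_list (xs @ ys) \<longleftrightarrow> good_list xs \<and> good_list ys"
  by (induction xs) auto

lemma rt_rt:
  assumes "s \<in> carrier G" "t \<in> carrier G"
  shows "rt s (rt t f) = rt (s \<otimes> t) f"
  using assms unfolding rt_def by (auto simp: m_assoc fun_eq_iff)

lemma rt_one: "(\<And>x. x \<notin> carrier G \<Longrightarrow> f x = 0) \<Longrightarrow> rt \<one> f = f"
  unfolding rt_def by (auto simp: fun_eq_iff)

lemma comb_CN:
  assumes f: "f \<in> CN N" and N: "N \<lhd> G" and xs: "good_list xs"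
  shows "comb xs f \<in> CN N"
  using xs
  by (induction xs) (auto intro!: fun_cone_zero fun_cone_add fun_cone_scale fun_cone_CN rt_CN[OF f N])

lemma haar_comb:
  assumes I: "haar (CN N) I" and f: "f \<in> CN N" and N: "N \<lhd> G" and xs: "good_list xs"
  shows "I (comb xs f) = weight xs * I f"
  using xs
proof (induction xs)
  case Nil
  show ?case using pos_functional_zero[OF haar_pos_functional[OF I] fun_cone_CN] by simp
next
  case (Cons p xs)
  note P = haar_pos_functional[OF I]
  have p: "0 \<le> fst p" "snd p \<in> carrier G" "good_list xs" using Cons by auto
  have 1: "rt (snd p) f \<in> CN N" by (rule rt_CN[OF f N p(2)])
  have "I (comb (p # xs) f) = fst p * I (rt (snd p) f) + I (comb xs f)"
    using pos_functional_add[OF P fun_cone_scale[OF fun_cone_CN 1 p(1)] comb_CN[OF f N p(3)]]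
      pos_functional_scale[OF P 1 p(1)] by simp
  then show ?case using Cons.IH[OF p(3)] haar_rt[OF I f p(2)] by (simp add: algebra_simps)
qed

text \<open>Haar's covering number (f : g): the least total weight of a combination of right
  translates of \<open>g\<close> that dominates \<open>f\<close>.\<close>

definition cov :: "('a \<Rightarrow> real) \<Rightarrow> ('a \<Rightarrow> real) \<Rightarrow> real" where
  "cov f g = Inf (weight ` {xs. good_list xs \<and> (\<forall>x. f x \<le> comb xs g x)})"

lemma cov_bdd: "bdd_below (weight ` {xs. good_list xs \<and> (\<forall>x. f x \<le> comb xs g x)})"
  by (rule bdd_belowI2[of _ 0]) (auto simp: weight_nonneg)

lemma cov_le: "good_list xs \<Longrightarrow> (\<And>x. f x \<le> comb xs g x) \<Longrightarrow> cov f g \<le> weight xs"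
  unfolding cov_def by (rule cINF_lower[OF cov_bdd]) auto

lemma sum_list_comb:
  assumes "finite S"
  obtains ys where "set ys = (\<lambda>s. (c s, h s)) ` S"
    "\<And>f x. comb ys f x = (\<Sum>s\<in>S. c s * rt (h s) f x)" "weight ys = (\<Sum>s\<in>S. c s)"
proof -
  obtain ss where ss: "set ss = S" "distinct ss" using finite_distinct_list[OF assms] by blast
  have "comb (map (\<lambda>s. (c s, h s)) ss) f x = (\<Sum>s\<in>S. c s * rt (h s) f x)" for f x
    using sum_list_distinct_conv_sum_set[OF ss(2), of "\<lambda>s. c s * rt (h s) f x"] ss(1)
    by (simp add: comb_def o_def)
  moreover have "weight (map (\<lambda>s. (c s, h s)) ss) = (\<Sum>s\<in>S. c s)"
    using sum_list_distinct_conv_sum_set[OF ss(2), of c] ss(1)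
    by (simp add: weight_def o_def)
  ultimately show ?thesis using that[of "map (\<lambda>s. (c s, h s)) ss"] ss by auto
qed

lemma cov_nonempty:
  assumes f: "f \<in> Cc X" and g: "g \<in> Cc X" and x0: "g x0 > 0"
  shows "{xs. good_list xs \<and> (\<forall>x. f x \<le> comb xs g x)} \<noteq> {}"
proof -
  obtain k S where k: "0 \<le> k" "finite S" "S \<subseteq> carrier G" "\<And>x. f x \<le> k * (\<Sum>s\<in>S. rt s g x)"
    using CN_dominated[OF one_is_normal, of g x0 f] f g x0 unfolding CN_one by metis
  obtain ys where "set ys = (\<lambda>s. (k, s)) ` S" "\<And>f x. comb ys f x = (\<Sum>s\<in>S. k * rt s f x)"
    using sum_list_comb[OF k(2), of "\<lambda>s. k" "\<lambda>s. s"] by metis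
  then have "good_list ys \<and> (\<forall>x. f x \<le> comb ys g x)"
    using k unfolding good_list_def by (auto simp: sum_distrib_left)
  then show ?thesis by blast
qed

lemma cov_approx:
  assumes f: "f \<in> Cc X" and g: "g \<in> Cc X" and x0: "g x0 > 0" and e: "e > 0"
  obtains xs where "good_list xs" "\<And>x. f x \<le> comb xs g x" "weight xs < cov f g + e"
proof -
  have "\<exists>w\<in>weight ` {xs. good_list xs \<and> (\<forall>x. f x \<le> comb xs g x)}. w < cov f g + e"
    using cInf_lessD[of "weight ` {xs. good_list xs \<and> (\<forall>x. f x \<le> comb xs g x)}" "cov f g + e"]
      cov_nonempty[OF f g x0] e unfolding cov_def by auto
  then show ?thesis using that by blast
qed

lemma cov_nonneg:
  assumes f: "f \<in> Cc X" and g: "g \<in> Cc X" and x0: "g x0 > 0"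
  shows "0 \<le> cov f g"
  unfolding cov_def using cov_nonempty[OF assms] by (intro cINF_greatest) (auto simp: weight_nonneg)

lemma cov_add:
  assumes f: "f \<in> Cc X" "f' \<in> Cc X" and g: "g \<in> Cc X" and x0: "g x0 > 0"
  shows "cov (\<lambda>x. f x + f' x) g \<le> cov f g + cov f' g"
proof (rule field_le_epsilon)
  fix e :: real assume "e > 0"
  then have e: "e / 2 > 0" by simp
  obtain xs where xs: "good_list xs" "\<And>x. f x \<le> comb xs g x" "weight xs < cov f g + e / 2"
    using cov_approx[OF f(1) g x0 e] by metis
  obtain ys where ys: "good_list ys" "\<And>x. f' x \<le> comb ys g x" "weight ys < cov f' g + e / 2"
    using cov_approx[OF f(2) g x0 e] by metis
  have "cov (\<lambda>x. f x + f' x) g \<le> weight (xs @ ys)"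
    by (rule cov_le) (use xs ys in \<open>auto simp: good_list_append comb_append intro: add_mono\<close>)
  then show "cov (\<lambda>x. f x + f' x) g \<le> cov f g + cov f' g + e"
    using xs(3) ys(3) by (simp add: weight_append)
qed

lemma cov_scale_le:
  assumes f: "f \<in> Cc X" and g: "g \<in> Cc X" and x0: "g x0 > 0" and c: "0 \<le> c"
  shows "cov (\<lambda>x. c * f x) g \<le> c * cov f g"
proof (rule field_le_epsilon)
  fix e :: real assume e: "e > 0"
  then have "e / (c + 1) > 0" using c by simp
  then obtain xs where xs: "good_list xs" "\<And>x. f x \<le> comb xs g x" "weight xs < cov f g + e / (c + 1)"
    using cov_approx[OF f(1) g x0] by metis
  have w: "comb (map (\<lambda>p. (c * fst p, snd p)) xs) g x = c * comb xs g x" for x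
    by (induction xs) (auto simp: algebra_simps)
  have "weight (map (\<lambda>p. (c * fst p, snd p)) xs) = c * weight xs"
    by (induction xs) (auto simp: algebra_simps)
  moreover have "cov (\<lambda>x. c * f x) g \<le> weight (map (\<lambda>p. (c * fst p, snd p)) xs)"
    by (rule cov_le) (use xs c in \<open>auto simp: w good_list_def intro: mult_left_mono\<close>)
  moreover have "c * weight xs \<le> c * (cov f g + e / (c + 1))"
    using xs(3) c by (intro mult_left_mono) auto
  moreover have "c * (e / (c + 1)) \<le> e"
    using c e by (simp add: field_simps)
  ultimately show "cov (\<lambda>x. c * f x) g \<le> c * cov f g + e"
    by (simp add: distrib_left)
qed

lemma cov_zero:
  assumes g: "g \<in> Cc X" and x0: "g x0 > 0"
  shows "cov (\<lambda>x. 0) g = 0"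
  using cov_le[of "[]" "\<lambda>x. 0" g] cov_nonneg[OF fun_cone_zero[OF fun_cone_Cc] g x0] by simp

lemma cov_scale:
  assumes f: "f \<in> Cc X" and g: "g \<in> Cc X" and x0: "g x0 > 0" and c: "0 \<le> c"
  shows "cov (\<lambda>x. c * f x) g = c * cov f g"
proof (cases "c = 0")
  case True
  then show ?thesis using cov_zero[OF g x0] by simp
next
  case False
  have "cov (\<lambda>x. inverse c * (c * f x)) g \<le> inverse c * cov (\<lambda>x. c * f x) g"
    by (rule cov_scale_le[OF fun_cone_scale[OF fun_cone_Cc f c] g x0]) (use c in simp)
  moreover have "(\<lambda>x. inverse c * (c * f x)) = f" using False by (auto simp: fun_eq_iff)
  ultimately have "c * cov f g \<le> cov (\<lambda>x. c * f x) g"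
    using False c by (simp add: field_simps)
  then show ?thesis using cov_scale_le[OF assms] by simp
qed

text \<open>A combination of translates of \<open>g\<close> dominating \<open>h\<close> is
  substituted into a combination of translates of \<open>h\<close> dominating \<open>f\<close>; the
  total weights multiply. The denominators with \<open>+ 1\<close> only guard against division by
  zero.\<close>

lemma cov_trans:
  assumes f: "f \<in> Cc X" and h: "h \<in> Cc X" "h y0 > 0" and g: "g \<in> Cc X" and x0: "g x0 > 0"
  shows "cov f g \<le> cov f h * cov h g"
proof -
  have *: "cov f g \<le> weight xs * cov h g" if xs: "good_list xs" "\<And>x. f x \<le> comb xs h x" for xs
  proof (rule field_le_epsilon)
    fix e :: real assume e: "e > 0"
    have w: "0 \<le> weight xs" by (rule weight_nonneg[OF xs(1)])
    then have "e / (weight xs + 1) > 0" using e by simp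
    then obtain ys where ys: "good_list ys" "\<And>x. h x \<le> comb ys g x"
        "weight ys < cov h g + e / (weight xs + 1)"
      using cov_approx[OF h(1) g x0] by metis
    \<comment> \<open>Substitution multiplies the weights; translating a translate by s and t gives
      the translate by \<open>s \<otimes> t\<close>, in this order by the convention of
      \<open>rt\<close>.\<close>
    define zs where "zs = concat (map (\<lambda>p. map (\<lambda>q. (fst p * fst q, snd p \<otimes> snd q)) ys) xs)"
    have in1: "comb (map (\<lambda>q. (c * fst q, s \<otimes> snd q)) ys) g x = c * rt s (comb ys g) x"
      if "s \<in> carrier G" "good_list ys" for c s x ys
      using that by (induction ys) (auto simp: algebra_simps m_assoc rt_def)
    have in2: "weight (map (\<lambda>q. (c * fst q, s \<otimes> snd q)) ys) = c * weight ys" for c s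
      by (induction ys) (auto simp: algebra_simps)
    have "comb xs h x \<le> comb zs g x" for x
      using xs(1) unfolding zs_def
    proof (induction xs)
      case (Cons p xs)
      have "rt (snd p) h x \<le> rt (snd p) (comb ys g) x" using ys(2) by (simp add: rt_def)
      then have "fst p * rt (snd p) h x \<le> fst p * rt (snd p) (comb ys g) x"
        using Cons.prems by (intro mult_left_mono) auto
      then show ?case using Cons by (simp add: comb_append in1 ys(1))
    qed simp
    then have "f x \<le> comb zs g x" for x using xs(2) order_trans by blast
    moreover have "good_list zs"
      using xs(1) ys(1) unfolding zs_def good_list_def by auto
    ultimately have "cov f g \<le> weight zs" by (intro cov_le)
    also have "weight zs = weight xs * weight ys"
      unfolding zs_def by (induction xs) (auto simp: weight_append in2 algebra_simps)
    also have "\<dots> \<le> weight xs * (cov h g + e / (weight xs + 1))"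
      using ys(3) w by (intro mult_left_mono) auto
    also have "weight xs * (e / (weight xs + 1)) \<le> e"
      using w e by (simp add: field_simps)
    then have "weight xs * (cov h g + e / (weight xs + 1)) \<le> weight xs * cov h g + e"
      by (simp add: distrib_left)
    finally show "cov f g \<le> weight xs * cov h g + e" .
  qed
  have n: "0 \<le> cov h g" by (rule cov_nonneg[OF h(1) g x0])
  show ?thesis
  proof (rule field_le_epsilon)
    fix e :: real assume e: "e > 0"
    then have "e / (cov h g + 1) > 0" using n by simp
    then obtain xs where xs: "good_list xs" "\<And>x. f x \<le> comb xs h x" "weight xs < cov f h + e / (cov h g + 1)"
      using cov_approx[OF f h] by metis
    have "cov f g \<le> weight xs * cov h g" by (rule *[OF xs(1,2)])
    also have "\<dots> \<le> (cov f h + e / (cov h g + 1)) * cov h g"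
      using xs(3) n by (intro mult_right_mono) auto
    also have "e / (cov h g + 1) * cov h g \<le> e" using n e by (simp add: field_simps)
    then have "(cov f h + e / (cov h g + 1)) * cov h g \<le> cov f h * cov h g + e"
      by (simp add: distrib_right)
    finally show "cov f g \<le> cov f h * cov h g + e" .
  qed
qed

lemma cov_rt_le:
  assumes f: "f \<in> Cc X" and g: "g \<in> Cc X" and x0: "g x0 > 0" and s: "s \<in> carrier G"
  shows "cov (rt s f) g \<le> cov f g"
proof (rule field_le_epsilon)
  fix e :: real assume "e > 0"
  then obtain xs where xs: "good_list xs" "\<And>x. f x \<le> comb xs g x" "weight xs < cov f g + e"
    using cov_approx[OF f g x0] by metis
  have w: "comb (map (\<lambda>p. (fst p, s \<otimes> snd p)) xs) g x = rt s (comb xs g) x" for x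
    using xs(1) by (induction xs) (auto simp: m_assoc s rt_def)
  have "weight (map (\<lambda>p. (fst p, s \<otimes> snd p)) xs) = weight xs"
    by (induction xs) auto
  moreover have "cov (rt s f) g \<le> weight (map (\<lambda>p. (fst p, s \<otimes> snd p)) xs)"
    by (rule cov_le) (use xs s in \<open>auto simp: w good_list_def rt_def\<close>)
  ultimately show "cov (rt s f) g \<le> cov f g + e" using xs(3) by simp
qed

lemma rt_Cc: "f \<in> Cc X \<Longrightarrow> s \<in> carrier G \<Longrightarrow> rt s f \<in> Cc X"
  using rt_CN[OF _ one_is_normal, of f s] unfolding CN_one .

lemma cov_rt:
  assumes f: "f \<in> Cc X" and g: "g \<in> Cc X" and x0: "g x0 > 0" and s: "s \<in> carrier G"
  shows "cov (rt s f) g = cov f g"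
proof (rule antisym[OF cov_rt_le[OF assms]])
  have "rt (inv s) (rt s f) = f"
    using Cc_outside[OF f] by (simp add: rt_rt s rt_one)
  then show "cov f g \<le> cov (rt s f) g"
    using cov_rt_le[OF rt_Cc[OF f s] g x0, of "inv s"] s by simp
qed

text \<open>Every translate of \<open>g\<close> is at most \<open>B\<close>, so a combination
  dominating \<open>f\<close> has weight at least \<open>f y0 / B\<close>. This keeps the
  normalising denominators below away from zero.\<close>

lemma cov_pos:
  assumes f: "f \<in> Cc X" "f y0 > 0" and g: "g \<in> Cc X" and x0: "g x0 > 0"
  shows "0 < cov f g"
proof -
  obtain B where B: "B > 0" "\<And>x. g x \<le> B" using Cc_bounded[OF g] by metis
  have "f y0 / B \<le> cov f g"
  proof (rule field_le_epsilon)
    fix e :: real assume "e > 0"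
    then obtain xs where xs: "good_list xs" "\<And>x. f x \<le> comb xs g x" "weight xs < cov f g + e"
      using cov_approx[OF f(1) g x0] by metis
    have "comb xs g y0 \<le> weight xs * B"
      using xs(1)
    proof (induction xs)
      case (Cons p xs)
      have "rt (snd p) g y0 \<le> B" using B by (simp add: rt_def)
      then have "fst p * rt (snd p) g y0 \<le> fst p * B" using Cons.prems by (intro mult_left_mono) auto
      then show ?case using Cons by (simp add: algebra_simps)
    qed simp
    then have "f y0 \<le> weight xs * B" using xs(2) order_trans by blast
    then have "f y0 / B \<le> weight xs" using B by (simp add: field_simps)
    then show "f y0 / B \<le> cov f g + e" using xs(3) by simp
  qed
  then show ?thesis using f(2) B(1) by (meson divide_pos_pos less_le_trans)
qed

end

section \<open>Uniform continuity and Haar's theorem on locally compact topological groups\<close>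

locale lc_group = rt_group +
  assumes mult_cont: "continuous_map (prod_topology X X) X (\<lambda>(x, y). x \<otimes> y)"
    and inv_cont: "continuous_map X X (\<lambda>x. inv x)"
begin

definition finv :: "('a \<Rightarrow> real) \<Rightarrow> 'a \<Rightarrow> real" where
  "finv f = (\<lambda>x. if x \<in> carrier G then f (inv x) else 0)"

lemma mult_cont':
  assumes "continuous_map Y X f" "continuous_map Y X g"
  shows "continuous_map Y X (\<lambda>x. f x \<otimes> g x)"
proof -
  have "continuous_map Y X ((\<lambda>(x, y). x \<otimes> y) \<circ> (\<lambda>x. (f x, g x)))"
    by (rule continuous_map_compose[OF _ mult_cont]) (simp add: continuous_map_pairwise o_def assms)
  then show ?thesis by (simp add: o_def)
qed

lemma inv_cont':
  assumes "continuous_map Y X f"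
  shows "continuous_map Y X (\<lambda>x. inv (f x))"
  using continuous_map_compose[OF assms inv_cont] by (simp add: o_def)

lemma finv_Cc:
  assumes f: "f \<in> Cc X"
  shows "finv f \<in> Cc X"
proof -
  obtain C where C: "compactin X C" "\<And>x. x \<notin> C \<Longrightarrow> f x = 0"
    using Cc_support[OF f] by metis
  show ?thesis
  proof (rule CcI)
    have "continuous_map X euclideanreal (f \<circ> (\<lambda>x. inv x))"
      by (rule continuous_map_compose[OF inv_cont Cc_cont[OF f]])
    then show "continuous_map X euclideanreal (finv f)"
      by (rule continuous_map_eq) (simp add: finv_def)
    show "0 \<le> finv f x" for x unfolding finv_def using Cc_nonneg[OF f] by simp
    show "compactin X ((\<lambda>x. inv x) ` C)" by (rule image_compactin[OF C(1) inv_cont])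
    show "finv f x = 0" if "x \<notin> (\<lambda>x. inv x) ` C" for x
    proof (cases "x \<in> carrier G")
      case True
      then have "inv x \<notin> C" using that by (metis image_eqI inv_inv)
      then show ?thesis using C(2) by (simp add: finv_def)
    qed (simp add: finv_def)
  qed
qed

text \<open>The tube lemma around {1} \<times> K gives the estimate for y in the support
  \<open>K\<close>. Intersecting with the set of inverses makes the neighbourhood symmetric, which
  handles y outside \<open>K\<close> with v y inside: translate back by inv v.\<close>

lemma unif_cont_left:
  assumes f: "f \<in> Cc X" and e: "e > 0"
  obtains V where "openin X V" "\<one> \<in> V"
    "\<And>v y. v \<in> V \<Longrightarrow> y \<in> carrier G \<Longrightarrow> \<bar>f (v \<otimes> y) - f y\<bar> \<le> e"
proof -
  obtain K where K: "compactin X K" "\<And>x. x \<notin> K \<Longrightarrow> f x = 0"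
    using Cc_support[OF f] by metis
  let ?XX = "prod_topology X X"
  have c1: "continuous_map ?XX X (\<lambda>p. fst p \<otimes> snd p)"
    by (intro mult_cont' continuous_map_fst continuous_map_snd)
  have "continuous_map ?XX euclideanreal (f \<circ> (\<lambda>p. fst p \<otimes> snd p))"
    by (rule continuous_map_compose[OF c1 Cc_cont[OF f]])
  moreover have "continuous_map ?XX euclideanreal (f \<circ> snd)"
    by (rule continuous_map_compose[OF continuous_map_snd Cc_cont[OF f]])
  ultimately have c2: "continuous_map ?XX euclideanreal (\<lambda>p. \<bar>f (fst p \<otimes> snd p) - f (snd p)\<bar>)"
    by (intro continuous_map_real_abs continuous_map_diff) (simp_all add: o_def)
  define W where "W = {p \<in> topspace ?XX. \<bar>f (fst p \<otimes> snd p) - f (snd p)\<bar> \<in> {..<e}}"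
  have W: "openin ?XX W"
    unfolding W_def by (rule openin_continuous_map_preimage[OF c2]) auto
  have "{\<one>} \<times> K \<subseteq> W"
    using compact_carrier[OF K(1)] e unfolding W_def by auto
  then obtain U V where UV: "openin X U" "\<one> \<in> U" "K \<subseteq> V" "U \<times> V \<subseteq> W"
    using tube_lemma_right[OF W K(1), of \<one>] by auto
  define U' where "U' = {x \<in> topspace X. inv x \<in> U}"
  have U': "openin X U'"
    unfolding U'_def by (rule openin_continuous_map_preimage[OF inv_cont UV(1)])
  have *: "\<bar>f (v \<otimes> y) - f y\<bar> \<le> e" if "v \<in> U" "y \<in> K" for v y
    using that UV unfolding W_def by fastforce
  show ?thesis
  proof (rule that[of "U \<inter> U'"])
    show "openin X (U \<inter> U')" using UV U' by blast
    show "\<one> \<in> U \<inter> U'" using UV unfolding U'_def by simp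
    fix v y assume v: "v \<in> U \<inter> U'" and y: "y \<in> carrier G"
    have vc: "v \<in> carrier G" using v unfolding U'_def by simp
    show "\<bar>f (v \<otimes> y) - f y\<bar> \<le> e"
    proof (cases "y \<in> K")
      case True
      then show ?thesis using * v by blast
    next
      case yK: False
      show ?thesis
      proof (cases "v \<otimes> y \<in> K")
        case True
        have "\<bar>f (inv v \<otimes> (v \<otimes> y)) - f (v \<otimes> y)\<bar> \<le> e"
          using * v True unfolding U'_def by blast
        then show ?thesis using vc y by (simp add: abs_minus_commute flip: m_assoc)
      next
        case False
        then show ?thesis using yK K(2) e by simp
      qed
    qed
  qed
qed

text \<open>Inversion exchanges left and right translations, so the left version is applied to the
  reflected function \<open>finv f\<close>.\<close>

lemma unif_cont_right:
  assumes f: "f \<in> Cc X" and e: "e > 0"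
  obtains V where "openin X V" "\<one> \<in> V"
    "\<And>v y. v \<in> V \<Longrightarrow> y \<in> carrier G \<Longrightarrow> \<bar>f (y \<otimes> v) - f y\<bar> \<le> e"
proof -
  obtain V where V: "openin X V" "\<one> \<in> V"
    "\<And>v y. v \<in> V \<Longrightarrow> y \<in> carrier G \<Longrightarrow> \<bar>finv f (v \<otimes> y) - finv f y\<bar> \<le> e"
    using unif_cont_left[OF finv_Cc[OF f] e] by metis
  show ?thesis
  proof (rule that[of "{x \<in> topspace X. inv x \<in> V}"])
    show "openin X {x \<in> topspace X. inv x \<in> V}"
      by (rule openin_continuous_map_preimage[OF inv_cont V(1)])
    show "\<one> \<in> {x \<in> topspace X. inv x \<in> V}" using V by simp
    fix v y assume v: "v \<in> {x \<in> topspace X. inv x \<in> V}" and y: "y \<in> carrier G"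
    have "\<bar>finv f (inv v \<otimes> inv y) - finv f (inv y)\<bar> \<le> e"
      using V(3) v y by simp
    then show "\<bar>f (y \<otimes> v) - f y\<bar> \<le> e"
      using v y by (simp add: finv_def inv_mult_group)
  qed
qed

text \<open>The shares \<open>h f1\<close> and \<open>h f2\<close> of the two functions in their sum
  are almost constant on every translate of a narrow bump. A combination dominating the sum is
  therefore split by multiplying each weight by the share at one point. The error is a multiple of
  \<open>cov f0 g\<close> because that is the denominator used for normalisation.\<close>

lemma cov_almost_additive:
  assumes f1: "f1 \<in> Cc X" and f2: "f2 \<in> Cc X" and f0: "f0 \<in> Cc X" "f0 z0 > 0" and e: "e > 0"
  obtains V where "openin X V" "\<one> \<in> V"
    "\<And>g x0. g \<in> Cc X \<Longrightarrow> g x0 > 0 \<Longrightarrow> (\<And>x. x \<notin> V \<Longrightarrow> g x = 0) \<Longrightarrow>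
        cov f1 g + cov f2 g \<le> cov (\<lambda>x. f1 x + f2 x) g + e * cov f0 g"
proof -
  obtain C1 where C1: "compactin X C1" "\<And>x. x \<notin> C1 \<Longrightarrow> f1 x = 0"
    using Cc_support[OF f1] by metis
  obtain C2 where C2: "compactin X C2" "\<And>x. x \<notin> C2 \<Longrightarrow> f2 x = 0"
    using Cc_support[OF f2] by metis
  have C: "compactin X (C1 \<union> C2)" by (rule compactin_Un[OF C1(1) C2(1)])
  obtain f' where f': "f' \<in> Cc X" "\<And>x. x \<in> C1 \<union> C2 \<Longrightarrow> f' x = 1"
    using Cc_urysohn[OF lc haus C openin_topspace compactin_subset_topspace[OF C]] by metis
  define f12 where "f12 = (\<lambda>x. f1 x + f2 x)"
  have f12: "f12 \<in> Cc X" unfolding f12_def by (rule fun_cone_add[OF fun_cone_Cc f1 f2])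
  define M1 where "M1 = cov f12 f0"
  define M2 where "M2 = cov f' f0"
  have M: "0 \<le> M1" "0 \<le> M2"
    unfolding M1_def M2_def using cov_nonneg[OF _ f0] f12 f'(1) by auto
  \<comment> \<open>The final error is d (2 cov f12 g + cov f' g + 2 d cov f' g). With
    \<open>d \<le> 1\<close> the bracket is at most (2 M1 + 3 M2) cov f0 g, which explains the
    denominator.\<close>
  define d where "d = min 1 (e / (2 * M1 + 3 * M2 + 1))"
  have d: "d > 0" "d \<le> 1" using M e unfolding d_def by auto
  have "d * (2 * M1 + 3 * M2) \<le> e / (2 * M1 + 3 * M2 + 1) * (2 * M1 + 3 * M2)"
    using M unfolding d_def by (intro mult_right_mono) auto
  also have "\<dots> \<le> e" using M e by (simp add: field_simps)
  finally have dM: "d * (2 * M1 + 3 * M2) \<le> e" .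
  define h where "h f = (\<lambda>x. f x * (1 / (f12 x + d)))" for f :: "'a \<Rightarrow> real"
  have n12: "0 \<le> f12 x" for x by (rule Cc_nonneg[OF f12])
  have h_Cc: "h f \<in> Cc X" if "f \<in> Cc X" for f
    unfolding h_def
  proof (rule Cc_mult[OF that])
    show "continuous_map X euclideanreal (\<lambda>x. 1 / (f12 x + d))"
      using n12 d by (intro continuous_map_real_divide continuous_map_add Cc_cont[OF f12] continuous_intros)
        (metis add_nonneg_pos less_irrefl)
    show "0 \<le> 1 / (f12 x + d)" for x using n12[of x] d by simp
  qed
  obtain V1 where V1: "openin X V1" "\<one> \<in> V1"
    "\<And>v y. v \<in> V1 \<Longrightarrow> y \<in> carrier G \<Longrightarrow> \<bar>h f1 (v \<otimes> y) - h f1 y\<bar> \<le> d"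
    using unif_cont_left[OF h_Cc[OF f1] d(1)] by metis
  obtain V2 where V2: "openin X V2" "\<one> \<in> V2"
    "\<And>v y. v \<in> V2 \<Longrightarrow> y \<in> carrier G \<Longrightarrow> \<bar>h f2 (v \<otimes> y) - h f2 y\<bar> \<le> d"
    using unif_cont_left[OF h_Cc[OF f2] d(1)] by metis
  \<comment> \<open>\<open>F\<close> agrees with \<open>f12 + d\<close> on the supports of
    \<open>f1\<close> and \<open>f2\<close>, so that \<open>f1\<close> and \<open>f2\<close> are
    exactly their shares times \<open>F\<close>, and unlike \<open>f12 + d\<close> it has compact
    support.\<close>
  define F where "F = (\<lambda>x. f12 x + d * f' x)"
  have df': "(\<lambda>x. d * f' x) \<in> Cc X" by (rule fun_cone_scale[OF fun_cone_Cc f'(1)]) (use d in simp)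
  have F: "F \<in> Cc X" unfolding F_def by (rule fun_cone_add[OF fun_cone_Cc f12 df'])
  have hF: "f1 x = h f1 x * F x" "f2 x = h f2 x * F x" for x
  proof -
    have p: "f12 x + d > 0" using n12[of x] d by simp
    have "f x = h f x * F x" if "f x \<noteq> 0 \<Longrightarrow> x \<in> C1 \<union> C2" for f
    proof (cases "f x = 0")
      case False
      then have "F x = f12 x + d" using f'(2) that unfolding F_def by simp
      then show ?thesis using p unfolding h_def by simp
    qed (simp add: h_def)
    then show "f1 x = h f1 x * F x" "f2 x = h f2 x * F x" using C1(2) C2(2) by blast+
  qed
  have hsum: "h f1 x + h f2 x \<le> 1" for x
  proof -
    have "h f1 x + h f2 x = f12 x / (f12 x + d)" by (simp add: h_def f12_def add_divide_distrib)
    then show ?thesis using n12[of x] d by simp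
  qed
  show ?thesis
  proof (rule that[of "V1 \<inter> V2"])
    show "openin X (V1 \<inter> V2)" "\<one> \<in> V1 \<inter> V2" using V1 V2 by auto
    fix g x0 assume g: "g \<in> Cc X" and x0: "g x0 > 0" and g0: "\<And>x. x \<notin> V1 \<inter> V2 \<Longrightarrow> g x = 0"
    have main: "cov f1 g + cov f2 g \<le> (1 + 2 * d) * weight xs"
      if xs: "good_list xs" "\<And>x. F x \<le> comb xs g x" for xs
    proof -
      \<comment> \<open>If g (x s) is not 0, then x s lies in \<open>V1 \<inter> V2\<close>, and x =
        (x s) inv s; hence the share at x differs from the share at inv s by at most
        \<open>d\<close>. The point inv s depends on the list entry only, not on x.\<close>
      define ys where "ys f = map (\<lambda>p. (fst p * (h f (inv (snd p)) + d), snd p)) xs" for f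
      have hn: "0 \<le> h f1 x" "0 \<le> h f2 x" for x
        using Cc_nonneg[OF h_Cc[OF f1]] Cc_nonneg[OF h_Cc[OF f2]] by auto
      have *: "h f x * comb xs g x \<le> comb (ys f) g x"
        if V: "\<And>v y. v \<in> V1 \<inter> V2 \<Longrightarrow> y \<in> carrier G \<Longrightarrow> \<bar>h f (v \<otimes> y) - h f y\<bar> \<le> d" for f x
        using xs(1) unfolding ys_def
      proof (induction xs)
        case (Cons p xs)
        have p: "0 \<le> fst p" "snd p \<in> carrier G" "good_list xs" using Cons.prems by auto
        have "h f x * rt (snd p) g x \<le> (h f (inv (snd p)) + d) * rt (snd p) g x"
        proof (cases "x \<in> carrier G \<and> x \<otimes> snd p \<in> V1 \<inter> V2")
          case True
          have "\<bar>h f (x \<otimes> snd p \<otimes> inv (snd p)) - h f (inv (snd p))\<bar> \<le> d"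
            using True p by (intro V) auto
          then have "h f x \<le> h f (inv (snd p)) + d" using True p by (simp add: m_assoc)
          then show ?thesis using Cc_nonneg[OF g] True by (intro mult_right_mono) (auto simp: rt_def)
        next
          case False
          then show ?thesis using g0 by (auto simp: rt_def)
        qed
        then have "fst p * (h f x * rt (snd p) g x) \<le> fst p * ((h f (inv (snd p)) + d) * rt (snd p) g x)"
          using p by (intro mult_left_mono) auto
        then show ?case using Cons.IH[OF p(3)] by (simp add: algebra_simps)
      qed simp
      have c: "cov f g \<le> weight (ys f)"
        if V: "\<And>v y. v \<in> V1 \<inter> V2 \<Longrightarrow> y \<in> carrier G \<Longrightarrow> \<bar>h f (v \<otimes> y) - h f y\<bar> \<le> d"
          and n: "\<And>x. 0 \<le> h f x" and fh: "\<And>x. f x = h f x * F x" for f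
      proof (rule cov_le)
        show "good_list (ys f)"
          using xs(1) n d unfolding good_list_def ys_def by auto
        fix x
        have "f x \<le> h f x * comb xs g x"
          using fh[of x] mult_left_mono[OF xs(2)[of x] n[of x]] by simp
        then show "f x \<le> comb (ys f) g x" using *[OF V, of x] by linarith
      qed
      have "weight (ys f1) + weight (ys f2) \<le> (1 + 2 * d) * weight xs"
        using xs(1) unfolding ys_def
      proof (induction xs)
        case (Cons p xs)
        have "h f1 (inv (snd p)) + d + (h f2 (inv (snd p)) + d) \<le> 1 + 2 * d"
          using hsum[of "inv (snd p)"] by simp
        then have "fst p * (h f1 (inv (snd p)) + d + (h f2 (inv (snd p)) + d)) \<le> fst p * (1 + 2 * d)"
          using Cons.prems by (intro mult_left_mono) auto
        then show ?case using Cons by (simp add: algebra_simps)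
      qed simp
      then show ?thesis
        using c[of f1] c[of f2] V1(3) V2(3) hn hF by fastforce
    qed
    have "(cov f1 g + cov f2 g) / (1 + 2 * d) \<le> cov F g"
    proof (rule field_le_epsilon)
      fix r :: real assume "r > 0"
      then obtain xs where xs: "good_list xs" "\<And>x. F x \<le> comb xs g x" "weight xs < cov F g + r"
        using cov_approx[OF F g x0] by metis
      have "(cov f1 g + cov f2 g) / (1 + 2 * d) \<le> weight xs"
        using main[OF xs(1,2)] d by (simp add: field_simps)
      then show "(cov f1 g + cov f2 g) / (1 + 2 * d) \<le> cov F g + r" using xs(3) by simp
    qed
    then have "cov f1 g + cov f2 g \<le> (1 + 2 * d) * cov F g" using d by (simp add: field_simps)
    also have "\<dots> \<le> (1 + 2 * d) * (cov f12 g + d * cov f' g)"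
    proof (rule mult_left_mono)
      show "cov F g \<le> cov f12 g + d * cov f' g"
        using cov_add[OF f12 df' g x0] cov_scale[OF f'(1) g x0, of d] d unfolding F_def by simp
    qed (use d in simp)
    also have "\<dots> = cov f12 g + d * (2 * cov f12 g + cov f' g + 2 * d * cov f' g)"
      by (simp add: algebra_simps)
    also have "\<dots> \<le> cov f12 g + e * cov f0 g"
    proof -
      have p0: "0 \<le> cov f0 g" by (rule cov_nonneg[OF f0(1) g x0])
      have a: "cov f12 g \<le> M1 * cov f0 g" unfolding M1_def by (rule cov_trans[OF f12 f0 g x0])
      have b: "cov f' g \<le> M2 * cov f0 g" unfolding M2_def by (rule cov_trans[OF f'(1) f0 g x0])
      have p': "0 \<le> cov f' g" by (rule cov_nonneg[OF f'(1) g x0])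
      have "d * cov f' g \<le> 1 * cov f' g" using d p' by (intro mult_right_mono) auto
      then have "2 * cov f12 g + cov f' g + 2 * d * cov f' g \<le> (2 * M1 + 3 * M2) * cov f0 g"
        using a b by (simp add: algebra_simps)
      then have "d * (2 * cov f12 g + cov f' g + 2 * d * cov f' g) \<le> d * ((2 * M1 + 3 * M2) * cov f0 g)"
        using d by (intro mult_left_mono) auto
      also have "\<dots> \<le> e * cov f0 g"
        using mult_right_mono[OF dM p0] by (simp add: mult.assoc)
      finally show ?thesis by simp
    qed
    finally show "cov f1 g + cov f2 g \<le> cov (\<lambda>x. f1 x + f2 x) g + e * cov f0 g"
      unfolding f12_def .
  qed
qed

lemma bump_at_one:
  assumes V: "openin X V" "\<one> \<in> V"
  obtains g where "g \<in> Cc X" "g \<one> = 1" "\<And>x. x \<notin> V \<Longrightarrow> g x = 0"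
proof -
  have "compactin X {\<one>}" by simp
  then obtain g C where "g \<in> Cc X" "\<And>x. x \<in> {\<one>} \<Longrightarrow> g x = 1" "C \<subseteq> V" "\<And>x. x \<notin> C \<Longrightarrow> g x = 0"
    using Cc_urysohn[OF lc haus _ V(1), of "{\<one>}"] V(2) by (metis empty_subsetI insert_subset)
  then show ?thesis using that by blast
qed

text \<open>The Haar functional is a limit, in a product of compact intervals, of normalised
  covering functionals for bumps supported near the identity.\<close>

lemma haar_exists_group:
  obtains I where "haar (Cc X) I"
proof -
  obtain f0 where f0: "f0 \<in> Cc X" "f0 \<one> = 1"
    using bump_at_one[OF openin_topspace] by (metis topspace_X one_closed)
  have f0p: "f0 \<one> > 0" using f0 by simp
  \<comment> \<open>\<open>cov_trans\<close> with \<open>f0\<close> in the middle bounds the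
    normalised value \<open>cov f g / cov f0 g\<close> by \<open>cov f f0\<close>, so the interval
    is the same for all bumps \<open>g\<close>.\<close>
  define P where "P = product_topology (\<lambda>f. top_of_set {0..cov f f0}) (Cc X)"
  define pt where "pt g = restrict (\<lambda>f. cov f g / cov f0 g) (Cc X)" for g
  define B where "B V = {g \<in> Cc X. (\<exists>x. g x > 0) \<and> (\<forall>x. x \<notin> V \<longrightarrow> g x = 0)}" for V
  define \<V> where "\<V> = {V. openin X V \<and> \<one> \<in> V}"
  have cP: "compact_space P"
    unfolding P_def compact_space_product_topology by (simp add: compact_space_subtopology)
  have ptP: "pt g \<in> topspace P" if gV: "g \<in> B V" for g V
  proof -
    obtain x0 where g: "g \<in> Cc X" "g x0 > 0" using gV unfolding B_def by blast
    have p: "0 < cov f0 g" by (rule cov_pos[OF f0(1) f0p g])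
    have "cov f g / cov f0 g \<in> {0..cov f f0}" if f: "f \<in> Cc X" for f
      using cov_nonneg[OF f g] cov_trans[OF f f0(1) f0p g] p by (simp add: field_simps)
    then show ?thesis unfolding P_def pt_def by (auto simp: topspace_product_topology)
  qed
  have Bne: "B V \<noteq> {}" if V: "V \<in> \<V>" for V
  proof -
    obtain g where "g \<in> Cc X" "g \<one> = 1" "\<And>x. x \<notin> V \<Longrightarrow> g x = 0"
      using bump_at_one[of V] V unfolding \<V>_def by blast
    then have "g \<in> B V" unfolding B_def by (auto intro!: exI[of _ \<one>])
    then show ?thesis by blast
  qed
  \<comment> \<open>The sets \<open>B V\<close> shrink with \<open>V\<close>. Finitely many closures
    have a common point, given by a bump supported in the intersection of the neighbourhoods, and
    compactness yields a point in all closures.\<close>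
  define \<C> where "\<C> = (\<lambda>V. P closure_of (pt ` B V)) ` \<V>"
  have fip: "\<Inter>\<F> \<noteq> {}" if fin: "finite \<F>" and sub: "\<F> \<subseteq> \<C>" for \<F>
  proof -
    obtain \<W> where W: "finite \<W>" "\<W> \<subseteq> \<V>" "\<F> = (\<lambda>V. P closure_of (pt ` B V)) ` \<W>"
      using finite_subset_image[OF fin sub[unfolded \<C>_def]] by blast
    have "topspace X \<inter> \<Inter>\<W> \<in> \<V>"
      using W(1,2)
    proof (induction \<W>)
      case empty
      show ?case unfolding \<V>_def using openin_topspace[of X] by simp
    next
      case (insert V \<W>)
      then have "V \<inter> (topspace X \<inter> \<Inter>\<W>) \<in> \<V>" unfolding \<V>_def by blast
      moreover have "topspace X \<inter> \<Inter>(insert V \<W>) = V \<inter> (topspace X \<inter> \<Inter>\<W>)" by blast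
      ultimately show ?case by simp
    qed
    then obtain g where g: "g \<in> B (topspace X \<inter> \<Inter>\<W>)" using Bne by blast
    have "pt g \<in> P closure_of (pt ` B V)" if "V \<in> \<W>" for V
    proof -
      have "g \<in> B V" using g that unfolding B_def by blast
      moreover have "pt ` B V \<subseteq> topspace P" using ptP by blast
      ultimately show ?thesis using closure_of_subset by blast
    qed
    then show ?thesis unfolding W(3) by blast
  qed
  have clo: "\<forall>C\<in>\<C>. closedin P C" unfolding \<C>_def by auto
  have "\<Inter>\<C> \<noteq> {}"
    using spec[OF cP[unfolded compact_space_fip], of \<C>]
    by (rule mp) (intro conjI clo allI impI, elim conjE, rule fip)
  then obtain I where I: "\<And>V. V \<in> \<V> \<Longrightarrow> I \<in> P closure_of (pt ` B V)"
    unfolding \<C>_def by blast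
  have top\<V>: "topspace X \<in> \<V>" unfolding \<V>_def using openin_topspace[of X] by simp
  have IP: "I \<in> topspace P" using I[OF top\<V>] closure_of_subset_topspace by fast
  have approx: "\<exists>g\<in>B V. \<forall>f\<in>F. \<bar>cov f g / cov f0 g - I f\<bar> < e"
    if F: "finite F" "F \<subseteq> Cc X" and e: "e > 0" and V: "V \<in> \<V>" for F e V
  proof -
    define O' where "O' f = {q \<in> topspace P. q f \<in> {I f - e<..<I f + e}}" for f
    have "openin P (O' f)" if "f \<in> F" for f
    proof -
      have "continuous_map P euclideanreal (\<lambda>q. q f)"
      proof -
        have "f \<in> Cc X" using F that by blast
        then have "continuous_map P (top_of_set {0..cov f f0}) (\<lambda>q. q f)"
          unfolding P_def by (rule continuous_map_product_projection)
        then show ?thesis by (rule continuous_map_into_fulltopology)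
      qed
      then show ?thesis unfolding O'_def by (rule openin_continuous_map_preimage) auto
    qed
    then have op: "openin P (topspace P \<inter> (\<Inter>f\<in>F. O' f))"
      using F(1) by (cases "F = {}") (auto intro!: openin_Int openin_INT)
    have mem: "I \<in> topspace P \<inter> (\<Inter>f\<in>F. O' f)" using IP e unfolding O'_def by auto
    have cl: "\<forall>T. I \<in> T \<and> openin P T \<longrightarrow> (\<exists>y. y \<in> pt ` B V \<and> y \<in> T)"
      using I[OF V] unfolding in_closure_of by simp
    have "\<exists>y. y \<in> pt ` B V \<and> y \<in> topspace P \<inter> (\<Inter>f\<in>F. O' f)"
      by (rule mp[OF spec[OF cl] conjI[OF mem op]])
    then obtain g where g: "g \<in> B V" "pt g \<in> topspace P \<inter> (\<Inter>f\<in>F. O' f)" by blast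
    then have g': "pt g f \<in> {I f - e<..<I f + e}" if "f \<in> F" for f
      using that unfolding O'_def by simp
    have "\<bar>cov f g / cov f0 g - I f\<bar> < e" if "f \<in> F" for f
      using g'[OF that] that F(2) unfolding pt_def by (auto simp: abs_less_iff)
    then show ?thesis using g(1) by blast
  qed
  \<comment> \<open>The factor 3 leaves room for replacing the value of \<open>I\<close> at each of
    up to three functions by a normalised covering number of a common bump.\<close>
  have zero: "a = b" if "\<And>e. e > 0 \<Longrightarrow> \<bar>a - b\<bar> \<le> 3 * e" for a b :: real
  proof (rule ccontr)
    assume "a \<noteq> b"
    then show False using that[of "\<bar>a - b\<bar> / 4"] by simp
  qed
  have gB: "\<exists>x0. g \<in> Cc X \<and> g x0 > 0 \<and> 0 < cov f0 g" if "g \<in> B V" for g V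
    using that cov_pos[OF f0(1) f0p] unfolding B_def by blast
  have "haar (Cc X) I"
    unfolding haar_def pos_functional_def
  proof (intro conjI ballI allI impI)
    fix f assume f: "f \<in> Cc X"
    show "0 \<le> I f" using IP f unfolding P_def by (auto simp: topspace_product_topology PiE_def Pi_def)
    show "I (\<lambda>x. c * f x) = c * I f" if c: "0 \<le> c" for c
    proof (rule zero)
      fix e :: real assume e: "e > 0"
      have cf: "(\<lambda>x. c * f x) \<in> Cc X" by (rule fun_cone_scale[OF fun_cone_Cc f c])
      have "e / (c + 1) > 0" using c e by simp
      then obtain g where g: "g \<in> B (topspace X)"
        "\<And>f'. f' \<in> {f, \<lambda>x. c * f x} \<Longrightarrow> \<bar>cov f' g / cov f0 g - I f'\<bar> < e / (c + 1)"
        using approx[of "{f, \<lambda>x. c * f x}" "e / (c + 1)" "topspace X"] top\<V> f cf by blast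
      obtain x0 where x0: "g \<in> Cc X" "g x0 > 0" using gB[OF g(1)] by blast
      have "cov (\<lambda>x. c * f x) g / cov f0 g = c * (cov f g / cov f0 g)"
        using cov_scale[OF f x0 c] by simp
      moreover have "\<bar>c * (cov f g / cov f0 g) - c * I f\<bar> \<le> c * (e / (c + 1))"
      proof -
        have "\<bar>c * (cov f g / cov f0 g) - c * I f\<bar> = c * \<bar>cov f g / cov f0 g - I f\<bar>"
          unfolding right_diff_distrib[symmetric] abs_mult using c by simp
        also have "\<dots> \<le> c * (e / (c + 1))" using g(2)[of f] c by (intro mult_left_mono) auto
        finally show ?thesis .
      qed
      moreover have "c * (e / (c + 1)) \<le> e" "e / (c + 1) \<le> e" using c e by (simp_all add: field_simps)
      ultimately show "\<bar>I (\<lambda>x. c * f x) - c * I f\<bar> \<le> 3 * e"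
        using g(2)[of "\<lambda>x. c * f x"] e by (auto simp: abs_less_iff abs_le_iff)
    qed
    show "I (rt s f) = I f" if s: "s \<in> carrier G" for s
    proof (rule zero)
      fix e :: real assume e: "e > 0"
      have cf: "rt s f \<in> Cc X" by (rule rt_Cc[OF f s])
      obtain g where g: "g \<in> B (topspace X)"
        "\<And>f'. f' \<in> {f, rt s f} \<Longrightarrow> \<bar>cov f' g / cov f0 g - I f'\<bar> < e"
        using approx[of "{f, rt s f}" e "topspace X"] top\<V> f cf e by blast
      obtain x0 where x0: "g \<in> Cc X" "g x0 > 0" using gB[OF g(1)] by blast
      show "\<bar>I (rt s f) - I f\<bar> \<le> 3 * e"
        using g(2)[of f] g(2)[of "rt s f"] cov_rt[OF f x0 s] e by (auto simp: abs_less_iff abs_le_iff)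
    qed
    fix f' assume f': "f' \<in> Cc X"
    show "I (\<lambda>x. f x + f' x) = I f + I f'"
    proof (rule zero)
      fix e :: real assume e: "e > 0"
      have ff: "(\<lambda>x. f x + f' x) \<in> Cc X" by (rule fun_cone_add[OF fun_cone_Cc f f'])
      have e2: "e / 2 > 0" using e by simp
      obtain V where V: "openin X V" "\<one> \<in> V"
        "\<And>g x0. g \<in> Cc X \<Longrightarrow> g x0 > 0 \<Longrightarrow> (\<And>x. x \<notin> V \<Longrightarrow> g x = 0) \<Longrightarrow>
          cov f g + cov f' g \<le> cov (\<lambda>x. f x + f' x) g + e / 2 * cov f0 g"
      proof (rule cov_almost_additive[OF f f' f0(1) f0p e2], goal_cases)
        case (1 V)
        from 1(1)[OF 1(2-4)] show ?case .
      qed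
      have "V \<in> \<V>" using V unfolding \<V>_def by blast
      then obtain g where g: "g \<in> B V"
        "\<And>h. h \<in> {f, f', \<lambda>x. f x + f' x} \<Longrightarrow> \<bar>cov h g / cov f0 g - I h\<bar> < e / 2"
        using approx[of "{f, f', \<lambda>x. f x + f' x}" "e / 2" V] f f' ff e2 by blast
      obtain x0 where x0: "g \<in> Cc X" "g x0 > 0" "0 < cov f0 g" using gB[OF g(1)] by blast
      have "cov f g + cov f' g \<le> cov (\<lambda>x. f x + f' x) g + e / 2 * cov f0 g"
        by (rule V(3)[OF x0(1,2)]) (use g(1) in \<open>auto simp: B_def\<close>)
      then have a: "cov f g / cov f0 g + cov f' g / cov f0 g \<le> cov (\<lambda>x. f x + f' x) g / cov f0 g + e / 2"
        using divide_right_mono[of _ _ "cov f0 g"] x0(3) by (fastforce simp: add_divide_distrib)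
      have b: "cov (\<lambda>x. f x + f' x) g / cov f0 g \<le> cov f g / cov f0 g + cov f' g / cov f0 g"
        using divide_right_mono[OF cov_add[OF f f' x0(1,2)], of "cov f0 g"] x0(3)
        by (simp add: add_divide_distrib)
      show "\<bar>I (\<lambda>x. f x + f' x) - (I f + I f')\<bar> \<le> 3 * e"
      proof -
        have "\<bar>cov f g / cov f0 g - I f\<bar> < e / 2" "\<bar>cov f' g / cov f0 g - I f'\<bar> < e / 2"
          "\<bar>cov (\<lambda>x. f x + f' x) g / cov f0 g - I (\<lambda>x. f x + f' x)\<bar> < e / 2"
          by (rule g(2), simp)+
        then show ?thesis using a b e by linarith
      qed
    qed
  next
    have "I f0 = 1"
    proof (rule zero)
      fix e :: real assume e: "e > 0"
      obtain g where g: "g \<in> B (topspace X)" "\<bar>cov f0 g / cov f0 g - I f0\<bar> < e"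
        using approx[of "{f0}" e "topspace X"] top\<V> f0 e by blast
      then show "\<bar>I f0 - 1\<bar> \<le> 3 * e" using gB[OF g(1)] by auto
    qed
    then show "\<exists>f\<in>Cc X. I f \<noteq> 0" using f0 by (intro bexI[of _ f0]) auto
  qed
  then show ?thesis by (rule that)
qed

text \<open>For every x the function y \<mapsto> g (x inv y) has integral \<gamma>, by right
  invariance. If \<open>g\<close> lives near the identity, its integral against \<open>f\<close> is
  close to f(x) \<gamma>, since only y with x inv y in \<open>V\<close> contribute. A partition of
  unity replaces this integral by a Riemann sum, which is a combination of translates of
  \<open>g\<close> by inverses of points of \<open>C\<close>. The functional \<open>I\<close> only
  supplies the coefficients.\<close>

lemma haar_approx:
  assumes I: "haar (Cc X) I" and f: "f \<in> Cc X" and C: "compactin X C" "\<And>x. x \<notin> C \<Longrightarrow> f x = 0"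
    and e: "e > 0"
  obtains V where "openin X V" "\<one> \<in> V"
    "\<And>g x0. g \<in> Cc X \<Longrightarrow> g x0 > 0 \<Longrightarrow> (\<And>x. x \<notin> V \<Longrightarrow> g x = 0) \<Longrightarrow>
       \<exists>xs. good_list xs \<and> (\<forall>p\<in>set xs. inv (snd p) \<in> C) \<and> (\<forall>x. \<bar>f x - comb xs g x\<bar> \<le> e)"
proof -
  note P = haar_pos_functional[OF I]
  have e2: "e / 2 > 0" using e by simp
  obtain V where V: "openin X V" "\<one> \<in> V"
    "\<And>v y. v \<in> V \<Longrightarrow> y \<in> carrier G \<Longrightarrow> \<bar>f (v \<otimes> y) - f y\<bar> \<le> e / 2"
    using unif_cont_left[OF f e2] by metis
  show ?thesis
  proof (rule that[OF V(1,2)])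
    fix g x0 assume g: "g \<in> Cc X" and x0: "g x0 > 0" and g0: "\<And>x. x \<notin> V \<Longrightarrow> g x = 0"
    have x0c: "x0 \<in> carrier G" using Cc_outside[OF g, of x0] x0 by fastforce
    define \<gamma> where "\<gamma> = I (finv g)"
    have "finv g (inv x0) > 0" using x0 x0c by (simp add: finv_def)
    then have \<gamma>: "\<gamma> > 0"
      unfolding \<gamma>_def using haar_strictly_pos[OF one_is_normal, of I "finv g" "inv x0"] I finv_Cc[OF g]
      by (simp add: CN_one)
    have If: "0 \<le> I f" by (rule pos_functional_nonneg[OF P f])
    \<comment> \<open>Chosen so that the error of the Riemann sum, d times \<open>I f\<close>, is at
      most half of \<open>e\<close> after division by \<gamma>; the other half is the oscillation of
      \<open>f\<close> over \<open>V\<close>.\<close>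
    define d where "d = e / 2 * \<gamma> / (I f + 1)"
    have d: "d > 0" using e \<gamma> If unfolding d_def by simp
    have dI: "d * I f \<le> e / 2 * \<gamma>"
      using e \<gamma> If unfolding d_def by (simp add: field_simps)
    obtain W where W: "openin X W" "\<one> \<in> W"
      "\<And>v y. v \<in> W \<Longrightarrow> y \<in> carrier G \<Longrightarrow> \<bar>g (y \<otimes> v) - g y\<bar> \<le> d"
      using unif_cont_right[OF g d] by metis
    \<comment> \<open>For y in \<open>U s\<close> one has x inv y = (x inv s)(s inv y) with the last
      factor in \<open>W\<close>, so replacing y by s changes g (x inv y) by at most
      \<open>d\<close>, for all x at once.\<close>
    define U where "U s = {y \<in> topspace X. s \<otimes> inv y \<in> W}" for s
    have U: "openin X (U s)" if "s \<in> carrier G" for s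
      unfolding U_def using that
      by (intro openin_continuous_map_preimage[OF _ W(1)] mult_cont' inv_cont) auto
    have Cc: "C \<subseteq> carrier G" by (rule compact_carrier[OF C(1)])
    have "C \<subseteq> \<Union>(U ` C)" using Cc W(2) by (force simp: U_def)
    moreover have "openin X T" if "T \<in> U ` C" for T using that U Cc by blast
    ultimately obtain \<F> where "finite \<F>" "\<F> \<subseteq> U ` C" "C \<subseteq> \<Union>\<F>"
      using compactinD[OF C(1), of "U ` C"] by blast
    then obtain D where D: "finite D" "D \<subseteq> C" "C \<subseteq> (\<Union>s\<in>D. U s)"
      by (metis finite_subset_image)
    have UD: "openin X (U s)" if "s \<in> D" for s using U D(2) Cc that by blast
    obtain p K where p: "\<And>s. s \<in> D \<Longrightarrow> p s \<in> Cc X" "\<And>s. s \<in> D \<Longrightarrow> K s \<subseteq> U s"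
      "\<And>s x. s \<in> D \<Longrightarrow> x \<notin> K s \<Longrightarrow> p s x = 0" "\<And>x. x \<in> C \<Longrightarrow> (\<Sum>s\<in>D. p s x) = (1::real)"
      using Cc_partition_of_unity[OF lc haus C(1) D(1) UD D(3)] by metis
    define k where "k x = rt (inv x) (finv g)" for x
    have k: "k x \<in> Cc X" "I (k x) = \<gamma>" if "x \<in> carrier G" for x
      using rt_Cc[OF finv_Cc[OF g], of "inv x"] haar_rt[OF I finv_Cc[OF g], of "inv x"] that
      unfolding k_def \<gamma>_def by auto
    have kv: "k x y = g (x \<otimes> inv y)" if "x \<in> carrier G" "y \<in> carrier G" for x y
      using that unfolding k_def rt_def finv_def by (simp add: inv_mult_group)
    have kn: "0 \<le> k x y" for x y
      unfolding k_def rt_def finv_def using Cc_nonneg[OF g] by auto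
    define fp where "fp s = (\<lambda>y. f y * p s y)" for s
    have fp: "fp s \<in> Cc X" if "s \<in> D" for s
      unfolding fp_def by (rule Cc_mult[OF f Cc_cont[OF p(1)[OF that]]]) (rule Cc_nonneg[OF p(1)[OF that]])
    have fpI: "0 \<le> I (fp s)" if "s \<in> D" for s by (rule pos_functional_nonneg[OF P fp[OF that]])
    have fsum: "f = (\<lambda>y. \<Sum>s\<in>D. fp s y)"
    proof
      fix y show "f y = (\<Sum>s\<in>D. fp s y)"
        using p(4)[of y] C(2)[of y] unfolding fp_def
        by (cases "y \<in> C") (simp_all flip: sum_distrib_left)
    qed
    have fpsum: "(\<Sum>s\<in>D. I (fp s)) = I f"
      using pos_functional_sum[OF fun_cone_Cc P fp, of D] fsum by simp
    obtain xs where xs: "set xs = (\<lambda>s. (I (fp s) / \<gamma>, inv s)) ` D"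
      "\<And>f x. comb xs f x = (\<Sum>s\<in>D. I (fp s) / \<gamma> * rt (inv s) f x)"
      "weight xs = (\<Sum>s\<in>D. I (fp s) / \<gamma>)"
    proof (rule sum_list_comb[OF D(1), of "\<lambda>s. I (fp s) / \<gamma>" "\<lambda>s. inv s"], goal_cases)
      case (1 ys)
      from 1(1)[OF 1(2-4)] show ?case .
    qed
    have good: "good_list xs" "\<forall>p\<in>set xs. inv (snd p) \<in> C"
      using fpI \<gamma> D(2) Cc unfolding xs(1) good_list_def by (auto simp: subset_iff)
    have main: "\<bar>f x - comb xs g x\<bar> \<le> e" for x
    proof (cases "x \<in> carrier G")
      case False
      then show ?thesis
        using e Cc_outside[OF f, of x] unfolding xs(2) by (simp add: rt_def)
    next
      case x: True
      \<comment> \<open>\<open>I q\<close> is compared twice: with the Riemann sum over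
        \<open>D\<close>, and with f(x) \<gamma>.\<close>
      define q where "q = (\<lambda>y. f y * k x y)"
      have q: "q \<in> Cc X"
        unfolding q_def by (rule Cc_mult[OF f Cc_cont[OF k(1)[OF x]] kn])
      define qs where "qs s = (\<lambda>y. fp s y * k x y)" for s
      have qs: "qs s \<in> Cc X" if "s \<in> D" for s
        unfolding qs_def by (rule Cc_mult[OF fp[OF that] Cc_cont[OF k(1)[OF x]] kn])
      have "q = (\<lambda>y. \<Sum>s\<in>D. qs s y)"
        unfolding q_def qs_def sum_distrib_right[symmetric] using fsum by metis
      then have Iq: "I q = (\<Sum>s\<in>D. I (qs s))"
        using pos_functional_sum[OF fun_cone_Cc P qs, of D] by simp
      have a: "\<bar>I (qs s) - g (x \<otimes> inv s) * I (fp s)\<bar> \<le> d * I (fp s)" if s: "s \<in> D" for s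
      proof -
        have gn: "0 \<le> g (x \<otimes> inv s)" by (rule Cc_nonneg[OF g])
        have "\<bar>qs s y - g (x \<otimes> inv s) * fp s y\<bar> \<le> d * fp s y" for y
        proof (cases "y \<in> K s")
          case True
          then have y: "y \<in> carrier G" "s \<otimes> inv y \<in> W" using p(2)[OF s] unfolding U_def by auto
          have sc: "s \<in> carrier G" using s D(2) Cc by blast
          have "\<bar>g (x \<otimes> inv s \<otimes> (s \<otimes> inv y)) - g (x \<otimes> inv s)\<bar> \<le> d"
            by (rule W(3)) (use y x sc in auto)
          moreover have "x \<otimes> inv s \<otimes> (s \<otimes> inv y) = x \<otimes> inv y"
            using x y sc by (metis inv_closed inv_solve_right m_assoc m_closed)
          ultimately have "\<bar>k x y - g (x \<otimes> inv s)\<bar> \<le> d" using kv[OF x y(1)] by simp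
          moreover have "0 \<le> fp s y" by (rule Cc_nonneg[OF fp[OF s]])
          ultimately have "fp s y * \<bar>k x y - g (x \<otimes> inv s)\<bar> \<le> fp s y * d" by (intro mult_left_mono)
          moreover have "qs s y - g (x \<otimes> inv s) * fp s y = fp s y * (k x y - g (x \<otimes> inv s))"
            unfolding qs_def by (simp add: algebra_simps)
          ultimately show ?thesis using \<open>0 \<le> fp s y\<close> by (simp add: abs_mult mult.commute)
        next
          case False
          then show ?thesis using p(3)[OF s] by (simp add: qs_def fp_def)
        qed
        then have "\<bar>I (qs s) - I (\<lambda>y. g (x \<otimes> inv s) * fp s y)\<bar> \<le> d * I (fp s)"
          by (intro pos_functional_approx[OF fun_cone_Cc P qs[OF s] fun_cone_scale[OF fun_cone_Cc fp[OF s] gn] fp[OF s]])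
            (use d in auto)
        then show ?thesis using pos_functional_scale[OF P fp[OF s] gn] by simp
      qed
      have "\<bar>I q - (\<Sum>s\<in>D. g (x \<otimes> inv s) * I (fp s))\<bar> \<le> (\<Sum>s\<in>D. d * I (fp s))"
        unfolding Iq sum_subtractf[symmetric] by (rule order_trans[OF sum_abs sum_mono[OF a]])
      then have b: "\<bar>I q - (\<Sum>s\<in>D. g (x \<otimes> inv s) * I (fp s))\<bar> \<le> e / 2 * \<gamma>"
        using dI fpsum by (simp add: sum_distrib_left[symmetric])
      have fn: "0 \<le> f x" by (rule Cc_nonneg[OF f])
      have "\<bar>q y - f x * k x y\<bar> \<le> e / 2 * k x y" for y
      proof (cases "y \<in> carrier G \<and> x \<otimes> inv y \<in> V")
        case True
        have "\<bar>f (x \<otimes> inv y \<otimes> y) - f y\<bar> \<le> e / 2" by (rule V(3)) (use True in auto)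
        then have "\<bar>f y - f x\<bar> \<le> e / 2" using x True by (simp add: m_assoc abs_minus_commute)
        then have "\<bar>f y - f x\<bar> * k x y \<le> e / 2 * k x y" using kn by (intro mult_right_mono)
        moreover have "q y - f x * k x y = (f y - f x) * k x y"
          unfolding q_def by (simp add: algebra_simps)
        ultimately show ?thesis using kn[of x y] by (simp add: abs_mult)
      next
        case False
        then have "k x y = 0"
          using kv[OF x, of y] g0 Cc_outside[OF k(1)[OF x], of y] by (cases "y \<in> carrier G") auto
        then show ?thesis by (simp add: q_def)
      qed
      then have "\<bar>I q - I (\<lambda>y. f x * k x y)\<bar> \<le> e / 2 * I (k x)"
        by (intro pos_functional_approx[OF fun_cone_Cc P q fun_cone_scale[OF fun_cone_Cc k(1)[OF x] fn] k(1)[OF x]])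
          (use e in auto)
      then have Iqf: "\<bar>I q - f x * \<gamma>\<bar> \<le> e / 2 * \<gamma>"
        using pos_functional_scale[OF P k(1)[OF x] fn] k(2)[OF x] by simp
      have "\<bar>f x * \<gamma> - (\<Sum>s\<in>D. g (x \<otimes> inv s) * I (fp s))\<bar> \<le> e * \<gamma>"
      proof -
        have "e / 2 * \<gamma> = e * \<gamma> / 2" by simp
        then show ?thesis using b Iqf by linarith
      qed
      moreover have "(\<Sum>s\<in>D. g (x \<otimes> inv s) * I (fp s)) = comb xs g x * \<gamma>"
        using \<gamma> x unfolding xs(2) sum_distrib_right rt_def
        by (intro sum.cong) auto
      ultimately have "\<bar>(f x - comb xs g x) * \<gamma>\<bar> \<le> e * \<gamma>"
        by (simp add: left_diff_distrib)
      then have "\<bar>f x - comb xs g x\<bar> * \<gamma> \<le> e * \<gamma>"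
        using \<gamma> by (simp add: abs_mult)
      then show ?thesis using \<gamma> by simp
    qed
    show "\<exists>xs. good_list xs \<and> (\<forall>p\<in>set xs. inv (snd p) \<in> C) \<and> (\<forall>x. \<bar>f x - comb xs g x\<bar> \<le> e)"
      using good main by blast
  qed
qed

text \<open>The hypothesis says that the 2 by 2 matrix with rows (A, A') and (B, B') is a limit of
  matrices of rank at most one, so its determinant vanishes. \<open>K\<close> collects the
  coefficients of \<open>e\<close> in the two products, and \<open>e\<close> is taken small enough
  for a strict contradiction.\<close>

lemma product_eq_if_approximately_proportional:
  fixes A A' B B' U U' :: real
  assumes nn: "0 \<le> A" "0 \<le> A'" "0 \<le> B" "0 \<le> B'" "0 \<le> U" "0 \<le> U'"
    and ex: "\<And>e. 0 < e \<Longrightarrow> e \<le> 1 \<Longrightarrow> \<exists>a b p q. \<bar>A - a * p\<bar> \<le> e * U \<and> \<bar>A' - a * q\<bar> \<le> e * U' \<and>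
      \<bar>B - b * p\<bar> \<le> e * U \<and> \<bar>B' - b * q\<bar> \<le> e * U'"
  shows "A * B' = B * A'"
proof (rule ccontr)
  define K where "K = A * U' + (B' + U') * U + B * U' + (A' + U') * U"
  have K: "0 \<le> K" unfolding K_def using nn by simp
  have *: "\<bar>x * y - x' * y'\<bar> \<le> e * (x * U' + (y + U') * U)"
    if "\<bar>x - x'\<bar> \<le> e * U" "\<bar>y - y'\<bar> \<le> e * U'" "0 \<le> x" "0 \<le> y" "0 < e" "e \<le> 1" for x y x' y' e
  proof -
    have "e * U' \<le> 1 * U'" using that nn by (intro mult_right_mono) auto
    then have y': "\<bar>y'\<bar> \<le> y + U'" using that by linarith
    have "x * y - x' * y' = x * (y - y') + y' * (x - x')" by (simp add: algebra_simps)
    then have "\<bar>x * y - x' * y'\<bar> \<le> x * \<bar>y - y'\<bar> + \<bar>y'\<bar> * \<bar>x - x'\<bar>"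
      using abs_triangle_ineq[of "x * (y - y')" "y' * (x - x')"] that by (simp add: abs_mult)
    also have "\<dots> \<le> x * (e * U') + (y + U') * (e * U)"
      using that y' by (intro add_mono mult_left_mono mult_mono) auto
    finally show ?thesis by (simp add: algebra_simps)
  qed
  assume "A * B' \<noteq> B * A'"
  then have d: "0 < \<bar>A * B' - B * A'\<bar>" by simp
  define e where "e = min 1 (\<bar>A * B' - B * A'\<bar> / (K + 1) / 2)"
  have e: "0 < e" "e \<le> 1" using d K unfolding e_def by auto
  obtain a b p q where ab: "\<bar>A - a * p\<bar> \<le> e * U" "\<bar>A' - a * q\<bar> \<le> e * U'"
      "\<bar>B - b * p\<bar> \<le> e * U" "\<bar>B' - b * q\<bar> \<le> e * U'"
    using ex[OF e] by blast
  have "\<bar>A * B' - (a * p) * (b * q)\<bar> \<le> e * (A * U' + (B' + U') * U)"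
    by (rule *[OF ab(1,4)]) (use nn e in auto)
  moreover have "\<bar>B * A' - (b * p) * (a * q)\<bar> \<le> e * (B * U' + (A' + U') * U)"
    by (rule *[OF ab(3,2)]) (use nn e in auto)
  moreover have "(a * p) * (b * q) = (b * p) * (a * q)" by simp
  ultimately have "\<bar>A * B' - B * A'\<bar> \<le> e * (A * U' + (B' + U') * U) + e * (B * U' + (A' + U') * U)"
    by linarith
  then have "\<bar>A * B' - B * A'\<bar> \<le> e * K" unfolding K_def by (simp add: algebra_simps)
  also have "e * K \<le> \<bar>A * B' - B * A'\<bar> / (K + 1) / 2 * K"
    using K by (intro mult_right_mono) (auto simp: e_def)
  also have "\<dots> = \<bar>A * B' - B * A'\<bar> * (K / (K + 1) / 2)" by simp
  also have "\<dots> < \<bar>A * B' - B * A'\<bar> * 1"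
    using d K by (intro mult_strict_left_mono) (auto simp: field_simps)
  finally show False by simp
qed

text \<open>For a narrow bump \<open>g\<close> both functions are nearly combinations of translates
  of \<open>g\<close>, of total weights a and b. These approximations are uniform statements about
  functions, so lists obtained from \<open>I\<close> serve for \<open>J\<close> too: the values at f
  are nearly a \<open>I g\<close> and a \<open>J g\<close>, those at f' nearly b \<open>I g\<close>
  and b \<open>J g\<close>. The matrix lemma concludes.\<close>

lemma haar_unique_group:
  assumes I: "haar (Cc X) I" and J: "haar (Cc X) J" and f: "f \<in> Cc X" and f': "f' \<in> Cc X"
  shows "I f * J f' = I f' * J f"
proof -
  note PI = haar_pos_functional[OF I] and PJ = haar_pos_functional[OF J]
  obtain C1 where C1: "compactin X C1" "\<And>x. x \<notin> C1 \<Longrightarrow> f x = 0"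
    using Cc_support[OF f] by metis
  obtain C2 where C2: "compactin X C2" "\<And>x. x \<notin> C2 \<Longrightarrow> f' x = 0"
    using Cc_support[OF f'] by metis
  define C where "C = C1 \<union> C2"
  have C: "compactin X C" unfolding C_def by (rule compactin_Un[OF C1(1) C2(1)])
  have C0: "f x = 0" "f' x = 0" if "x \<notin> C" for x using that C1(2) C2(2) unfolding C_def by auto
  \<comment> \<open>A bump supported in \<open>V0 \<subseteq> L\<close>, translated by inverses of
    points of \<open>C\<close>, vanishes off \<open>L <#> C\<close>, which is compact since
    multiplication is jointly continuous here. Thus one \<open>u\<close> controls all errors,
    however small the bump.\<close>
  have "compactin X {\<one>}" by simp
  then obtain V0 L where VL: "openin X V0" "compactin X L" "\<one> \<in> V0" "V0 \<subseteq> L"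
    using lc haus locally_compact_space_compact_closed_compact[of X] by (metis insert_subset)
  have "compactin X ((\<lambda>(x, y). x \<otimes> y) ` (L \<times> C))"
    by (rule image_compactin[OF _ mult_cont]) (simp add: compactin_Times VL C)
  moreover have "(\<lambda>(x, y). x \<otimes> y) ` (L \<times> C) = L <#> C" unfolding set_mult_def by auto
  ultimately have LC: "compactin X (L <#> C)" by simp
  obtain u where u: "u \<in> Cc X" "\<And>x. x \<in> L <#> C \<Longrightarrow> u x = 1"
    using Cc_urysohn[OF lc haus LC openin_topspace compactin_subset_topspace[OF LC]] by metis
  have CL: "C \<subseteq> L <#> C"
  proof
    fix x assume "x \<in> C"
    then have "x = \<one> \<otimes> x" using compact_carrier[OF C] by auto
    then show "x \<in> L <#> C" using \<open>x \<in> C\<close> VL unfolding set_mult_iff by blast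
  qed
  show ?thesis
  proof (rule product_eq_if_approximately_proportional[where U = "I u" and U' = "J u"])
    fix e :: real assume e: "0 < e" "e \<le> 1"
    obtain V1 where V1: "openin X V1" "\<one> \<in> V1"
      "\<And>g x0. g \<in> Cc X \<Longrightarrow> g x0 > 0 \<Longrightarrow> (\<And>x. x \<notin> V1 \<Longrightarrow> g x = 0) \<Longrightarrow>
       \<exists>xs. good_list xs \<and> (\<forall>p\<in>set xs. inv (snd p) \<in> C) \<and> (\<forall>x. \<bar>f x - comb xs g x\<bar> \<le> e)"
      using haar_approx[OF I f C C0(1) e(1)] by metis
    obtain V2 where V2: "openin X V2" "\<one> \<in> V2"
      "\<And>g x0. g \<in> Cc X \<Longrightarrow> g x0 > 0 \<Longrightarrow> (\<And>x. x \<notin> V2 \<Longrightarrow> g x = 0) \<Longrightarrow>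
       \<exists>xs. good_list xs \<and> (\<forall>p\<in>set xs. inv (snd p) \<in> C) \<and> (\<forall>x. \<bar>f' x - comb xs g x\<bar> \<le> e)"
      using haar_approx[OF I f' C C0(2) e(1)] by metis
    have "openin X (V0 \<inter> V1 \<inter> V2)" "\<one> \<in> V0 \<inter> V1 \<inter> V2" using VL V1 V2 by auto
    then obtain g where g: "g \<in> Cc X" "g \<one> = 1" "\<And>x. x \<notin> V0 \<inter> V1 \<inter> V2 \<Longrightarrow> g x = 0"
      using bump_at_one by metis
    have g1: "g \<one> > 0" using g by simp
    obtain xs where xs: "good_list xs" "\<forall>p\<in>set xs. inv (snd p) \<in> C" "\<And>x. \<bar>f x - comb xs g x\<bar> \<le> e"
      using V1(3)[OF g(1) g1] g(3) by blast
    obtain ys where ys: "good_list ys" "\<forall>p\<in>set ys. inv (snd p) \<in> C" "\<And>x. \<bar>f' x - comb ys g x\<bar> \<le> e"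
      using V2(3)[OF g(1) g1] g(3) by blast
    have supp: "comb zs g x = 0"
      if "x \<notin> L <#> C" and z: "good_list zs" "\<forall>p\<in>set zs. inv (snd p) \<in> C" for zs x
      using z
    proof (induction zs)
      case (Cons p zs)
      have "rt (snd p) g x = 0"
      proof (rule ccontr)
        assume "rt (snd p) g x \<noteq> 0"
        then have x: "x \<in> carrier G" and "g (x \<otimes> snd p) \<noteq> 0" unfolding rt_def by (auto split: if_splits)
        then have "x \<otimes> snd p \<in> L" using g(3) VL(4) by blast
        moreover have "x = x \<otimes> snd p \<otimes> inv (snd p)" using x Cons.prems by (simp add: m_assoc)
        ultimately show False using that Cons.prems(2) unfolding set_mult_iff by fastforce
      qed
      then show ?case using Cons by simp
    qed simp
    have est: "\<bar>H h - weight zs * H g\<bar> \<le> e * H u"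
      if H: "haar (Cc X) H" and h: "h \<in> Cc X" "\<And>x. x \<notin> C \<Longrightarrow> h x = 0"
        and z: "good_list zs" "\<forall>p\<in>set zs. inv (snd p) \<in> C" "\<And>x. \<bar>h x - comb zs g x\<bar> \<le> e" for H h zs
    proof -
      have g': "g \<in> CN {\<one>}" and H': "haar (CN {\<one>}) H" using g H by (simp_all add: CN_one)
      have "\<bar>h x - comb zs g x\<bar> \<le> e * u x" for x
      proof (cases "x \<in> L <#> C")
        case True then show ?thesis using z(3)[of x] u(2) by simp
      next
        case False
        then have "x \<notin> C" using CL by blast
        then show ?thesis using supp[OF False z(1,2)] h(2)[of x] e Cc_nonneg[OF u(1), of x] by simp
      qed
      then have "\<bar>H h - H (comb zs g)\<bar> \<le> e * H u"
        using comb_CN[OF g' one_is_normal z(1)] e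
        by (intro pos_functional_approx[OF fun_cone_Cc haar_pos_functional[OF H] h(1) _ u(1)]) (auto simp: CN_one)
      then show ?thesis using haar_comb[OF H' g' one_is_normal z(1)] by simp
    qed
    show "\<exists>a b p q. \<bar>I f - a * p\<bar> \<le> e * I u \<and> \<bar>J f - a * q\<bar> \<le> e * J u \<and>
      \<bar>I f' - b * p\<bar> \<le> e * I u \<and> \<bar>J f' - b * q\<bar> \<le> e * J u"
      using est[OF I f C0(1) xs] est[OF J f C0(1) xs] est[OF I f' C0(2) ys] est[OF J f' C0(2) ys] by blast
  qed (use pos_functional_nonneg[OF PI] pos_functional_nonneg[OF PJ] f f' u in auto)
qed

end

section \<open>Passing to quotients by normal subgroups\<close>

lemma continuous_map_realI:
  assumes "\<And>x e. x \<in> topspace X \<Longrightarrow> e > 0 \<Longrightarrow> \<exists>U. openin X U \<and> x \<in> U \<and> (\<forall>y\<in>U. \<bar>f y - f x\<bar> \<le> (e::real))"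
  shows "continuous_map X euclideanreal f"
proof -
  have *: "openin X {x \<in> topspace X. f x \<in> W}" if W: "open W" for W
  proof (subst openin_subopen, intro ballI)
    fix x assume x: "x \<in> {x \<in> topspace X. f x \<in> W}"
    then obtain e where e: "e > 0" "ball (f x) e \<subseteq> W" using W open_contains_ball by blast
    obtain U where U: "openin X U" "x \<in> U" "\<forall>y\<in>U. \<bar>f y - f x\<bar> \<le> e / 2"
      using assms[of x "e / 2"] x e(1) by auto
    have "f y \<in> W" if "y \<in> U" for y
    proof -
      have "\<bar>f y - f x\<bar> < e" using U(3) that e(1) by fastforce
      then show ?thesis using e(2) by (auto simp: dist_real_def abs_minus_commute)
    qed
    then show "\<exists>T. openin X T \<and> x \<in> T \<and> T \<subseteq> {x \<in> topspace X. f x \<in> W}"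
      using U openin_subset[OF U(1)] by (intro exI[of _ U]) auto
  qed
  then show ?thesis unfolding continuous_map_def by auto
qed

lemma lc_group_of_topological_group:
  assumes "topological_group H Z" "locally_compact_space Z" "Hausdorff_space Z"
  shows "lc_group H Z"
proof -
  interpret group H using assms(1) unfolding topological_group_def by blast
  have t: "topspace Z = carrier H"
    and m: "continuous_map (prod_topology Z Z) Z (\<lambda>(x, y). x \<otimes>\<^bsub>H\<^esub> y)"
    and i: "continuous_map Z Z (\<lambda>x. inv\<^bsub>H\<^esub> x)"
    using assms(1) unfolding topological_group_def by auto
  show ?thesis
  proof (unfold_locales)
    show "continuous_map Z Z (\<lambda>x. x \<otimes>\<^bsub>H\<^esub> s)" if "s \<in> carrier H" for s
    proof -
      have "continuous_map Z Z ((\<lambda>(x, y). x \<otimes>\<^bsub>H\<^esub> y) \<circ> (\<lambda>x. (x, s)))"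
        by (rule continuous_map_compose[OF _ m]) (simp add: continuous_map_pairwise o_def that t)
      then show ?thesis by (simp add: o_def)
    qed
  qed (use assms t m i in auto)
qed

context rt_group
begin

text \<open>Proportionality in cross-multiplied form: no reference function or division has to be
  carried through the induction.\<close>

definition unique_haar :: "('a \<Rightarrow> real) set \<Rightarrow> bool" where
  "unique_haar A \<longleftrightarrow> (\<forall>I J. haar A I \<longrightarrow> haar A J \<longrightarrow> (\<forall>f\<in>A. \<forall>g\<in>A. I f * J g = I g * J f))"

lemma lcos_image: "x <# N = (\<lambda>n. x \<otimes> n) ` N"
  unfolding l_coset_def by blast

lemma lcos_eq_iff:
  assumes N: "N \<lhd> G" and x: "x \<in> carrier G" and y: "y \<in> carrier G"
  shows "x <# N = y <# N \<longleftrightarrow> inv x \<otimes> y \<in> N"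
proof -
  interpret N: subgroup N G by (rule normal_imp_subgroup[OF N])
  show ?thesis
  proof
    assume "x <# N = y <# N"
    moreover have "y \<in> y <# N" using y unfolding lcos_image by (force intro: image_eqI[of _ _ \<one>])
    ultimately obtain n where "n \<in> N" "y = x \<otimes> n" unfolding lcos_image by blast
    then show "inv x \<otimes> y \<in> N" using x by (simp flip: m_assoc)
  next
    assume n: "inv x \<otimes> y \<in> N"
    have "y = x \<otimes> (inv x \<otimes> y)" using x y by (simp flip: m_assoc)
    then show "x <# N = y <# N"
      unfolding lcos_image using coset_image[OF N x n] by simp
  qed
qed

lemma lcos_absorb:
  assumes N: "N \<lhd> G" and x: "x \<in> carrier G" and n: "n \<in> N"
  shows "(x \<otimes> n) <# N = x <# N"
  unfolding lcos_image by (rule coset_image[OF N x n])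

lemma lcos_mult:
  assumes N: "N \<lhd> G" and "x \<in> carrier G" "y \<in> carrier G"
  shows "(x <# N) <#> (y <# N) = (x \<otimes> y) <# N"
  using normal.rcos_sum[OF N assms(2,3)] normal.coset_eq[OF N] assms by simp

lemma carrier_Mod:
  assumes N: "N \<lhd> G"
  shows "carrier (G Mod N) = (\<lambda>x. x <# N) ` carrier G"
  unfolding carrier_FactGroup using normal.coset_eq[OF N] by auto

lemma topspace_coset: "topspace (coset_topology G X N) = (\<lambda>x. x <# N) ` carrier G"
  by (simp add: coset_topology_def)

lemma coset_quotient_map: "quotient_map X (coset_topology G X N) (\<lambda>x. x <# N)"
  unfolding coset_topology_def by (rule quotient_map_quotient_topology)

lemma coset_cont: "continuous_map X (coset_topology G X N) (\<lambda>x. x <# N)"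
  using coset_quotient_map quotient_imp_continuous_map by blast

text \<open>The saturation of \<open>U\<close> is the union of its right translates by elements of
  \<open>N\<close>, and these are open.\<close>

lemma coset_open_map:
  assumes N: "N \<lhd> G" and U: "openin X U"
  shows "openin (coset_topology G X N) ((\<lambda>x. x <# N) ` U)"
proof -
  have Uc: "U \<subseteq> carrier G" by (rule open_carrier[OF U])
  have eq: "{x \<in> topspace X. x <# N \<in> (\<lambda>x. x <# N) ` U} = (\<Union>n\<in>N. U #> n)"
  proof (intro equalityI subsetI)
    fix x assume "x \<in> {x \<in> topspace X. x <# N \<in> (\<lambda>x. x <# N) ` U}"
    then obtain u where u: "x \<in> carrier G" "u \<in> U" "u <# N = x <# N" by auto
    then have "inv u \<otimes> x \<in> N" using lcos_eq_iff[OF N] Uc by blast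
    moreover have "x = u \<otimes> (inv u \<otimes> x)" using u Uc by (simp add: subset_iff flip: m_assoc)
    ultimately show "x \<in> (\<Union>n\<in>N. U #> n)" using u(2) unfolding rcos_image by blast
  next
    fix x assume "x \<in> (\<Union>n\<in>N. U #> n)"
    then obtain u n where "u \<in> U" "n \<in> N" "x = u \<otimes> n" unfolding rcos_image by blast
    then show "x \<in> {x \<in> topspace X. x <# N \<in> (\<lambda>x. x <# N) ` U}"
      using Uc normal_carrier[OF N] lcos_absorb[OF N, of u n] by auto
  qed
  have "openin X (\<Union>n\<in>N. U #> n)"
    using openin_rcos[OF U] normal_carrier[OF N] by blast
  then show ?thesis
    unfolding coset_topology_def openin_quotient_topology eq using Uc by auto
qed

text \<open>A point off the closed coset relation has a product neighbourhood off it; the images of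
  the two factors are open and disjoint.\<close>

lemma coset_Hausdorff:
  assumes N: "adm N"
  shows "Hausdorff_space (coset_topology G X N)"
  unfolding Hausdorff_space_def
proof (intro allI impI, elim conjE)
  note nN = adm_normal[OF N]
  let ?R = "{(x, y). x \<in> carrier G \<and> y \<in> carrier G \<and> inv x \<otimes> y \<in> N}"
  fix A B assume "A \<in> topspace (coset_topology G X N)" "B \<in> topspace (coset_topology G X N)" and AB: "A \<noteq> B"
  then obtain x y where xy: "x \<in> carrier G" "y \<in> carrier G" "A = x <# N" "B = y <# N"
    unfolding topspace_coset by blast
  have nR: "(x, y) \<notin> ?R" using AB lcos_eq_iff[OF nN xy(1,2)] xy by auto
  have op: "openin (prod_topology X X) (topspace (prod_topology X X) - ?R)"
    using N unfolding adm_def by blast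
  have "(x, y) \<in> topspace (prod_topology X X) - ?R" using xy nR by simp
  then obtain U V where UV: "openin X U" "openin X V" "x \<in> U" "y \<in> V" "U \<times> V \<subseteq> topspace (prod_topology X X) - ?R"
    using op[unfolded openin_prod_topology_alt, rule_format, of x y] by auto
  have "disjnt ((\<lambda>x. x <# N) ` U) ((\<lambda>x. x <# N) ` V)"
  proof (rule ccontr)
    assume "\<not> ?thesis"
    then obtain u v where uv: "u \<in> U" "v \<in> V" "u <# N = v <# N" unfolding disjnt_def by blast
    have uvc: "u \<in> carrier G" "v \<in> carrier G"
      using uv(1,2) open_carrier[OF UV(1)] open_carrier[OF UV(2)] by auto
    have "(u, v) \<in> ?R" using lcos_eq_iff[OF nN uvc] uv(3) uvc by simp
    moreover have "(u, v) \<in> U \<times> V" using uv by simp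
    ultimately show False using UV(5) by blast
  qed
  then show "\<exists>U V. openin (coset_topology G X N) U \<and> openin (coset_topology G X N) V \<and> A \<in> U \<and> B \<in> V \<and> disjnt U V"
    using coset_open_map[OF nN UV(1)] coset_open_map[OF nN UV(2)] UV(3,4) xy(3,4) by blast
qed

text \<open>Images of relatively compact open sets cover \<open>K\<close>, and finitely many
  suffice; the union of the compact sets containing them is \<open>C\<close>. Hence supports that
  are compact modulo \<open>N\<close> are the same as compact supports on the coset space.\<close>

lemma coset_compact_lift:
  assumes N: "N \<lhd> G" and K: "compactin (coset_topology G X N) K"
  obtains C where "compactin X C" "\<And>x. x \<in> carrier G \<Longrightarrow> x <# N \<in> K \<Longrightarrow> x \<in> C <#> N"
proof -
  let ?Y = "coset_topology G X N"
  have "\<exists>U L. openin X U \<and> compactin X L \<and> x \<in> U \<and> U \<subseteq> L" if "x \<in> carrier G" for x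
    using lc that unfolding locally_compact_space_def by simp
  then obtain U L where UL: "\<And>x. x \<in> carrier G \<Longrightarrow> openin X (U x) \<and> compactin X (L x) \<and> x \<in> U x \<and> U x \<subseteq> L x"
    by metis
  let ?\<U> = "(\<lambda>x. (\<lambda>y. y <# N) ` U x) ` carrier G"
  have "openin ?Y T" if "T \<in> ?\<U>" for T using that UL coset_open_map[OF N] by blast
  moreover have "K \<subseteq> \<Union>?\<U>"
  proof
    fix A assume "A \<in> K"
    then obtain x where x: "x \<in> carrier G" "A = x <# N"
      using compactin_subset_topspace[OF K] unfolding topspace_coset by blast
    then have "A \<in> (\<lambda>y. y <# N) ` U x" using UL by blast
    then show "A \<in> \<Union>?\<U>" using x(1) by blast
  qed
  ultimately obtain \<F> where F: "finite \<F>" "\<F> \<subseteq> ?\<U>" "K \<subseteq> \<Union>\<F>"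
    using compactinD[OF K, of ?\<U>] by blast
  obtain D where "D \<subseteq> carrier G" "finite D" "\<F> = (\<lambda>x. (\<lambda>y. y <# N) ` U x) ` D"
    using finite_subset_image[OF F(1,2)] by blast
  then have D: "finite D" "D \<subseteq> carrier G" "K \<subseteq> (\<Union>x\<in>D. (\<lambda>y. y <# N) ` U x)"
    using F(3) by auto
  show ?thesis
  proof (rule that)
    show "compactin X (\<Union>x\<in>D. L x)" using D UL by (intro compactin_Union) auto
    fix x assume x: "x \<in> carrier G" "x <# N \<in> K"
    then obtain d u where u: "d \<in> D" "u \<in> U d" "u <# N = x <# N" using D(3) by blast
    then have ud: "u \<in> L d" "u \<in> carrier G" using UL D(2) open_carrier by blast+
    then have "inv u \<otimes> x \<in> N" using lcos_eq_iff[OF N] u x by blast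
    moreover have "x = u \<otimes> (inv u \<otimes> x)" using ud x by (simp flip: m_assoc)
    ultimately show "x \<in> (\<Union>x\<in>D. L x) <#> N" using ud(1) u(1) unfolding set_mult_iff by blast
  qed
qed

text \<open>\<open>push\<close> and \<open>pull\<close> identify functions on the group that are
  constant on cosets with functions on the coset space. The choice of a representative is harmless
  for \<open>f\<close> in \<open>CN N\<close>.\<close>

definition push :: "'a set \<Rightarrow> ('a \<Rightarrow> real) \<Rightarrow> 'a set \<Rightarrow> real" where
  "push N f = (\<lambda>A. if A \<in> (\<lambda>x. x <# N) ` carrier G then f (SOME x. x \<in> carrier G \<and> x <# N = A) else 0)"

definition pull :: "'a set \<Rightarrow> ('a set \<Rightarrow> real) \<Rightarrow> 'a \<Rightarrow> real" where
  "pull N F = (\<lambda>x. if x \<in> carrier G then F (x <# N) else 0)"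

lemma push_eq:
  assumes f: "f \<in> CN N" and N: "N \<lhd> G" and x: "x \<in> carrier G"
  shows "push N f (x <# N) = f x"
proof -
  define y where "y = (SOME y. y \<in> carrier G \<and> y <# N = x <# N)"
  have y: "y \<in> carrier G" "y <# N = x <# N"
    using someI[of "\<lambda>y. y \<in> carrier G \<and> y <# N = x <# N" x] x unfolding y_def by auto
  then have "inv x \<otimes> y \<in> N" using lcos_eq_iff[OF N x y(1)] by simp
  then have "f (x \<otimes> (inv x \<otimes> y)) = f x" by (rule CN_inv[OF f x])
  then have "f y = f x" using x y(1) by (simp flip: m_assoc)
  then show ?thesis using x unfolding push_def y_def by auto
qed

lemma push_outside: "A \<notin> (\<lambda>x. x <# N) ` carrier G \<Longrightarrow> push N f A = 0"
  unfolding push_def by simp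

lemma push_add: "push N (\<lambda>x. f x + g x) = (\<lambda>A. push N f A + push N g A)"
  and push_scale: "push N (\<lambda>x. c * f x) = (\<lambda>A. c * push N f A)"
  unfolding push_def by auto

lemma push_cont:
  assumes f: "f \<in> CN N" and N: "N \<lhd> G"
  shows "continuous_map (coset_topology G X N) euclideanreal (push N f)"
proof -
  have "continuous_map X euclideanreal (push N f \<circ> (\<lambda>x. x <# N))"
    by (rule continuous_map_eq[OF CN_cont[OF f]]) (simp add: push_eq[OF f N])
  then show ?thesis by (rule continuous_compose_quotient_map[OF coset_quotient_map])
qed

lemma push_Cc:
  assumes f: "f \<in> CN N" and N: "N \<lhd> G"
  shows "push N f \<in> Cc (coset_topology G X N)"
proof -
  obtain C where C: "compactin X C" "\<And>x. x \<notin> C <#> N \<Longrightarrow> f x = 0"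
    using CN_support[OF f] by metis
  show ?thesis
  proof (rule CcI[OF push_cont[OF f N]])
    show "0 \<le> push N f A" for A unfolding push_def using CN_nonneg[OF f] by simp
    show "compactin (coset_topology G X N) ((\<lambda>x. x <# N) ` C)"
      by (rule image_compactin[OF C(1) coset_cont])
    fix A assume A: "A \<notin> (\<lambda>x. x <# N) ` C"
    show "push N f A = 0"
    proof (cases "A \<in> (\<lambda>x. x <# N) ` carrier G")
      case True
      then obtain x where x: "x \<in> carrier G" "A = x <# N" by blast
      have "x \<notin> C <#> N"
      proof
        assume "x \<in> C <#> N"
        then obtain c n where cn: "c \<in> C" "n \<in> N" "x = c \<otimes> n" unfolding set_mult_iff by blast
        then have "A = c <# N" using x lcos_absorb[OF N] compact_carrier[OF C(1)] by blast
        then show False using A cn by blast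
      qed
      then show ?thesis using push_eq[OF f N x(1)] C(2) x by simp
    qed (rule push_outside)
  qed
qed

lemma pull_CN:
  assumes F: "F \<in> Cc (coset_topology G X N)" and N: "N \<lhd> G"
  shows "pull N F \<in> CN N"
proof -
  obtain K where K: "compactin (coset_topology G X N) K" "\<And>A. A \<notin> K \<Longrightarrow> F A = 0"
    using Cc_support[OF F] by metis
  obtain C where C: "compactin X C" "\<And>x. x \<in> carrier G \<Longrightarrow> x <# N \<in> K \<Longrightarrow> x \<in> C <#> N"
    using coset_compact_lift[OF N K(1)] by metis
  show ?thesis
  proof (rule CNI[OF _ _ _ C(1)])
    have "continuous_map X euclideanreal (F \<circ> (\<lambda>x. x <# N))"
      by (rule continuous_map_compose[OF coset_cont Cc_cont[OF F]])
    then show "continuous_map X euclideanreal (pull N F)"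
      by (rule continuous_map_eq) (simp add: pull_def)
    show "0 \<le> pull N F x" for x unfolding pull_def using Cc_nonneg[OF F] by simp
    show "pull N F (x \<otimes> l) = pull N F x" if "x \<in> carrier G" "l \<in> N" for x l
      using that normal_carrier[OF N] lcos_absorb[OF N that] unfolding pull_def by auto
    show "pull N F x = 0" if "x \<notin> C <#> N" for x
      using that C(2) K(2) unfolding pull_def by auto
  qed
qed

lemma pull_push:
  assumes f: "f \<in> CN N" and N: "N \<lhd> G"
  shows "pull N (push N f) = f"
  using push_eq[OF f N] CN_outside[OF f N] unfolding pull_def by auto

lemma push_pull:
  assumes F: "F \<in> Cc (coset_topology G X N)" and N: "N \<lhd> G"
  shows "push N (pull N F) = F"
proof
  fix A show "push N (pull N F) A = F A"
  proof (cases "A \<in> (\<lambda>x. x <# N) ` carrier G")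
    case True
    then show ?thesis using push_eq[OF pull_CN[OF F N] N] by (auto simp: pull_def)
  next
    case False
    then show ?thesis using Cc_outside[OF F, of A] by (simp add: push_outside topspace_coset)
  qed
qed

text \<open>\<open>push\<close> and \<open>pull\<close> are mutually inverse, respect sums and
  multiples, and carry right translation by s to right translation by its coset. Existence and
  uniqueness on the locally compact group G/N are transported along them.\<close>

lemma haar_quotient_group:
  assumes N: "N \<lhd> G" and lcg: "lc_group (G Mod N) (coset_topology G X N)"
  shows "\<exists>I. haar (CN N) I" "unique_haar (CN N)"
proof -
  let ?Y = "coset_topology G X N"
  interpret Q: lc_group "G Mod N" ?Y by (rule lcg)
  have rtp: "push N (rt s f) = Q.rt (s <# N) (push N f)" if f: "f \<in> CN N" and s: "s \<in> carrier G" for f s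
  proof
    fix A show "push N (rt s f) A = Q.rt (s <# N) (push N f) A"
    proof (cases "A \<in> (\<lambda>x. x <# N) ` carrier G")
      case True
      then obtain x where x: "x \<in> carrier G" "A = x <# N" by blast
      then show ?thesis
        using push_eq[OF rt_CN[OF f N s] N x(1)] push_eq[OF f N, of "x \<otimes> s"] lcos_mult[OF N x(1) s] s
        unfolding Q.rt_def by (auto simp: carrier_Mod[OF N] rt_def)
    next
      case False
      then show ?thesis unfolding Q.rt_def by (simp add: push_outside carrier_Mod[OF N])
    qed
  qed
  have rtq: "pull N (Q.rt (s <# N) F) = rt s (pull N F)" if s: "s \<in> carrier G" for F s
    using s lcos_mult[OF N _ s] unfolding pull_def rt_def Q.rt_def
    by (auto simp: carrier_Mod[OF N] fun_eq_iff)
  have toQ: "Q.haar (Cc ?Y) (\<lambda>F. I (pull N F))" if I: "haar (CN N) I" for I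
    unfolding Q.haar_def pos_functional_def
  proof (intro conjI ballI allI impI)
    note P = haar_pos_functional[OF I]
    fix F assume F: "F \<in> Cc ?Y"
    show "0 \<le> I (pull N F)" by (rule pos_functional_nonneg[OF P pull_CN[OF F N]])
    have "pull N (\<lambda>A. c * F A) = (\<lambda>x. c * pull N F x)" for c unfolding pull_def by auto
    then show "I (pull N (\<lambda>A. c * F A)) = c * I (pull N F)" if "0 \<le> c" for c
      using pos_functional_scale[OF P pull_CN[OF F N] that] by simp
    show "I (pull N (Q.rt s F)) = I (pull N F)" if s: "s \<in> carrier (G Mod N)" for s
      using s rtq haar_rt[OF I pull_CN[OF F N]] by (auto simp: carrier_Mod[OF N])
    fix F' assume F': "F' \<in> Cc ?Y"
    have "pull N (\<lambda>A. F A + F' A) = (\<lambda>x. pull N F x + pull N F' x)" unfolding pull_def by auto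
    then show "I (pull N (\<lambda>A. F A + F' A)) = I (pull N F) + I (pull N F')"
      using pos_functional_add[OF P pull_CN[OF F N] pull_CN[OF F' N]] by simp
  next
    obtain f where "f \<in> CN N" "I f \<noteq> 0" using I unfolding haar_def by blast
    then show "\<exists>F\<in>Cc ?Y. I (pull N F) \<noteq> 0"
      using push_Cc[OF _ N] pull_push[OF _ N] by (intro bexI[of _ "push N f"]) auto
  qed
  show "\<exists>I. haar (CN N) I"
  proof -
    obtain J where J: "Q.haar (Cc ?Y) J" using Q.haar_exists_group .
    note P = Q.haar_pos_functional[OF J]
    have "haar (CN N) (\<lambda>f. J (push N f))"
      unfolding haar_def pos_functional_def
    proof (intro conjI ballI allI impI)
      fix f assume f: "f \<in> CN N"
      show "0 \<le> J (push N f)" by (rule pos_functional_nonneg[OF P push_Cc[OF f N]])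
      show "J (push N (\<lambda>A. c * f A)) = c * J (push N f)" if "0 \<le> c" for c
        using pos_functional_scale[OF P push_Cc[OF f N] that] by (simp add: push_scale)
      show "J (push N (rt s f)) = J (push N f)" if s: "s \<in> carrier G" for s
        using rtp[OF f s] Q.haar_rt[OF J push_Cc[OF f N], of "s <# N"] s by (simp add: carrier_Mod[OF N])
      show "J (push N (\<lambda>A. f A + f' A)) = J (push N f) + J (push N f')" if f': "f' \<in> CN N" for f'
        using pos_functional_add[OF P push_Cc[OF f N] push_Cc[OF f' N]] by (simp add: push_add)
    next
      obtain F where "F \<in> Cc ?Y" "J F \<noteq> 0" using J unfolding Q.haar_def by blast
      then show "\<exists>f\<in>CN N. J (push N f) \<noteq> 0"
        using pull_CN[OF _ N] push_pull[OF _ N] by (intro bexI[of _ "pull N F"]) auto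
    qed
    then show ?thesis by blast
  qed
  show "unique_haar (CN N)"
    unfolding unique_haar_def
  proof (intro allI impI ballI)
    fix I J f g assume I: "haar (CN N) I" "haar (CN N) J" and f: "f \<in> CN N" "g \<in> CN N"
    show "I f * J g = I g * J f"
      using Q.haar_unique_group[OF toQ[OF I(1)] toQ[OF I(2)] push_Cc[OF f(1) N] push_Cc[OF f(2) N]]
      by (simp add: pull_push[OF _ N] f)
  qed
qed

end

section \<open>Averaging over a compact subquotient\<close>

lemma (in lc_group) compact_one_Cc:
  assumes "compact_space X"
  shows "indicator (carrier G) \<in> Cc X"
proof (rule CcI)
  show "continuous_map X euclideanreal (indicator (carrier G))"
    by (rule continuous_map_eq[of _ _ "\<lambda>x. 1"]) auto
  show "compactin X (topspace X)" using assms by (simp add: compact_space_def)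
qed auto

text \<open>Uniqueness makes a Haar functional of a compact group invariant under left translations
  and under continuous automorphisms; both are of the following form.\<close>

lemma (in lc_group) compact_haar_invariant:
  assumes cs: "compact_space X" and h: "haar (Cc X) h" and F: "F \<in> Cc X"
    and c: "continuous_map X X c"
    and eq: "\<And>B. B \<in> carrier G \<Longrightarrow> \<exists>B'\<in>carrier G. \<forall>A\<in>carrier G. c A \<otimes> B = c (A \<otimes> B')"
  shows "h (\<lambda>A. if A \<in> carrier G then F (c A) else 0) = h F"
proof -
  define co where "co F = (\<lambda>A. if A \<in> carrier G then F (c A) else 0)" for F :: "'a \<Rightarrow> real"
  note P = haar_pos_functional[OF h]
  have cc: "c A \<in> carrier G" if "A \<in> carrier G" for A
    using continuous_map_image_subset_topspace[OF c] that by auto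
  have co: "co F \<in> Cc X" if F: "F \<in> Cc X" for F
  proof (rule CcI)
    have "continuous_map X euclideanreal (F \<circ> c)" by (rule continuous_map_compose[OF c Cc_cont[OF F]])
    then show "continuous_map X euclideanreal (co F)"
      by (rule continuous_map_eq) (simp add: co_def)
    show "0 \<le> co F x" for x unfolding co_def using Cc_nonneg[OF F] by simp
    show "compactin X (topspace X)" using cs by (simp add: compact_space_def)
    show "co F x = 0" if "x \<notin> topspace X" for x using that unfolding co_def by simp
  qed
  let ?one = "indicator (carrier G) :: 'a \<Rightarrow> real"
  have one: "?one \<in> Cc X" by (rule compact_one_Cc[OF cs])
  have co1: "co ?one = ?one" unfolding co_def using cc by (auto simp: indicator_def)
  have h1: "h ?one > 0"
    using haar_strictly_pos[OF one_is_normal, of h ?one \<one>] h one by (simp add: CN_one)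
  have J: "haar (Cc X) (\<lambda>F. h (co F))"
    unfolding haar_def pos_functional_def
  proof (intro conjI ballI allI impI)
    fix F assume F: "F \<in> Cc X"
    show "0 \<le> h (co F)" by (rule pos_functional_nonneg[OF P co[OF F]])
    have "co (\<lambda>A. k * F A) = (\<lambda>x. k * co F x)" for k unfolding co_def by auto
    then show "h (co (\<lambda>A. k * F A)) = k * h (co F)" if "0 \<le> k" for k
      using pos_functional_scale[OF P co[OF F] that] by simp
    \<comment> \<open>Hypothesis \<open>eq\<close> moves a right translation past the map
      \<open>c\<close>, possibly changing the translating element.\<close>
    show "h (co (rt B F)) = h (co F)" if B: "B \<in> carrier G" for B
    proof -
      obtain B' where B': "B' \<in> carrier G" "\<And>A. A \<in> carrier G \<Longrightarrow> c A \<otimes> B = c (A \<otimes> B')"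
        using eq[OF B] by blast
      have "co (rt B F) = rt B' (co F)"
        unfolding co_def rt_def using B' B cc by (auto simp: fun_eq_iff)
      then show ?thesis using haar_rt[OF h co[OF F] B'(1)] by simp
    qed
    fix F' assume F': "F' \<in> Cc X"
    have "co (\<lambda>A. F A + F' A) = (\<lambda>x. co F x + co F' x)" unfolding co_def by auto
    then show "h (co (\<lambda>A. F A + F' A)) = h (co F) + h (co F')"
      using pos_functional_add[OF P co[OF F] co[OF F']] by simp
  next
    show "\<exists>F\<in>Cc X. h (co F) \<noteq> 0" using one co1 h1 by (intro bexI[of _ ?one]) auto
  qed
  \<comment> \<open>Composition with \<open>c\<close> fixes the constant 1, so the proportionality
    factor given by uniqueness is 1.\<close>
  have "h (co F) * h ?one = h (co ?one) * h F" by (rule haar_unique_group[OF J h F one])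
  then have "h (co F) = h F" using co1 h1 by simp
  then show ?thesis unfolding co_def .
qed

text \<open>One successor step, with M and N two consecutive members of the system. \<open>Y\<close>
  is the space G/N, \<open>Z\<close> the compact group M/N, and \<open>joint\<close> is the jointly
  continuous right action of M/N on G/N.\<close>

locale compact_step = rt_group +
  fixes M N :: "'a set" and Y Z :: "'a set topology"
  defines "Y \<equiv> coset_topology G X N"
    and "Z \<equiv> coset_topology (G\<lparr>carrier := M\<rparr>) (subtopology X M) N"
  assumes M: "adm M" and N: "adm N" and NM: "N \<subseteq> M"
    and tgZ: "topological_group (G\<lparr>carrier := M\<rparr> Mod N) Z"
    and compact_Z: "compact_space Z" and Hausdorff_Z: "Hausdorff_space Z"
    and joint: "continuous_map (prod_topology Y Z) Y (\<lambda>(A, B). A <#> B)"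
begin

lemmas nN = adm_normal[OF N] and nM = adm_normal[OF M]

abbreviation pr :: "'a \<Rightarrow> 'a set" where "pr x \<equiv> x <# N"

lemma M_carrier: "M \<subseteq> carrier G"
  by (rule normal_carrier[OF nM])

lemma topspace_Y: "topspace Y = pr ` carrier G"
  unfolding Y_def by (rule topspace_coset)

lemma topspace_Z: "topspace Z = pr ` M"
  unfolding Z_def coset_topology_def using M_carrier by (auto simp: l_coset_consistent)

lemma lc_group_Z: "lc_group (G\<lparr>carrier := M\<rparr> Mod N) Z"
  by (rule lc_group_of_topological_group[OF tgZ compact_imp_locally_compact_space[OF compact_Z] Hausdorff_Z])

sublocale K: lc_group "G\<lparr>carrier := M\<rparr> Mod N" Z
  by (rule lc_group_Z)

lemma carrier_K: "carrier (G\<lparr>carrier := M\<rparr> Mod N) = pr ` M"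
  using K.topspace_X topspace_Z by simp

declare K.topspace_X [simp del]

abbreviation one_Z :: "'a set \<Rightarrow> real" where "one_Z \<equiv> indicator (pr ` M)"

lemma one_Z_Cc: "one_Z \<in> Cc Z"
  using K.compact_one_Cc[OF compact_Z] unfolding carrier_K .

text \<open>Total mass 1 makes the averaging operator a projection onto the functions constant on
  the cosets of \<open>M\<close>.\<close>

definition hK :: "('a set \<Rightarrow> real) \<Rightarrow> real" where
  "hK = (SOME h. K.haar (Cc Z) h \<and> h one_Z = 1)"

lemma hK: "K.haar (Cc Z) hK" and hK_one: "hK one_Z = 1"
proof -
  obtain h where h: "K.haar (Cc Z) h" using K.haar_exists_group .
  have "K.haar (K.CN {\<one>\<^bsub>G\<lparr>carrier := M\<rparr> Mod N\<^esub>}) h" using h unfolding K.CN_one .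
  moreover have "one_Z \<in> K.CN {\<one>\<^bsub>G\<lparr>carrier := M\<rparr> Mod N\<^esub>}" using one_Z_Cc unfolding K.CN_one .
  moreover have "one_Z \<one>\<^bsub>G\<lparr>carrier := M\<rparr> Mod N\<^esub> > 0"
    using K.one_closed unfolding carrier_K by simp
  ultimately have p: "h one_Z > 0" by (rule K.haar_strictly_pos[OF K.one_is_normal])
  define h' where "h' F = inverse (h one_Z) * h F" for F
  have "K.haar (Cc Z) h'"
    using h p unfolding h'_def K.haar_def pos_functional_def
    by (auto simp: distrib_left)
  moreover have "h' one_Z = 1" using p unfolding h'_def by simp
  ultimately have "\<exists>h. K.haar (Cc Z) h \<and> h one_Z = 1" by blast
  from someI_ex[OF this] show "K.haar (Cc Z) hK" "hK one_Z = 1" unfolding hK_def by blast+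
qed

lemmas hP = K.haar_pos_functional[OF hK]

text \<open>The restriction of \<open>f\<close> to the coset x M, regarded as the function mN
  \<mapsto> f(x m) on M/N.\<close>

definition fib :: "('a \<Rightarrow> real) \<Rightarrow> 'a \<Rightarrow> 'a set \<Rightarrow> real" where
  "fib f x = (\<lambda>A. if A \<in> pr ` M then push N f (pr x <#> A) else 0)"

definition avg :: "('a \<Rightarrow> real) \<Rightarrow> 'a \<Rightarrow> real" where
  "avg f x = (if x \<in> carrier G then hK (fib f x) else 0)"

lemma fib_eq:
  assumes f: "f \<in> CN N" and x: "x \<in> carrier G" and m: "m \<in> M"
  shows "fib f x (pr m) = f (x \<otimes> m)"
  using assms M_carrier lcos_mult[OF nN x, of m] push_eq[OF f nN, of "x \<otimes> m"]
  unfolding fib_def by auto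

lemma Psi_cont:
  assumes f: "f \<in> CN N"
  shows "continuous_map (prod_topology Y Z) euclideanreal (\<lambda>p. push N f (fst p <#> snd p))"
  using continuous_map_compose[OF joint push_cont[OF f nN, folded Y_def]]
  by (simp add: o_def case_prod_unfold)

lemma fib_Cc:
  assumes f: "f \<in> CN N" and x: "x \<in> carrier G"
  shows "fib f x \<in> Cc Z"
proof (rule CcI)
  have "continuous_map Z (prod_topology Y Z) (\<lambda>A. (pr x, A))"
    using x by (simp add: continuous_map_pairwise o_def topspace_Y)
  then have "continuous_map Z euclideanreal (\<lambda>A. push N f (pr x <#> A))"
    using continuous_map_compose[OF _ Psi_cont[OF f]] by (fastforce simp: o_def)
  then show "continuous_map Z euclideanreal (fib f x)"
    by (rule continuous_map_eq) (simp add: fib_def topspace_Z)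
  show "0 \<le> fib f x A" for A unfolding fib_def push_def using CN_nonneg[OF f] by simp
  show "compactin Z (topspace Z)" using compact_Z by (simp add: compact_space_def)
  show "fib f x A = 0" if "A \<notin> topspace Z" for A using that unfolding fib_def topspace_Z by simp
qed

text \<open>Joint continuity and the tube lemma over the compact space \<open>Z\<close> make the
  fibres of \<open>f\<close> over nearby points uniformly close; \<open>hK\<close> has total mass 1,
  so the averages are equally close.\<close>

lemma avg_near:
  assumes f: "f \<in> CN N" and x: "x \<in> carrier G" and e: "e > 0"
  shows "\<exists>U. openin X U \<and> x \<in> U \<and> (\<forall>y\<in>U. \<bar>avg f y - avg f x\<bar> \<le> e)"
proof -
  let ?YZ = "prod_topology Y Z"
  have c: "continuous_map ?YZ euclideanreal (\<lambda>p. \<bar>push N f (fst p <#> snd p) - push N f (pr x <#> snd p)\<bar>)"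
  proof -
    have "continuous_map ?YZ ?YZ (\<lambda>p. (pr x, snd p))"
      using x by (simp add: continuous_map_pairwise o_def topspace_Y continuous_map_snd)
    then have "continuous_map ?YZ euclideanreal (\<lambda>p. push N f (pr x <#> snd p))"
      using continuous_map_compose[OF _ Psi_cont[OF f]] by (fastforce simp: o_def)
    then show ?thesis
      by (intro continuous_map_real_abs continuous_map_diff Psi_cont[OF f])
  qed
  define W where "W = {p \<in> topspace ?YZ. \<bar>push N f (fst p <#> snd p) - push N f (pr x <#> snd p)\<bar> \<in> {..<e}}"
  have W: "openin ?YZ W"
    unfolding W_def by (rule openin_continuous_map_preimage[OF c]) auto
  have cz: "compactin Z (topspace Z)" using compact_Z by (simp add: compact_space_def)
  have "{pr x} \<times> topspace Z \<subseteq> W" using x e unfolding W_def by (auto simp: topspace_Y)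
  then obtain V V' where V: "openin Y V" "pr x \<in> V" "topspace Z \<subseteq> V'" "V \<times> V' \<subseteq> W"
    using tube_lemma_right[OF W cz, of "pr x"] x by (auto simp: topspace_Y)
  define U where "U = {y \<in> topspace X. pr y \<in> V}"
  have "openin X U"
    unfolding U_def by (rule openin_continuous_map_preimage[OF coset_cont V(1)[unfolded Y_def]])
  moreover have "x \<in> U" using V x unfolding U_def by simp
  moreover have "\<bar>avg f y - avg f x\<bar> \<le> e" if y: "y \<in> U" for y
  proof -
    have yc: "y \<in> carrier G" using y unfolding U_def by simp
    have "\<bar>fib f y A - fib f x A\<bar> \<le> e * one_Z A" for A
    proof (cases "A \<in> pr ` M")
      case True
      then have "(pr y, A) \<in> W" using V y unfolding U_def by (auto simp: topspace_Z)
      then show ?thesis using True unfolding W_def fib_def by simp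
    qed (simp add: fib_def)
    then have "\<bar>hK (fib f y) - hK (fib f x)\<bar> \<le> e * hK one_Z"
      using e by (intro pos_functional_approx[OF fun_cone_Cc hP fib_Cc[OF f yc] fib_Cc[OF f x] one_Z_Cc]) auto
    then show ?thesis using x yc hK_one unfolding avg_def by simp
  qed
  ultimately show ?thesis by blast
qed

lemma translate_Z:
  assumes m: "m \<in> M"
  shows "continuous_map Z Z (\<lambda>A. pr m <#> A)"
proof -
  have "continuous_map Z Z (\<lambda>A. pr m \<otimes>\<^bsub>G\<lparr>carrier := M\<rparr> Mod N\<^esub> A)"
    by (rule K.mult_cont') (use m in \<open>auto simp: topspace_Z\<close>)
  then show ?thesis by simp
qed

text \<open>The fibre over x m is the left translate of the fibre over x by the coset of m, and the
  Haar functional of a compact group is also invariant under left translations.\<close>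

lemma avg_absorb:
  assumes f: "f \<in> CN N" and x: "x \<in> carrier G" and m: "m \<in> M"
  shows "avg f (x \<otimes> m) = avg f x"
proof -
  have mc: "m \<in> carrier G" using m M_carrier by blast
  interpret M: subgroup M G by (rule normal_imp_subgroup[OF nM])
  have "hK (\<lambda>A. if A \<in> carrier (G\<lparr>carrier := M\<rparr> Mod N) then fib f x (pr m <#> A) else 0) = hK (fib f x)"
  proof (rule K.compact_haar_invariant[OF compact_Z hK fib_Cc[OF f x] translate_Z[OF m]])
    fix B assume B: "B \<in> carrier (G\<lparr>carrier := M\<rparr> Mod N)"
    have "pr m <#> A <#> B = pr m <#> (A <#> B)"
      if A: "A \<in> carrier (G\<lparr>carrier := M\<rparr> Mod N)" for A
      using K.m_assoc[of "pr m" A B] A B m by (simp add: carrier_K)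
    then show "\<exists>B'\<in>carrier (G\<lparr>carrier := M\<rparr> Mod N). \<forall>A\<in>carrier (G\<lparr>carrier := M\<rparr> Mod N).
        (pr m <#> A) \<otimes>\<^bsub>G\<lparr>carrier := M\<rparr> Mod N\<^esub> B = pr m <#> (A \<otimes>\<^bsub>G\<lparr>carrier := M\<rparr> Mod N\<^esub> B')"
      using B by (intro bexI[of _ B]) auto
  qed
  moreover have "(\<lambda>A. if A \<in> carrier (G\<lparr>carrier := M\<rparr> Mod N) then fib f x (pr m <#> A) else 0) = fib f (x \<otimes> m)"
  proof
    fix A show "(if A \<in> carrier (G\<lparr>carrier := M\<rparr> Mod N) then fib f x (pr m <#> A) else 0) = fib f (x \<otimes> m) A"
    proof (cases "A \<in> pr ` M")
      case True
      then obtain k where k: "k \<in> M" "A = pr k" by blast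
      have kc: "k \<in> carrier G" using k M_carrier by blast
      have "fib f x (pr m <#> A) = f (x \<otimes> (m \<otimes> k))"
        using lcos_mult[OF nN mc kc] fib_eq[OF f x, of "m \<otimes> k"] m k by simp
      moreover have "fib f (x \<otimes> m) A = f (x \<otimes> m \<otimes> k)"
        using fib_eq[OF f, of "x \<otimes> m" k] x mc k by simp
      ultimately show ?thesis using True x mc kc by (simp add: carrier_K m_assoc)
    qed (simp add: carrier_K fib_def)
  qed
  ultimately show ?thesis using x mc unfolding avg_def by simp
qed

text \<open>Left translation by \<open>g\<close> embeds the compact group \<open>M/N\<close> into the Hausdorff space
  \<open>G/N\<close>, and right translation by \<open>g\<close> has the same image; hence conjugation by \<open>g\<close> is
  continuous on \<open>M/N\<close>.\<close>

lemma conj_cont: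
  assumes g: "g \<in> carrier G"
  shows "continuous_map Z Z (\<lambda>A. pr (inv g) <#> A <#> pr g)"
proof -
  define \<phi> where "\<phi> A = pr g <#> A" for A
  have \<phi>_pr: "\<phi> (pr k) = pr (g \<otimes> k)" if "k \<in> carrier G" for k
    unfolding \<phi>_def by (rule lcos_mult[OF nN g that])
  have \<phi>c: "continuous_map Z Y \<phi>"
  proof -
    have "continuous_map Z (prod_topology Y Z) (\<lambda>A. (pr g, A))"
      using g by (simp add: continuous_map_pairwise o_def topspace_Y)
    from continuous_map_compose[OF this joint] show ?thesis by (simp add: o_def \<phi>_def[abs_def])
  qed
  have incl: "continuous_map Z Y (\<lambda>A. A)"
  proof -
    have "continuous_map Z (prod_topology Y Z) (\<lambda>A. (pr \<one>, A))"
      by (simp add: continuous_map_pairwise o_def topspace_Y)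
    from continuous_map_compose[OF this joint] have "continuous_map Z Y (\<lambda>A. pr \<one> <#> A)" by (simp add: o_def)
    then show ?thesis
      by (rule continuous_map_eq) (use lcos_mult[OF nN one_closed] M_carrier in \<open>auto simp: topspace_Z subset_iff\<close>)
  qed
  have rg: "continuous_map Y Y (\<lambda>A. A <#> pr g)"
    unfolding Y_def
  proof (rule continuous_compose_quotient_map[OF coset_quotient_map])
    have "continuous_map X (coset_topology G X N) (pr \<circ> (\<lambda>x. x \<otimes> g))"
      by (rule continuous_map_compose[OF right_cont[OF g] coset_cont])
    then show "continuous_map X (coset_topology G X N) ((\<lambda>A. A <#> pr g) \<circ> pr)"
      by (rule continuous_map_eq) (simp add: lcos_mult[OF nN _ g])
  qed
  have inj: "inj_on \<phi> (topspace Z)"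
  proof (rule inj_onI)
    fix A B assume AB: "A \<in> topspace Z" "B \<in> topspace Z" "\<phi> A = \<phi> B"
    then obtain a b where ab: "a \<in> M" "b \<in> M" "A = pr a" "B = pr b" by (auto simp: topspace_Z)
    have c: "a \<in> carrier G" "b \<in> carrier G" using ab M_carrier by auto
    have "pr (g \<otimes> a) = pr (g \<otimes> b)" using AB(3) ab \<phi>_pr c by simp
    then have "inv (g \<otimes> a) \<otimes> (g \<otimes> b) \<in> N" using lcos_eq_iff[OF nN] g c by simp
    moreover have "inv (g \<otimes> a) \<otimes> (g \<otimes> b) = inv a \<otimes> b"
    proof -
      have "inv (g \<otimes> a) \<otimes> (g \<otimes> b) = inv a \<otimes> (inv g \<otimes> (g \<otimes> b))"
        using g c by (simp add: inv_mult_group m_assoc)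
      also have "inv g \<otimes> (g \<otimes> b) = b" using g c by (simp flip: m_assoc)
      finally show ?thesis .
    qed
    ultimately show "A = B" using lcos_eq_iff[OF nN c] ab by simp
  qed
  \<comment> \<open>A continuous injection of a compact space into a Hausdorff space is an
    embedding. Its inverse \<psi> on the image, applied to right translation by g, is conjugation by
    g.\<close>
  have "embedding_map Z Y \<phi>"
    by (rule continuous_imp_embedding_map[OF \<phi>c compact_Z _ inj])
       (simp add: Y_def coset_Hausdorff[OF N])
  then obtain \<psi> where \<psi>: "homeomorphic_maps Z (subtopology Y (\<phi> ` topspace Z)) \<phi> \<psi>"
    unfolding embedding_map_def homeomorphic_map_maps by blast
  have c1: "continuous_map Z Y (\<lambda>A. A <#> pr g)"
    using continuous_map_compose[OF incl rg] by (simp add: o_def)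
  have conj: "pr (inv g) <#> A <#> pr g \<in> topspace Z \<and> \<phi> (pr (inv g) <#> A <#> pr g) = A <#> pr g"
    if "A \<in> topspace Z" for A
  proof -
    obtain k where k: "k \<in> M" "A = pr k" using \<open>A \<in> topspace Z\<close> by (auto simp: topspace_Z)
    have kc: "k \<in> carrier G" using k M_carrier by auto
    have "inv g \<otimes> k \<otimes> g \<in> M" by (rule normal.inv_op_closed1[OF nM g k(1)])
    moreover have "pr (inv g) <#> A <#> pr g = pr (inv g \<otimes> k \<otimes> g)"
      using k kc g by (simp add: lcos_mult[OF nN])
    moreover have "g \<otimes> (inv g \<otimes> k \<otimes> g) = k \<otimes> g" using g kc by (simp flip: m_assoc)
    moreover have "A <#> pr g = pr (k \<otimes> g)" using k kc g by (simp add: lcos_mult[OF nN])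
    ultimately show ?thesis using g kc by (auto simp: topspace_Z \<phi>_pr)
  qed
  have "continuous_map Z (subtopology Y (\<phi> ` topspace Z)) (\<lambda>A. A <#> pr g)"
    unfolding continuous_map_in_subtopology
  proof (intro conjI c1)
    show "(\<lambda>A. A <#> pr g) \<in> topspace Z \<rightarrow> \<phi> ` topspace Z"
      using conj by (auto intro: image_eqI[OF sym])
  qed
  then have "continuous_map Z Z (\<psi> \<circ> (\<lambda>A. A <#> pr g))"
    by (rule continuous_map_compose) (use \<psi> in \<open>auto simp: homeomorphic_maps_def\<close>)
  then show ?thesis
  proof (rule continuous_map_eq)
    fix A assume A: "A \<in> topspace Z"
    have "\<psi> (\<phi> (pr (inv g) <#> A <#> pr g)) = pr (inv g) <#> A <#> pr g"
      using \<psi> conj[OF A] unfolding homeomorphic_maps_def by blast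
    then show "(\<psi> \<circ> (\<lambda>A. A <#> pr g)) A = pr (inv g) <#> A <#> pr g"
      using conj[OF A] by simp
  qed
qed

text \<open>Since x m g = (x g)(inv g m g), the fibre of the translate over x is the fibre of
  \<open>f\<close> over x g composed with conjugation, under which \<open>hK\<close> is
  invariant.\<close>

lemma avg_rt:
  assumes f: "f \<in> CN N" and g: "g \<in> carrier G"
  shows "avg (rt g f) = rt g (avg f)"
proof
  fix x show "avg (rt g f) x = rt g (avg f) x"
  proof (cases "x \<in> carrier G")
    case x: True
    let ?c = "\<lambda>A. pr (inv g) <#> A <#> pr g"
    let ?KG = "G\<lparr>carrier := M\<rparr> Mod N"
    have xg: "x \<otimes> g \<in> carrier G" using x g by simp
    have c_pr: "?c (pr k) = pr (inv g \<otimes> k \<otimes> g)" if "k \<in> carrier G" for k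
      using that g by (simp add: lcos_mult[OF nN])
    have "hK (\<lambda>A. if A \<in> carrier ?KG then fib f (x \<otimes> g) (?c A) else 0) = hK (fib f (x \<otimes> g))"
    proof (rule K.compact_haar_invariant[OF compact_Z hK fib_Cc[OF f xg] conj_cont[OF g]])
      fix B assume "B \<in> carrier ?KG"
      then obtain b where b: "b \<in> M" "B = pr b" unfolding carrier_K by blast
      have bc: "b \<in> carrier G" using b M_carrier by blast
      have b': "g \<otimes> b \<otimes> inv g \<in> M" by (rule normal.inv_op_closed2[OF nM g b(1)])
      have "?c A <#> B = ?c (A <#> pr (g \<otimes> b \<otimes> inv g))" if "A \<in> carrier ?KG" for A
      proof -
        obtain a where a: "a \<in> M" "A = pr a" using \<open>A \<in> carrier ?KG\<close> unfolding carrier_K by blast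
        have ac: "a \<in> carrier G" using a M_carrier by blast
        have "inv g \<otimes> (a \<otimes> (g \<otimes> b \<otimes> inv g)) \<otimes> g = inv g \<otimes> a \<otimes> g \<otimes> b"
          using ac bc g by (simp add: m_assoc)
        then show ?thesis
          using a b ac bc g by (simp add: c_pr lcos_mult[OF nN])
      qed
      then show "\<exists>B'\<in>carrier ?KG. \<forall>A\<in>carrier ?KG. ?c A \<otimes>\<^bsub>?KG\<^esub> B = ?c (A \<otimes>\<^bsub>?KG\<^esub> B')"
        using b' by (intro bexI[of _ "pr (g \<otimes> b \<otimes> inv g)"]) (auto simp: carrier_K)
    qed
    moreover have "(\<lambda>A. if A \<in> carrier ?KG then fib f (x \<otimes> g) (?c A) else 0) = fib (rt g f) x"
    proof
      fix A show "(if A \<in> carrier ?KG then fib f (x \<otimes> g) (?c A) else 0) = fib (rt g f) x A"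
      proof (cases "A \<in> pr ` M")
        case True
        then obtain a where a: "a \<in> M" "A = pr a" by blast
        have ac: "a \<in> carrier G" using a M_carrier by blast
        have "inv g \<otimes> a \<otimes> g \<in> M" by (rule normal.inv_op_closed1[OF nM g a(1)])
        then have "fib f (x \<otimes> g) (?c A) = f (x \<otimes> g \<otimes> (inv g \<otimes> a \<otimes> g))"
          using fib_eq[OF f xg] a c_pr[OF ac] by simp
        also have "x \<otimes> g \<otimes> (inv g \<otimes> a \<otimes> g) = x \<otimes> a \<otimes> g"
        proof -
          have "g \<otimes> (inv g \<otimes> (a \<otimes> g)) = a \<otimes> g" using g ac by (simp flip: m_assoc)
          then show ?thesis using x g ac by (simp add: m_assoc)
        qed
        also have "f (x \<otimes> a \<otimes> g) = fib (rt g f) x A"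
          using fib_eq[OF rt_CN[OF f nN g] x a(1)] a x ac by (simp add: rt_def)
        finally show ?thesis using True by (simp add: carrier_K)
      qed (simp add: carrier_K fib_def)
    qed
    ultimately show ?thesis using x xg by (simp add: avg_def rt_def)
  qed (simp add: avg_def rt_def)
qed

lemma avg_support:
  assumes f: "f \<in> CN N" and C: "compactin X C" "\<And>x. x \<notin> C <#> N \<Longrightarrow> f x = 0" and x: "x \<notin> C <#> M"
  shows "avg f x = 0"
proof (cases "x \<in> carrier G")
  case xc: True
  interpret M: subgroup M G by (rule normal_imp_subgroup[OF nM])
  have "fib f x A = 0" for A
  proof (cases "A \<in> pr ` M")
    case True
    then obtain k where k: "k \<in> M" "A = pr k" by blast
    have "x \<otimes> k \<notin> C <#> N"
    proof
      assume "x \<otimes> k \<in> C <#> N"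
      then obtain c n where cn: "c \<in> C" "n \<in> N" "x \<otimes> k = c \<otimes> n" unfolding set_mult_iff by blast
      have cc: "c \<in> carrier G" "n \<in> M" using cn NM compact_carrier[OF C(1)] by auto
      have "x = c \<otimes> (n \<otimes> inv k)"
        using cn(3) k(1) xc cc by (metis M.mem_carrier inv_closed inv_solve_right m_assoc m_closed)
      then show False using x cn(1) cc(2) k(1) unfolding set_mult_iff by blast
    qed
    then show ?thesis using fib_eq[OF f xc k(1)] k C(2) by simp
  qed (simp add: fib_def)
  then have "fib f x = (\<lambda>A. 0)" by auto
  then show ?thesis using pos_functional_zero[OF hP fun_cone_Cc] by (simp add: avg_def)
qed (simp add: avg_def)

lemma avg_CN:
  assumes f: "f \<in> CN N"
  shows "avg f \<in> CN M"
proof -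
  obtain C where C: "compactin X C" "\<And>x. x \<notin> C <#> N \<Longrightarrow> f x = 0"
    using CN_support[OF f] by metis
  show ?thesis
  proof (rule CNI[OF _ _ avg_absorb[OF f] C(1) avg_support[OF f C]])
    show "continuous_map X euclideanreal (avg f)"
      by (rule continuous_map_realI) (use avg_near[OF f] in auto)
    show "0 \<le> avg f x" for x
      unfolding avg_def using pos_functional_nonneg[OF hP fib_Cc[OF f]] by simp
  qed
qed

lemma avg_add:
  assumes f: "f \<in> CN N" and g: "g \<in> CN N"
  shows "avg (\<lambda>x. f x + g x) = (\<lambda>x. avg f x + avg g x)"
proof
  fix x
  have "fib (\<lambda>x. f x + g x) x = (\<lambda>A. fib f x A + fib g x A)" for x unfolding fib_def by (auto simp: push_add)
  then show "avg (\<lambda>x. f x + g x) x = avg f x + avg g x"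
    using pos_functional_add[OF hP fib_Cc[OF f] fib_Cc[OF g]] unfolding avg_def by simp
qed

lemma avg_scale:
  assumes f: "f \<in> CN N" and c: "0 \<le> c"
  shows "avg (\<lambda>x. c * f x) = (\<lambda>x. c * avg f x)"
proof
  fix x
  have "fib (\<lambda>x. c * f x) x = (\<lambda>A. c * fib f x A)" for x unfolding fib_def by (auto simp: push_scale)
  then show "avg (\<lambda>x. c * f x) x = c * avg f x"
    using pos_functional_scale[OF hP fib_Cc[OF f] c] unfolding avg_def by simp
qed

text \<open>The image of \<open>C <#> M\<close> in G/N is the image of the compact set pr(C)
  \<times> M/N under the joint action, hence compact, and lifts to a compact set modulo
  \<open>N\<close>.\<close>

lemma proper_step: "proper_over M N"
  unfolding proper_over_def
proof (intro allI impI)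
  fix C assume C: "compactin X C"
  have cz: "compactin Z (topspace Z)" using compact_Z by (simp add: compact_space_def)
  have cy: "compactin Y (pr ` C)" unfolding Y_def by (rule image_compactin[OF C coset_cont])
  have "compactin Y ((\<lambda>(A, B). A <#> B) ` (pr ` C \<times> topspace Z))"
    by (rule image_compactin[OF _ joint]) (simp add: compactin_Times cz cy)
  then obtain C' where C': "compactin X C'"
    "\<And>x. x \<in> carrier G \<Longrightarrow> pr x \<in> (\<lambda>(A, B). A <#> B) ` (pr ` C \<times> topspace Z) \<Longrightarrow> x \<in> C' <#> N"
    unfolding Y_def using coset_compact_lift[OF nN] by metis
  have "C <#> M \<subseteq> C' <#> N"
  proof
    fix x assume "x \<in> C <#> M"
    then obtain c m where cm: "c \<in> C" "m \<in> M" "x = c \<otimes> m" unfolding set_mult_iff by blast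
    have cc: "c \<in> carrier G" "m \<in> carrier G" using cm compact_carrier[OF C] M_carrier by auto
    have "pr x = pr c <#> pr m" using cm lcos_mult[OF nN cc] by simp
    moreover have "(pr c, pr m) \<in> pr ` C \<times> topspace Z" using cm by (simp add: topspace_Z)
    ultimately have "pr x \<in> (\<lambda>(A, B). A <#> B) ` (pr ` C \<times> topspace Z)"
      by (metis (mono_tags, lifting) case_prod_conv image_eqI)
    then show "x \<in> C' <#> N" using C'(2) cm cc by simp
  qed
  then show "\<exists>C'. compactin X C' \<and> C <#> M \<subseteq> C' <#> N" using C'(1) by blast
qed

lemma CN_step: "CN M \<subseteq> CN N"
  by (rule CN_mono[OF proper_step NM])

lemma avg_idem:
  assumes f: "f \<in> CN M"
  shows "avg f = f"
proof
  have fN: "f \<in> CN N" using f CN_step by blast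
  fix x show "avg f x = f x"
  proof (cases "x \<in> carrier G")
    case x: True
    have "fib f x = (\<lambda>A. f x * one_Z A)"
    proof
      fix A show "fib f x A = f x * one_Z A"
      proof (cases "A \<in> pr ` M")
        case True
        then obtain k where k: "k \<in> M" "A = pr k" by blast
        then show ?thesis using fib_eq[OF fN x k(1)] CN_inv[OF f x k(1)] by simp
      qed (simp add: fib_def)
    qed
    then show ?thesis
      using pos_functional_scale[OF hP one_Z_Cc CN_nonneg[OF f]] hK_one x by (simp add: avg_def)
  next
    case False
    then show ?thesis using CN_outside[OF f nM] by (simp add: avg_def)
  qed
qed

lemma haar_step:
  assumes I: "haar (CN M) I"
  shows "haar (CN N) (\<lambda>f. I (avg f))"
  unfolding haar_def pos_functional_def
proof (intro conjI ballI allI impI)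
  note P = haar_pos_functional[OF I]
  fix f assume f: "f \<in> CN N"
  show "0 \<le> I (avg f)" by (rule pos_functional_nonneg[OF P avg_CN[OF f]])
  show "I (avg (\<lambda>x. c * f x)) = c * I (avg f)" if "0 \<le> c" for c
    using avg_scale[OF f that] pos_functional_scale[OF P avg_CN[OF f] that] by simp
  show "I (avg (rt s f)) = I (avg f)" if "s \<in> carrier G" for s
    using avg_rt[OF f that] haar_rt[OF I avg_CN[OF f] that] by simp
  show "I (avg (\<lambda>x. f x + g x)) = I (avg f) + I (avg g)" if g: "g \<in> CN N" for g
    using avg_add[OF f g] pos_functional_add[OF P avg_CN[OF f] avg_CN[OF g]] by simp
next
  obtain f where "f \<in> CN M" "I f \<noteq> 0" using I unfolding haar_def by blast
  then show "\<exists>f\<in>CN N. I (avg f) \<noteq> 0" using CN_step by (intro bexI[of _ f]) (auto simp: avg_idem)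
qed

text \<open>The average of \<open>f\<close> is a uniform limit of convex combinations of right translates of \<open>f\<close>.\<close>

lemma haar_avg:
  assumes I: "haar (CN N) I" and f: "f \<in> CN N"
  shows "I (avg f) = I f"
proof -
  note P = haar_pos_functional[OF I]
  obtain C where C: "compactin X C" "\<And>x. x \<notin> C <#> N \<Longrightarrow> f x = 0"
    using CN_support[OF f] by metis
  obtain C' where C': "compactin X C'" "C <#> M \<subseteq> C' <#> N"
    using proper_step C(1) unfolding proper_over_def by blast
  \<comment> \<open>\<open>C' <#> N\<close> contains \<open>C <#> M\<close>, off which the average
    and all translates of \<open>f\<close> by elements of \<open>M\<close> vanish; so
    \<open>u\<close> controls the error everywhere.\<close>
  obtain u where u: "u \<in> CN N" "\<And>x. x \<in> C' <#> N \<Longrightarrow> 1 \<le> u x" using CN_unit[OF N C'(1)] by blast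
  have avgN: "avg f \<in> CN N" using avg_CN[OF f] CN_step by blast
  have cz: "compactin Z (topspace Z)" using compact_Z by (simp add: compact_space_def)
  have cy: "compactin Y (pr ` C')" unfolding Y_def by (rule image_compactin[OF C'(1) coset_cont])
  have est: "\<bar>I (avg f) - I f\<bar> \<le> e * I u" if e: "e > 0" for e
  proof -
    let ?YZ = "prod_topology Y Z"
    \<comment> \<open>The tube lemma, now along the compact image of \<open>C'\<close>: nearby
      elements of M/N act on \<open>f\<close> almost equally, uniformly over that image.\<close>
    have "\<exists>V. openin Z V \<and> A \<in> V \<and> (\<forall>B\<in>V. \<forall>D\<in>pr ` C'. \<bar>push N f (D <#> B) - push N f (D <#> A)\<bar> \<le> e)"
      if A: "A \<in> topspace Z" for A
    proof -
      have c: "continuous_map ?YZ euclideanreal (\<lambda>p. \<bar>push N f (fst p <#> snd p) - push N f (fst p <#> A)\<bar>)"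
      proof -
        have "continuous_map ?YZ ?YZ (\<lambda>p. (fst p, A))"
          using A by (simp add: continuous_map_pairwise o_def continuous_map_fst)
        then have "continuous_map ?YZ euclideanreal (\<lambda>p. push N f (fst p <#> A))"
          using continuous_map_compose[OF _ Psi_cont[OF f]] by (fastforce simp: o_def)
        then show ?thesis
          by (intro continuous_map_real_abs continuous_map_diff Psi_cont[OF f])
      qed
      define W where "W = {p \<in> topspace ?YZ. \<bar>push N f (fst p <#> snd p) - push N f (fst p <#> A)\<bar> \<in> {..<e}}"
      have W: "openin ?YZ W"
        unfolding W_def by (rule openin_continuous_map_preimage[OF c]) auto
      have "pr ` C' \<times> {A} \<subseteq> W"
        using A e compactin_subset_topspace[OF cy] unfolding W_def by auto
      then obtain U V where "openin Z V" "pr ` C' \<subseteq> U" "A \<in> V" "U \<times> V \<subseteq> W"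
        using tube_lemma_left[OF W cy A] by auto
      then have "openin Z V \<and> A \<in> V \<and> (\<forall>B\<in>V. \<forall>D\<in>pr ` C'. (D, B) \<in> W)" by blast
      then show ?thesis unfolding W_def by (intro exI[of _ V]) (auto intro!: less_imp_le)
    qed
    then obtain V where V: "\<And>A. A \<in> topspace Z \<Longrightarrow> openin Z (V A) \<and> A \<in> V A \<and>
        (\<forall>B\<in>V A. \<forall>D\<in>pr ` C'. \<bar>push N f (D <#> B) - push N f (D <#> A)\<bar> \<le> e)"
      by metis
    have "openin Z T" if "T \<in> V ` topspace Z" for T using that V by blast
    moreover have "topspace Z \<subseteq> \<Union>(V ` topspace Z)" using V by blast
    ultimately obtain \<F> where F: "finite \<F>" "\<F> \<subseteq> V ` topspace Z" "topspace Z \<subseteq> \<Union>\<F>"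
      using compactinD[OF cz, of "V ` topspace Z"] by blast
    obtain D where D: "D \<subseteq> topspace Z" "finite D" "\<F> = V ` D"
      using finite_subset_image[OF F(1,2)] by blast
    have VD: "openin Z (V A)" if "A \<in> D" for A using V D(1) that by blast
    have cov: "topspace Z \<subseteq> (\<Union>A\<in>D. V A)" using F(3) D(3) by simp
    obtain p K' where p: "\<And>A. A \<in> D \<Longrightarrow> p A \<in> Cc Z" "\<And>A. A \<in> D \<Longrightarrow> K' A \<subseteq> V A"
      "\<And>A x. A \<in> D \<Longrightarrow> x \<notin> K' A \<Longrightarrow> p A x = 0" "\<And>x. x \<in> topspace Z \<Longrightarrow> (\<Sum>A\<in>D. p A x) = (1::real)"
      using Cc_partition_of_unity[OF K.lc K.haus cz D(2) VD cov] by metis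
    have "\<exists>l. l \<in> M \<and> A = pr l" if "A \<in> D" for A using that D(1) by (auto simp: topspace_Z)
    then obtain l where l: "\<And>A. A \<in> D \<Longrightarrow> l A \<in> M \<and> A = pr (l A)" by metis
    have lc: "l A \<in> carrier G" if "A \<in> D" for A using l that M_carrier by blast
    define w where "w A = hK (p A)" for A
    have w0: "0 \<le> w A" if "A \<in> D" for A
      unfolding w_def by (rule pos_functional_nonneg[OF hP p(1)[OF that]])
    have "(\<lambda>B. \<Sum>A\<in>D. p A B) = one_Z"
    proof
      fix B show "(\<Sum>A\<in>D. p A B) = one_Z B"
        using p(4)[of B] Cc_outside[OF p(1), of _ B] by (cases "B \<in> topspace Z") (auto simp: topspace_Z)
    qed
    then have wsum: "(\<Sum>A\<in>D. w A) = 1"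
      using pos_functional_sum[OF fun_cone_Cc hP, of D p, OF p(1)] hK_one unfolding w_def by simp
    \<comment> \<open>The weights are the \<open>hK\<close>-masses of a partition of unity on M/N
      and add up to 1. So \<open>g\<close> is a Riemann sum for the average, while
      \<open>I g = I f\<close> by right invariance.\<close>
    define g where "g = (\<lambda>x. \<Sum>A\<in>D. w A * rt (l A) f x)"
    have gt: "(\<lambda>x. w A * rt (l A) f x) \<in> CN N" if "A \<in> D" for A
      by (rule fun_cone_scale[OF fun_cone_CN rt_CN[OF f nN lc[OF that]] w0[OF that]])
    have g: "g \<in> CN N" unfolding g_def by (rule fun_cone_sum[OF fun_cone_CN gt])
    have "I g = (\<Sum>A\<in>D. I (\<lambda>x. w A * rt (l A) f x))"
      unfolding g_def by (rule pos_functional_sum[OF fun_cone_CN P gt])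
    also have "\<dots> = (\<Sum>A\<in>D. w A * I f)"
      using pos_functional_scale[OF P rt_CN[OF f nN lc] w0] haar_rt[OF I f lc] by simp
    finally have Ig: "I g = I f" using wsum by (simp flip: sum_distrib_right)
    have "\<bar>avg f x - g x\<bar> \<le> e * u x" for x
    proof (cases "x \<in> C' <#> N")
      case True
      then obtain c n where cn: "c \<in> C'" "n \<in> N" "x = c \<otimes> n" unfolding set_mult_iff by blast
      have cc: "c \<in> carrier G" using cn compact_carrier[OF C'(1)] by blast
      have x: "x \<in> carrier G" using cn cc normal_carrier[OF nN] by auto
      have prx: "pr x \<in> pr ` C'" using lcos_absorb[OF nN cc cn(2)] cn by simp
      define q where "q A = (\<lambda>B. fib f x B * p A B)" for A
      have q: "q A \<in> Cc Z" if "A \<in> D" for A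
        unfolding q_def
        by (rule Cc_mult[OF fib_Cc[OF f x] Cc_cont[OF p(1)[OF that]]]) (rule Cc_nonneg[OF p(1)[OF that]])
      have "fib f x = (\<lambda>B. \<Sum>A\<in>D. q A B)"
      proof
        fix B show "fib f x B = (\<Sum>A\<in>D. q A B)"
          using p(4)[of B] unfolding q_def sum_distrib_left[symmetric]
          by (cases "B \<in> topspace Z") (auto simp: topspace_Z fib_def)
      qed
      then have avg: "avg f x = (\<Sum>A\<in>D. hK (q A))"
        using pos_functional_sum[OF fun_cone_Cc hP, of D q, OF q] x unfolding avg_def by simp
      have "\<bar>hK (q A) - w A * rt (l A) f x\<bar> \<le> e * w A" if A: "A \<in> D" for A
      proof -
        have r: "rt (l A) f x = push N f (pr x <#> A)"
          using l[OF A] fib_eq[OF f x, of "l A"] x by (auto simp: rt_def fib_def)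
        have rn: "0 \<le> rt (l A) f x" by (rule CN_nonneg[OF rt_CN[OF f nN lc[OF A]]])
        have "\<bar>q A B - rt (l A) f x * p A B\<bar> \<le> e * p A B" for B
        proof (cases "B \<in> K' A")
          case True
          then have B: "B \<in> V A" using p(2)[OF A] by blast
          then have BM: "B \<in> pr ` M" using openin_subset[OF VD[OF A]] by (auto simp: topspace_Z)
          have At: "A \<in> topspace Z" using A D(1) by blast
          have "\<bar>push N f (pr x <#> B) - push N f (pr x <#> A)\<bar> \<le> e"
            using V[OF At] B prx by blast
          then have "\<bar>fib f x B - rt (l A) f x\<bar> \<le> e" using BM r by (simp add: fib_def)
          then have "\<bar>fib f x B - rt (l A) f x\<bar> * p A B \<le> e * p A B"
            using Cc_nonneg[OF p(1)[OF A]] by (intro mult_right_mono)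
          moreover have "q A B - rt (l A) f x * p A B = (fib f x B - rt (l A) f x) * p A B"
            unfolding q_def by (simp add: algebra_simps)
          ultimately show ?thesis using Cc_nonneg[OF p(1)[OF A], of B] by (simp add: abs_mult)
        next
          case False
          then show ?thesis using p(3)[OF A] by (simp add: q_def)
        qed
        then have "\<bar>hK (q A) - hK (\<lambda>B. rt (l A) f x * p A B)\<bar> \<le> e * hK (p A)"
          by (intro pos_functional_approx[OF fun_cone_Cc hP q[OF A] fun_cone_scale[OF fun_cone_Cc p(1)[OF A] rn] p(1)[OF A]])
             (use e in auto)
        then show ?thesis
          using pos_functional_scale[OF hP p(1)[OF A] rn] unfolding w_def by (simp add: mult.commute)
      qed
      then have "\<bar>avg f x - g x\<bar> \<le> (\<Sum>A\<in>D. e * w A)"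
        unfolding avg g_def sum_subtractf[symmetric] by (rule order_trans[OF sum_abs sum_mono])
      also have "\<dots> = e" using wsum by (simp flip: sum_distrib_left)
      also have "\<dots> \<le> e * u x" using u(2)[OF True] e by simp
      finally show ?thesis .
    next
      case False
      then have xM: "x \<notin> C <#> M" using C'(2) by blast
      have "rt (l A) f x = 0" if A: "A \<in> D" for A
      proof (rule ccontr)
        assume "rt (l A) f x \<noteq> 0"
        then have x: "x \<in> carrier G" "f (x \<otimes> l A) \<noteq> 0" unfolding rt_def by (auto split: if_splits)
        interpret M: subgroup M G by (rule normal_imp_subgroup[OF nM])
        obtain c n where cn: "c \<in> C" "n \<in> N" "x \<otimes> l A = c \<otimes> n"
          using x(2) C(2) set_mult_iff by blast
        have cc: "c \<in> carrier G" "n \<in> M" using cn NM compact_carrier[OF C(1)] by auto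
        have "x = c \<otimes> (n \<otimes> inv (l A))"
          using cn(3) l[OF A] x(1) cc by (metis M.mem_carrier inv_closed inv_solve_right m_assoc m_closed)
        then show False using xM cn(1) cc(2) l[OF A] unfolding set_mult_iff by blast
      qed
      then have "g x = 0" unfolding g_def by simp
      then show ?thesis using avg_support[OF f C xM] CN_nonneg[OF u(1)] e by simp
    qed
    then have "\<bar>I (avg f) - I g\<bar> \<le> e * I u"
      by (intro pos_functional_approx[OF fun_cone_CN P avgN g u(1)]) (use e in auto)
    then show ?thesis using Ig by simp
  qed
  have u0: "0 \<le> I u" by (rule pos_functional_nonneg[OF P u(1)])
  have "\<bar>I (avg f) - I f\<bar> \<le> 0"
  proof (rule field_le_epsilon)
    fix r :: real assume r: "r > 0"
    then have "\<bar>I (avg f) - I f\<bar> \<le> r / (I u + 1) * I u" by (intro est) (use u0 in simp)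
    also have "\<dots> \<le> r" using r u0 by (simp add: field_simps)
    finally show "\<bar>I (avg f) - I f\<bar> \<le> 0 + r" by simp
  qed
  then show ?thesis by simp
qed

text \<open>A Haar functional on the larger cone is determined by its restriction to
  \<open>CN M\<close>, because it does not distinguish a function from its average.\<close>

lemma unique_haar_step:
  assumes "unique_haar (CN M)"
  shows "unique_haar (CN N)"
  unfolding unique_haar_def
proof (intro allI impI ballI)
  fix I J f g assume I: "haar (CN N) I" "haar (CN N) J" and f: "f \<in> CN N" "g \<in> CN N"
  have "haar (CN M) I" "haar (CN M) J"
    using haar_restrict[OF _ nN M CN_step] I by auto
  then have "I (avg f) * J (avg g) = I (avg g) * J (avg f)"
    using assms avg_CN f unfolding unique_haar_def by blast
  then show "I f * J g = I g * J f"
    unfolding haar_avg[OF I(1) f(1)] haar_avg[OF I(1) f(2)] haar_avg[OF I(2) f(1)] haar_avg[OF I(2) f(2)] .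
qed

end

section \<open>Intersections of chains of normal subgroups\<close>

text \<open>In a finite subfamily of a decreasing chain the member of largest index is contained in
  all others, so the finite intersection property is automatic.\<close>

lemma compactin_chain:
  fixes E :: "'i::linorder set"
  assumes K: "compactin X K" and cl: "\<And>i. i \<in> E \<Longrightarrow> closedin X (T i)" and E: "E \<noteq> {}"
    and mono: "\<And>i j. i \<in> E \<Longrightarrow> j \<in> E \<Longrightarrow> i \<le> j \<Longrightarrow> T j \<subseteq> T i" and ne: "\<And>i. i \<in> E \<Longrightarrow> K \<inter> T i \<noteq> {}"
  shows "K \<inter> (\<Inter>i\<in>E. T i) \<noteq> {}"
proof -
  have fip: "K \<inter> \<Inter>\<F> \<noteq> {}" if F: "finite \<F>" "\<F> \<subseteq> T ` E" for \<F>
  proof -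
    obtain D where D: "D \<subseteq> E" "finite D" "\<F> = T ` D" using finite_subset_image[OF F] by blast
    show ?thesis
    proof (cases "D = {}")
      case True
      then show ?thesis using ne E D(3) by auto
    next
      case False
      then have m: "Max D \<in> D" using D(2) by simp
      have "T (Max D) \<subseteq> T i" if "i \<in> D" for i
        using mono[of i "Max D"] D(1,2) m that by auto
      then have "T (Max D) \<subseteq> \<Inter>\<F>" unfolding D(3) by blast
      then show ?thesis using ne[of "Max D"] m D(1) by blast
    qed
  qed
  have clo: "\<forall>C\<in>T ` E. closedin X C" using cl by blast
  have "(\<forall>C\<in>T ` E. closedin X C) \<and> (\<forall>\<F>. finite \<F> \<and> \<F> \<subseteq> T ` E \<longrightarrow> K \<inter> \<Inter>\<F> \<noteq> {})"
    using clo fip by blast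
  then show ?thesis
    using K[unfolded compactin_fip] by blast
qed

context rt_group
begin

text \<open>The extension is the infimum of \<Phi> over majorants from the dense cone. All required
  identities hold up to an error of the form e times a constant, by approximating from the dense
  cone. The function \<open>u\<close> in \<open>dense\<close> depends on \<open>f\<close> only, so
  the constants stay fixed as e tends to 0.\<close>

lemma haar_extend:
  assumes A: "fun_cone A" and B: "fun_cone B" and AB: "A \<subseteq> B"
    and rtA: "\<And>f s. f \<in> A \<Longrightarrow> s \<in> carrier G \<Longrightarrow> rt s f \<in> A"
    and rtB: "\<And>f s. f \<in> B \<Longrightarrow> s \<in> carrier G \<Longrightarrow> rt s f \<in> B"
    and dense: "\<And>f. f \<in> B \<Longrightarrow> \<exists>u\<in>A. \<forall>e>0. \<exists>h\<in>A. \<forall>x. \<bar>h x - f x\<bar> \<le> e * u x"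
    and \<Phi>: "haar A \<Phi>"
  shows "\<exists>I. haar B I"
proof -
  note P = haar_pos_functional[OF \<Phi>]
  define I where "I f = Inf (\<Phi> ` {h \<in> A. \<forall>x. f x \<le> h x})" for f
  have bdd: "bdd_below (\<Phi> ` {h \<in> A. \<forall>x. f x \<le> h x})" for f
    by (rule bdd_belowI2[of _ 0]) (auto intro: pos_functional_nonneg[OF P])
  \<comment> \<open>Adding \<open>e * v\<close> to the approximant gives a majorant of
    \<open>f\<close>, which bounds the infimum above; comparing every majorant with the approximant
    bounds it below.\<close>
  have K: "\<bar>I f - \<Phi> h\<bar> \<le> e * \<Phi> v" if h: "h \<in> A" and v: "v \<in> A" and e: "0 \<le> e"
    and le: "\<And>x. \<bar>h x - f x\<bar> \<le> e * v x" for f h v e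
  proof -
    have ev: "(\<lambda>x. e * v x) \<in> A" by (rule fun_cone_scale[OF A v e])
    have hev: "(\<lambda>x. h x + e * v x) \<in> A" by (rule fun_cone_add[OF A h ev])
    have \<Phi>ev: "\<Phi> (\<lambda>x. k x + e * v x) = \<Phi> k + e * \<Phi> v" if "k \<in> A" for k
      using pos_functional_add[OF P that ev] pos_functional_scale[OF P v e] by simp
    have m: "(\<lambda>x. h x + e * v x) \<in> {h \<in> A. \<forall>x. f x \<le> h x}"
      using hev le by (auto simp: abs_le_iff algebra_simps)
    have "I f \<le> \<Phi> h + e * \<Phi> v"
      unfolding I_def \<Phi>ev[OF h, symmetric] by (rule cINF_lower[OF bdd m])
    moreover have "\<Phi> h - e * \<Phi> v \<le> I f"
      unfolding I_def
    proof (rule cINF_greatest)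
      show "{h \<in> A. \<forall>x. f x \<le> h x} \<noteq> {}" using m by blast
      fix k assume k: "k \<in> {h \<in> A. \<forall>x. f x \<le> h x}"
      then have kA: "k \<in> A" by blast
      have "\<Phi> h \<le> \<Phi> (\<lambda>x. k x + e * v x)"
      proof (rule pos_functional_mono[OF A P h fun_cone_add[OF A kA ev]])
        fix x
        have "f x \<le> k x" using k by blast
        then show "h x \<le> k x + e * v x" using le[of x] by linarith
      qed
      then show "\<Phi> h - e * \<Phi> v \<le> \<Phi> k" using \<Phi>ev[OF kA] by simp
    qed
    ultimately show ?thesis by simp
  qed
  have I_nonneg: "0 \<le> I f" if f: "f \<in> B" for f
  proof -
    obtain u h where uh: "u \<in> A" "h \<in> A" "\<And>x. \<bar>h x - f x\<bar> \<le> 1 * u x" using dense[OF f] zero_less_one by blast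
    have "f x \<le> h x + u x" for x using uh(3)[of x] by simp
    then have "(\<lambda>x. h x + u x) \<in> {h \<in> A. \<forall>x. f x \<le> h x}" using fun_cone_add[OF A uh(2,1)] by simp
    then show ?thesis
      unfolding I_def by (intro cINF_greatest) (auto intro: pos_functional_nonneg[OF P])
  qed
  have zero: "a = b" if "\<And>e. e > 0 \<Longrightarrow> \<bar>a - b\<bar> \<le> e * k" "0 \<le> k" for a b k :: real
  proof -
    have "\<bar>a - b\<bar> \<le> 0 + r" if r: "r > 0" for r
    proof -
      have "\<bar>a - b\<bar> \<le> r / (k + 1) * k" using that(1) r \<open>0 \<le> k\<close> by (intro \<open>\<And>e. e > 0 \<Longrightarrow> \<bar>a - b\<bar> \<le> e * k\<close>) simp
      also have "\<dots> \<le> r" using r \<open>0 \<le> k\<close> by (simp add: field_simps)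
      finally show ?thesis by simp
    qed
    then have "\<bar>a - b\<bar> \<le> 0" by (rule field_le_epsilon)
    then show ?thesis by simp
  qed
  have "haar B I"
    unfolding haar_def pos_functional_def
  proof (intro conjI ballI allI impI)
    fix f assume f: "f \<in> B"
    show "0 \<le> I f" by (rule I_nonneg[OF f])
    obtain u where u: "u \<in> A" "\<And>e. e > 0 \<Longrightarrow> \<exists>h\<in>A. \<forall>x. \<bar>h x - f x\<bar> \<le> e * u x"
      using dense[OF f] by blast
    have u0: "0 \<le> \<Phi> u" by (rule pos_functional_nonneg[OF P u(1)])
    show "I (\<lambda>x. c * f x) = c * I f" if c: "0 \<le> c" for c
    proof (rule zero)
      show "0 \<le> 2 * c * \<Phi> u" using c u0 by simp
      fix e :: real assume e: "e > 0"
      obtain h where h: "h \<in> A" "\<And>x. \<bar>h x - f x\<bar> \<le> e * u x" using u(2)[OF e] by blast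
      have 1: "\<bar>I f - \<Phi> h\<bar> \<le> e * \<Phi> u" by (rule K[OF h(1) u(1) _ h(2)]) (use e in simp)
      have "\<bar>c * h x - c * f x\<bar> \<le> e * (c * u x)" for x
        using mult_left_mono[OF h(2)[of x] c] c
        unfolding right_diff_distrib[symmetric] abs_mult by (simp add: algebra_simps)
      then have "\<bar>I (\<lambda>x. c * f x) - \<Phi> (\<lambda>x. c * h x)\<bar> \<le> e * \<Phi> (\<lambda>x. c * u x)"
        by (intro K fun_cone_scale[OF A] h u c) (use e in simp)
      then have 2: "\<bar>I (\<lambda>x. c * f x) - c * \<Phi> h\<bar> \<le> e * (c * \<Phi> u)"
        using pos_functional_scale[OF P h(1) c] pos_functional_scale[OF P u(1) c] by simp
      have "\<bar>c * I f - c * \<Phi> h\<bar> \<le> c * (e * \<Phi> u)"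
        using mult_left_mono[OF 1 c] c unfolding right_diff_distrib[symmetric] abs_mult by simp
      then show "\<bar>I (\<lambda>x. c * f x) - c * I f\<bar> \<le> e * (2 * c * \<Phi> u)" using 2 by (simp add: algebra_simps)
    qed
    show "I (rt s f) = I f" if s: "s \<in> carrier G" for s
    proof (rule zero)
      show "0 \<le> 2 * \<Phi> u" using u0 by simp
      fix e :: real assume e: "e > 0"
      obtain h where h: "h \<in> A" "\<And>x. \<bar>h x - f x\<bar> \<le> e * u x" using u(2)[OF e] by blast
      have 1: "\<bar>I f - \<Phi> h\<bar> \<le> e * \<Phi> u" by (rule K[OF h(1) u(1) _ h(2)]) (use e in simp)
      have "\<bar>I (rt s f) - \<Phi> (rt s h)\<bar> \<le> e * \<Phi> (rt s u)"
        by (rule K[OF rtA[OF h(1) s] rtA[OF u(1) s]]) (use e h(2) in \<open>auto simp: rt_def\<close>)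
      then show "\<bar>I (rt s f) - I f\<bar> \<le> e * (2 * \<Phi> u)"
        using 1 haar_rt[OF \<Phi> h(1) s] haar_rt[OF \<Phi> u(1) s] by simp
    qed
    fix g assume g: "g \<in> B"
    obtain v where v: "v \<in> A" "\<And>e. e > 0 \<Longrightarrow> \<exists>h\<in>A. \<forall>x. \<bar>h x - g x\<bar> \<le> e * v x"
      using dense[OF g] by blast
    have v0: "0 \<le> \<Phi> v" by (rule pos_functional_nonneg[OF P v(1)])
    show "I (\<lambda>x. f x + g x) = I f + I g"
    proof (rule zero)
      show "0 \<le> 2 * (\<Phi> u + \<Phi> v)" using u0 v0 by simp
      fix e :: real assume e: "e > 0"
      obtain h where h: "h \<in> A" "\<And>x. \<bar>h x - f x\<bar> \<le> e * u x" using u(2)[OF e] by blast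
      obtain k where k: "k \<in> A" "\<And>x. \<bar>k x - g x\<bar> \<le> e * v x" using v(2)[OF e] by blast
      have 1: "\<bar>I f - \<Phi> h\<bar> \<le> e * \<Phi> u" by (rule K[OF h(1) u(1) _ h(2)]) (use e in simp)
      have 2: "\<bar>I g - \<Phi> k\<bar> \<le> e * \<Phi> v" by (rule K[OF k(1) v(1) _ k(2)]) (use e in simp)
      have "\<bar>h x + k x - (f x + g x)\<bar> \<le> e * (u x + v x)" for x
        using h(2)[of x] k(2)[of x] unfolding distrib_left by linarith
      then have "\<bar>I (\<lambda>x. f x + g x) - \<Phi> (\<lambda>x. h x + k x)\<bar> \<le> e * \<Phi> (\<lambda>x. u x + v x)"
        by (intro K fun_cone_add[OF A] h k u v) (use e in simp)
      then have "\<bar>I (\<lambda>x. f x + g x) - (\<Phi> h + \<Phi> k)\<bar> \<le> e * \<Phi> u + e * \<Phi> v"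
        using pos_functional_add[OF P h(1) k(1)] pos_functional_add[OF P u(1) v(1)] by (simp add: distrib_left)
      moreover have "e * (2 * (\<Phi> u + \<Phi> v)) = 2 * (e * \<Phi> u) + 2 * (e * \<Phi> v)" by (simp add: algebra_simps)
      ultimately show "\<bar>I (\<lambda>x. f x + g x) - (I f + I g)\<bar> \<le> e * (2 * (\<Phi> u + \<Phi> v))"
        using 1 2 by linarith
    qed
  next
    obtain f where f: "f \<in> A" "\<Phi> f \<noteq> 0" using \<Phi> unfolding haar_def by blast
    have "\<bar>I f - \<Phi> f\<bar> \<le> 0 * \<Phi> f" by (rule K[OF f(1) f(1)]) auto
    then show "\<exists>f\<in>B. I f \<noteq> 0" using f AB by (intro bexI[of _ f]) auto
  qed
  then show ?thesis by blast
qed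

lemma proper_over_trans:
  assumes "proper_over L M" "proper_over M N"
  shows "proper_over L N"
  using assms unfolding proper_over_def by (meson order_trans)

lemma proper_over_mono:
  assumes "proper_over L N" "M \<subseteq> L"
  shows "proper_over M N"
  unfolding proper_over_def
proof (intro allI impI)
  fix C assume "compactin X C"
  then obtain C' where "compactin X C'" "C <#> L \<subseteq> C' <#> N" using assms(1) unfolding proper_over_def by blast
  moreover have "C <#> M \<subseteq> C <#> L" by (rule mono_set_mult[OF order_refl assms(2)])
  ultimately show "\<exists>C'. compactin X C' \<and> C <#> M \<subseteq> C' <#> N" by blast
qed

end

text \<open>The situation below a limit ordinal, with the inductive results for all earlier members.
  The least index \<open>e0\<close> will be the ordinal 1, and properness is always measured from
  there.\<close>

locale normal_chain = rt_group +
  fixes E :: "'i::linorder set" and L :: "'i \<Rightarrow> 'a set" and N :: "'a set" and e0 :: 'i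
  assumes e0: "e0 \<in> E" and e0_le: "\<And>i. i \<in> E \<Longrightarrow> e0 \<le> i"
    and admL: "\<And>i. i \<in> E \<Longrightarrow> adm (L i)" and compactL: "\<And>i. i \<in> E \<Longrightarrow> compactin X (L i)"
    and antiL: "\<And>i j. i \<in> E \<Longrightarrow> j \<in> E \<Longrightarrow> i \<le> j \<Longrightarrow> L j \<subseteq> L i"
    and N_eq: "N = (\<Inter>i\<in>E. L i)" and admN: "adm N"
    and properL: "\<And>i. i \<in> E \<Longrightarrow> proper_over (L e0) (L i)"
    and existsL: "\<And>i. i \<in> E \<Longrightarrow> \<exists>I. haar (CN (L i)) I"
    and uniqueL: "\<And>i. i \<in> E \<Longrightarrow> unique_haar (CN (L i))"
begin

lemma nL: "i \<in> E \<Longrightarrow> L i \<lhd> G"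
  by (rule adm_normal[OF admL])

lemmas nN = adm_normal[OF admN]

lemma N_sub: "i \<in> E \<Longrightarrow> N \<subseteq> L i"
  unfolding N_eq by blast

lemma CN_chain: "i \<in> E \<Longrightarrow> j \<in> E \<Longrightarrow> i \<le> j \<Longrightarrow> CN (L i) \<subseteq> CN (L j)"
  by (rule CN_mono[OF proper_over_mono[OF properL antiL] antiL]) (auto simp: e0 e0_le)

text \<open>Otherwise compactness of the cosets along the chain produces a point y in all cosets x
  L_i with |f y - f x| at least e. Then y lies in x N, on which \<open>f\<close> is
  constant.\<close>

lemma osc:
  assumes f: "f \<in> CN N" and x: "x \<in> carrier G" and e: "e > 0"
  shows "\<exists>i\<in>E. \<forall>l\<in>L i. \<bar>f (x \<otimes> l) - f x\<bar> < e"
proof (rule ccontr)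
  assume neg: "\<not> ?thesis"
  define T where "T i = (L i #> x) \<inter> {y \<in> topspace X. \<bar>f y - f x\<bar> \<in> {e..}}" for i
  \<comment> \<open>Normality is used to write the coset as a right translate of \<open>L i\<close>:
    only right translations are continuous, so only in this form is it visibly compact.\<close>
  have cos: "x <# L i = L i #> x" if "i \<in> E" for i
    using normal.coset_eq[OF nL[OF that]] x by simp
  have cpt: "compactin X (L i #> x)" if "i \<in> E" for i
    by (rule compactin_rcos[OF compactL[OF that] x])
  have c: "continuous_map X euclideanreal (\<lambda>y. \<bar>f y - f x\<bar>)"
    by (intro continuous_map_real_abs continuous_map_diff CN_cont[OF f] continuous_map_const[THEN iffD2]) simp
  have "closedin X {y \<in> topspace X. \<bar>f y - f x\<bar> \<in> {e..}}"
    by (rule closedin_continuous_map_preimage[OF c]) auto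
  then have clT: "closedin X (T i)" if "i \<in> E" for i
    unfolding T_def using compactin_imp_closedin[OF haus cpt[OF that]] by blast
  have neT: "(L e0 #> x) \<inter> T i \<noteq> {}" if i: "i \<in> E" for i
  proof -
    obtain l where l: "l \<in> L i" "\<bar>f (x \<otimes> l) - f x\<bar> \<ge> e" using neg i by (force simp: not_less)
    have "x \<otimes> l \<in> L i #> x" using l(1) cos[OF i] unfolding lcos_image by blast
    moreover have "L i #> x \<subseteq> L e0 #> x" using antiL[OF e0 i e0_le[OF i]] unfolding rcos_image by blast
    moreover have "x \<otimes> l \<in> carrier G" using x l(1) normal_carrier[OF nL[OF i]] by blast
    ultimately show ?thesis using l(2) unfolding T_def by auto
  qed
  have "(L e0 #> x) \<inter> (\<Inter>i\<in>E. T i) \<noteq> {}"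
  proof (rule compactin_chain[OF cpt[OF e0] clT _ _ neT])
    show "E \<noteq> {}" using e0 by blast
    show "T j \<subseteq> T i" if "i \<in> E" "j \<in> E" "i \<le> j" for i j
      using antiL[OF that] unfolding T_def rcos_image by blast
  qed
  then obtain y where y: "y \<in> (\<Inter>i\<in>E. T i)" by blast
  then have "y \<in> T e0" using e0 by blast
  then have yc: "y \<in> carrier G" and ye: "e \<le> \<bar>f y - f x\<bar>" unfolding T_def by auto
  have "inv x \<otimes> y \<in> L i" if i: "i \<in> E" for i
  proof -
    have "y \<in> x <# L i" using y i cos[OF i] unfolding T_def by blast
    then obtain l where l: "l \<in> L i" "y = x \<otimes> l" unfolding lcos_image by blast
    then show ?thesis using x normal_carrier[OF nL[OF i]] by (simp add: subset_iff flip: m_assoc)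
  qed
  then have "inv x \<otimes> y \<in> N" unfolding N_eq by blast
  then have "f (x \<otimes> (inv x \<otimes> y)) = f x" by (rule CN_inv[OF f x])
  then have "f y = f x" using x yc by (simp flip: m_assoc)
  then show False using ye e by simp
qed

lemma sup_CN: "f \<in> CN N \<Longrightarrow> i \<in> E \<Longrightarrow> coset_sup (L i) f \<in> CN (L i)"
  by (rule coset_sup_CN[OF admL nN N_sub])

lemma sup_upper: "f \<in> CN N \<Longrightarrow> i \<in> E \<Longrightarrow> f x \<le> coset_sup (L i) f x"
  by (rule coset_sup_upper[OF _ nN nL])

lemma sup_anti:
  assumes f: "f \<in> CN N" and ij: "i \<in> E" "j \<in> E" "i \<le> j"
  shows "coset_sup (L j) f x \<le> coset_sup (L i) f x"
proof (cases "x \<in> carrier G")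
  case True
  show ?thesis
    by (rule coset_sup_le[OF nL[OF ij(2)] True], rule coset_sup_ge[OF f nN True]) (use antiL[OF ij] in blast)
qed (simp add: coset_sup_def)

lemma sup_tends:
  assumes f: "f \<in> CN N" and x: "x \<in> carrier G" and e: "e > 0"
  shows "\<exists>i\<in>E. coset_sup (L i) f x \<le> f x + e"
proof -
  obtain i where i: "i \<in> E" "\<forall>l\<in>L i. \<bar>f (x \<otimes> l) - f x\<bar> < e" using osc[OF assms] by blast
  have "coset_sup (L i) f x \<le> f x + e"
    by (rule coset_sup_le[OF nL[OF i(1)] x]) (use i(2) in fastforce)
  then show ?thesis using i(1) by blast
qed

text \<open>Dini's argument: the continuous functions \<open>coset_sup (L i) f\<close> decrease
  pointwise to \<open>f\<close>, hence uniformly on a compact set. Invariance under \<open>N\<close>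
  extends this to its cosets, and properness gives a common support.\<close>

lemma uniform_tends:
  assumes p: "proper_over (L e0) N" and f: "f \<in> CN N"
  obtains u where "u \<in> CN (L e0)"
    "\<And>e. e > 0 \<Longrightarrow> \<exists>i\<in>E. \<forall>x. \<bar>coset_sup (L i) f x - f x\<bar> \<le> e * u x"
proof -
  obtain C where C: "compactin X C" "\<And>x. x \<notin> C <#> N \<Longrightarrow> f x = 0"
    using CN_support[OF f] by metis
  \<comment> \<open>All the suprema and \<open>f\<close> vanish off \<open>C <#> L e0\<close>.
    Properness places that set inside \<open>C' <#> N\<close>, so the estimate is needed only on
    \<open>C'\<close>.\<close>
  obtain C' where C': "compactin X C'" "C <#> L e0 \<subseteq> C' <#> N"
    using p C(1) unfolding proper_over_def by blast
  obtain u where u: "u \<in> CN (L e0)" "\<And>x. x \<in> C' <#> L e0 \<Longrightarrow> 1 \<le> u x"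
    using CN_unit[OF admL[OF e0] C'(1)] by blast
  have main: "\<exists>i\<in>E. \<forall>x. \<bar>coset_sup (L i) f x - f x\<bar> \<le> e * u x" if e: "e > 0" for e
  proof -
    define T where "T i = {x \<in> topspace X. coset_sup (L i) f x - f x \<in> {e..}}" for i
    have clT: "closedin X (T i)" if i: "i \<in> E" for i
      unfolding T_def
      by (rule closedin_continuous_map_preimage[OF continuous_map_diff[OF CN_cont[OF sup_CN[OF f i]] CN_cont[OF f]]]) auto
    have anti: "T j \<subseteq> T i" if "i \<in> E" "j \<in> E" "i \<le> j" for i j
      using sup_anti[OF f that] unfolding T_def by (force intro: order_trans)
    have "\<exists>i\<in>E. C' \<inter> T i = {}"
    proof (rule ccontr)
      assume "\<not> ?thesis"
      then have "C' \<inter> (\<Inter>i\<in>E. T i) \<noteq> {}"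
        using e0 by (intro compactin_chain[OF C'(1) clT _ anti]) auto
      then obtain x where x: "x \<in> C'" "\<And>i. i \<in> E \<Longrightarrow> x \<in> T i" by blast
      have "e / 2 > 0" using e by simp
      then obtain i where i: "i \<in> E" "coset_sup (L i) f x \<le> f x + e / 2"
        using sup_tends[OF f, of x "e / 2"] x(1) compact_carrier[OF C'(1)] by blast
      then show False using x(2)[OF i(1)] e unfolding T_def by simp
    qed
    then obtain i where i: "i \<in> E" "C' \<inter> T i = {}" by blast
    have "\<bar>coset_sup (L i) f x - f x\<bar> \<le> e * u x" for x
    proof (cases "x \<in> C' <#> N")
      case True
      then obtain c n where cn: "c \<in> C'" "n \<in> N" "x = c \<otimes> n" unfolding set_mult_iff by blast
      have cc: "c \<in> carrier G" using cn compact_carrier[OF C'(1)] by blast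
      have "coset_sup (L i) f x = coset_sup (L i) f c"
        using CN_inv[OF sup_CN[OF f i(1)] cc, of n] cn N_sub[OF i(1)] by blast
      moreover have "f x = f c" using CN_inv[OF f cc cn(2)] cn by simp
      moreover have "coset_sup (L i) f c - f c < e" using i(2) cn(1) cc unfolding T_def by force
      ultimately have "\<bar>coset_sup (L i) f x - f x\<bar> \<le> e" using sup_upper[OF f i(1), of x] by simp
      moreover have "x \<in> C' <#> L e0" using cn N_sub[OF e0] unfolding set_mult_iff by blast
      then have "1 \<le> u x" by (rule u(2))
      ultimately show ?thesis using e by (smt (verit) mult_le_cancel_left1)
    next
      case False
      then have x: "x \<notin> C <#> L e0" using C'(2) by blast
      then have "x \<notin> C <#> L i" using antiL[OF e0 i(1) e0_le[OF i(1)]] unfolding set_mult_iff by blast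
      then have "coset_sup (L i) f x = 0"
        using coset_sup_support[OF nL[OF i(1)] N_sub[OF i(1)] C(1), of f x] C(2) by blast
      moreover have "x \<notin> C <#> N" using x N_sub[OF e0] unfolding set_mult_iff by blast
      ultimately show ?thesis using C(2) e CN_nonneg[OF u(1)] by simp
    qed
    then show ?thesis using i(1) by blast
  qed
  show ?thesis by (rule that[OF u(1) main])
qed

text \<open>One reference function, lying in all the cones of the chain, normalises all functionals
  simultaneously.\<close>

definition ref :: "'a \<Rightarrow> real" where
  "ref = (SOME f. f \<in> CN (L e0) \<and> 1 \<le> f \<one>)"

lemma ref: "ref \<in> CN (L e0)" "1 \<le> ref \<one>"
proof -
  have "\<exists>f. f \<in> CN (L e0) \<and> 1 \<le> f \<one>" using CN_nonzero[OF admL[OF e0]] by blast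
  from someI_ex[OF this] show "ref \<in> CN (L e0)" "1 \<le> ref \<one>" unfolding ref_def by blast+
qed

lemma ref_in: "i \<in> E \<Longrightarrow> ref \<in> CN (L i)"
  using CN_chain[OF e0 _ e0_le] ref(1) by blast

definition II :: "'i \<Rightarrow> ('a \<Rightarrow> real) \<Rightarrow> real" where
  "II i = (SOME I. haar (CN (L i)) I \<and> I ref = 1)"

lemma II: assumes i: "i \<in> E" shows "haar (CN (L i)) (II i)" "II i ref = 1"
proof -
  obtain I where I: "haar (CN (L i)) I" using existsL[OF i] by blast
  have p: "I ref > 0" by (rule haar_strictly_pos[OF nL[OF i] I ref_in[OF i], of \<one>]) (use ref(2) in simp)
  define I' where "I' f = inverse (I ref) * I f" for f
  have "haar (CN (L i)) I'"
    using I p unfolding I'_def haar_def pos_functional_def by (auto simp: distrib_left)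
  moreover have "I' ref = 1" using p unfolding I'_def by simp
  ultimately have "\<exists>I. haar (CN (L i)) I \<and> I ref = 1" by blast
  from someI_ex[OF this] show "haar (CN (L i)) (II i)" "II i ref = 1" unfolding II_def by blast+
qed

text \<open>The restriction of \<open>II j\<close> to the smaller cone is again a Haar functional;
  uniqueness there and the common value 1 at \<open>ref\<close> identify it with
  \<open>II i\<close>.\<close>

lemma II_consistent_le:
  assumes ij: "i \<in> E" "j \<in> E" "i \<le> j" and f: "f \<in> CN (L i)"
  shows "II j f = II i f"
proof -
  have "haar (CN (L i)) (II j)"
    by (rule haar_restrict[OF II(1)[OF ij(2)] nL[OF ij(2)] admL[OF ij(1)] CN_chain[OF ij]])
  then have "II i f * II j ref = II i ref * II j f"
    using uniqueL[OF ij(1)] II(1)[OF ij(1)] f ref_in[OF ij(1)] unfolding unique_haar_def by blast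
  then show ?thesis using II(2) ij by simp
qed

lemma II_consistent:
  assumes "i \<in> E" "j \<in> E" "f \<in> CN (L i)" "f \<in> CN (L j)"
  shows "II j f = II i f"
  using II_consistent_le[of i j f] II_consistent_le[of j i f] assms by (cases "i \<le> j") auto

text \<open>Along the chain the integrals of the functions \<open>coset_sup (L i) f\<close> decrease. If their
  infimum is attained, then \<open>f\<close> is invariant under some \<open>L i\<close>; otherwise a countable subchain is
  cofinal and the Baire category theorem applies. In both cases some \<open>V <#> L i\<close> with \<open>V\<close> open
  is relatively compact modulo \<open>N\<close>.\<close>

lemma proper_limit: "proper_over (L e0) N"
proof -
  obtain f where f: "f \<in> CN N" "1 \<le> f \<one>" using CN_nonzero[OF admN] by blast
  obtain C where C: "compactin X C" "\<And>x. x \<notin> C <#> N \<Longrightarrow> f x = 0"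
    using CN_support[OF f(1)] by metis
  define a where "a i = II i (coset_sup (L i) f)" for i
  have a0: "0 \<le> a i" if "i \<in> E" for i
    unfolding a_def
    by (rule pos_functional_nonneg[OF haar_pos_functional[OF II(1)[OF that]] sup_CN[OF f(1) that]])
  have a_anti: "a j \<le> a i" if ij: "i \<in> E" "j \<in> E" "i \<le> j" for i j
  proof -
    have s: "coset_sup (L i) f \<in> CN (L j)" using sup_CN[OF f(1) ij(1)] CN_chain[OF ij] by blast
    have "II j (coset_sup (L j) f) \<le> II j (coset_sup (L i) f)"
      by (rule pos_functional_mono[OF fun_cone_CN haar_pos_functional[OF II(1)[OF ij(2)]]
            sup_CN[OF f(1) ij(2)] s sup_anti[OF f(1) ij]])
    then show ?thesis
      unfolding a_def using II_consistent_le[OF ij sup_CN[OF f(1) ij(1)]] by simp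
  qed
  define c where "c = Inf (a ` E)"
  have bdd: "bdd_below (a ` E)" by (rule bdd_belowI2[of _ 0]) (rule a0)
  have c_le: "c \<le> a i" if "i \<in> E" for i unfolding c_def by (rule cINF_lower[OF bdd that])
  have "\<exists>i\<in>E. a i < c + 1 / Suc n" for n
    using cInf_lessD[of "a ` E" "c + 1 / Suc n"] e0 unfolding c_def by auto
  \<comment> \<open>A minimising sequence of indices for the integrals. If it is bounded by some
    \<open>k\<close> in \<open>E\<close>, the infimum is attained at \<open>k\<close>; otherwise it
    is cofinal, since \<open>E\<close> is linearly ordered.\<close>
  then obtain s where s: "\<And>n. s n \<in> E" "\<And>n. a (s n) < c + 1 / Suc n" by metis
  have "\<exists>V i. openin X V \<and> V \<noteq> {} \<and> i \<in> E \<and> V <#> L i \<subseteq> C <#> N"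
  proof (cases "\<exists>k\<in>E. \<forall>n. s n \<le> k")
    case True
    then obtain k where k: "k \<in> E" "\<And>n. s n \<le> k" by blast
    have ak: "a k \<le> c"
    proof (rule field_le_epsilon)
      fix r :: real assume "r > 0"
      then obtain n where "1 / Suc n < r" using nat_approx_posE by blast
      then show "a k \<le> c + r" using s(2)[of n] a_anti[OF s(1) k(1) k(2), of n] by linarith
    qed
    \<comment> \<open>A difference of the two suprema would be a nonnegative function with positive
      integral by strict positivity, although \<open>a k\<close> is already the infimum.\<close>
    have eq: "coset_sup (L k) f x = coset_sup (L j) f x" if j: "j \<in> E" "k \<le> j" for j x
    proof (rule ccontr)
      assume ne: "coset_sup (L k) f x \<noteq> coset_sup (L j) f x"
      have sk: "coset_sup (L k) f \<in> CN (L j)" using sup_CN[OF f(1) k(1)] CN_chain[OF k(1) j] by blast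
      have sj: "coset_sup (L j) f \<in> CN (L j)" by (rule sup_CN[OF f(1) j(1)])
      define d where "d = (\<lambda>x. coset_sup (L k) f x - coset_sup (L j) f x)"
      have d: "d \<in> CN (L j)"
        unfolding d_def by (rule fun_cone_diff[OF fun_cone_CN sk sj sup_anti[OF f(1) k(1) j]])
      have "d x > 0" using ne sup_anti[OF f(1) k(1) j, of x] unfolding d_def by simp
      then have "II j d > 0" by (rule haar_strictly_pos[OF nL[OF j(1)] II(1)[OF j(1)] d])
      moreover have "II j (\<lambda>x. coset_sup (L j) f x + d x) = a j + II j d"
        unfolding a_def by (rule pos_functional_add[OF haar_pos_functional[OF II(1)[OF j(1)]] sj d])
      moreover have "(\<lambda>x. coset_sup (L j) f x + d x) = coset_sup (L k) f" unfolding d_def by auto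
      moreover have "II j (coset_sup (L k) f) = a k"
        unfolding a_def by (rule II_consistent_le[OF k(1) j sup_CN[OF f(1) k(1)]])
      ultimately show False using ak c_le[OF j(1)] by simp
    qed
    \<comment> \<open>The suprema are constant along the chain from \<open>k\<close> on and tend to
      \<open>f\<close>, so \<open>f\<close> itself is invariant under \<open>L k\<close>.\<close>
    have fk: "coset_sup (L k) f x = f x" if x: "x \<in> carrier G" for x
    proof (rule antisym[OF _ sup_upper[OF f(1) k(1)]])
      show "coset_sup (L k) f x \<le> f x"
      proof (rule field_le_epsilon)
        fix r :: real assume r: "r > 0"
        obtain i where i: "i \<in> E" "coset_sup (L i) f x \<le> f x + r" using sup_tends[OF f(1) x r] by blast
        have m: "max i k \<in> E" using i k by (auto simp: max_def)
        have "coset_sup (L k) f x = coset_sup (L (max i k)) f x" by (rule eq[OF m]) simp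
        also have "\<dots> \<le> coset_sup (L i) f x" by (rule sup_anti[OF f(1) i(1) m]) simp
        finally show "coset_sup (L k) f x \<le> f x + r" using i(2) by simp
      qed
    qed
    define V where "V = {x \<in> topspace X. f x \<in> {0<..}}"
    have "openin X V" unfolding V_def by (rule openin_continuous_map_preimage[OF CN_cont[OF f(1)]]) auto
    moreover have "\<one> \<in> V" using f(2) unfolding V_def by simp
    moreover have "V <#> L k \<subseteq> C <#> N"
    proof
      fix x assume "x \<in> V <#> L k"
      then obtain v l where vl: "v \<in> V" "l \<in> L k" "x = v \<otimes> l" unfolding set_mult_iff by blast
      have vc: "v \<in> carrier G" "l \<in> carrier G" using vl normal_carrier[OF nL[OF k(1)]] unfolding V_def by auto
      have "f x = f v"
        using CN_inv[OF sup_CN[OF f(1) k(1)] vc(1) vl(2)] fk vc vl(3) by simp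
      then have "f x \<noteq> 0" using vl(1) unfolding V_def by simp
      then show "x \<in> C <#> N" using C(2) by blast
    qed
    ultimately show ?thesis using k(1) by blast
  next
    case False
    then have cofinal: "\<exists>n. i \<le> s n" if "i \<in> E" for i using that by (meson linear)
    \<comment> \<open>\<open>B n\<close> collects the points on whose whole coset of
      \<open>L (s n)\<close> the function is at least 1/2, so these cosets stay inside the support
      of \<open>f\<close>. By \<open>osc\<close> and cofinality these closed sets cover the nonempty
      open set where f > 1/2, so one of them has interior.\<close>
    define B where "B n = {x \<in> topspace X. \<forall>l\<in>L (s n). 1 / 2 \<le> f (x \<otimes> l)}" for n
    have clB: "closedin X (B n)" for n
    proof -
      have ne: "L (s n) \<noteq> {}" using normal_one[OF nL[OF s(1)]] by blast
      have eq: "B n = (\<Inter>l\<in>L (s n). {x \<in> topspace X. rt l f x \<in> {1 / 2..}})"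
        using ne unfolding B_def rt_def by auto
      have "closedin X {x \<in> topspace X. rt l f x \<in> {1 / 2..}}" if "l \<in> L (s n)" for l
        using that normal_carrier[OF nL[OF s(1)]]
        by (intro closedin_continuous_map_preimage[OF rt_cont[OF CN_cont[OF f(1)]]]) auto
      then show ?thesis unfolding eq by (intro closedin_INT ne)
    qed
    define U where "U = {x \<in> topspace X. f x \<in> {1 / 2<..}}"
    have U: "openin X U" unfolding U_def by (rule openin_continuous_map_preimage[OF CN_cont[OF f(1)]]) auto
    have UB: "U \<subseteq> \<Union>(range B)"
    proof
      fix x assume x: "x \<in> U"
      then have xc: "x \<in> carrier G" and fx: "f x - 1 / 2 > 0" unfolding U_def by auto
      obtain i where i: "i \<in> E" "\<forall>l\<in>L i. \<bar>f (x \<otimes> l) - f x\<bar> < f x - 1 / 2"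
        using osc[OF f(1) xc fx] by blast
      obtain n where n: "i \<le> s n" using cofinal[OF i(1)] by blast
      have "1 / 2 \<le> f (x \<otimes> l)" if "l \<in> L (s n)" for l
      proof -
        have "\<bar>f (x \<otimes> l) - f x\<bar> < f x - 1 / 2" using i(2) antiL[OF i(1) s(1) n] that by blast
        then show ?thesis by linarith
      qed
      then have "x \<in> B n" using xc unfolding B_def by simp
      then show "x \<in> \<Union>(range B)" by blast
    qed
    have "\<exists>n. X interior_of (B n) \<noteq> {}"
    proof (rule ccontr)
      assume "\<not> ?thesis"
      then have "X interior_of \<Union>(range B) = {}"
        using lc haus locally_compact_Hausdorff_imp_regular_space[of X] clB
        by (intro Baire_category_alt) auto
      moreover have "U \<subseteq> X interior_of \<Union>(range B)" by (rule interior_of_maximal[OF UB U])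
      moreover have "\<one> \<in> U" using f(2) unfolding U_def by simp
      ultimately show False by blast
    qed
    then obtain n where n: "X interior_of (B n) \<noteq> {}" by blast
    have "X interior_of (B n) <#> L (s n) \<subseteq> C <#> N"
    proof
      fix x assume "x \<in> X interior_of (B n) <#> L (s n)"
      then obtain v l where vl: "v \<in> B n" "l \<in> L (s n)" "x = v \<otimes> l"
        using interior_of_subset[of X "B n"] unfolding set_mult_iff by blast
      then have "f x \<noteq> 0" unfolding B_def by force
      then show "x \<in> C <#> N" using C(2) by blast
    qed
    then show ?thesis using n s(1) openin_interior_of by blast
  qed
  then obtain V i where V: "openin X V" "V \<noteq> {}" "i \<in> E" "V <#> L i \<subseteq> C <#> N" by blast
  have "proper_over (L i) N" by (rule proper_overI[OF nL[OF V(3)] nN V(1,2) C(1) V(4)])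
  then show ?thesis by (rule proper_over_trans[OF properL[OF V(3)]])
qed

lemma CN_limit: "i \<in> E \<Longrightarrow> CN (L i) \<subseteq> CN N"
  by (rule CN_mono[OF proper_over_mono[OF proper_limit antiL[OF e0 _ e0_le]] N_sub])

text \<open>The cones \<open>CN (L i)\<close> increase along the chain, and the normalised
  functionals extend one another to their union, which is dense in \<open>CN N\<close> in the sense
  of \<open>haar_extend\<close> by \<open>uniform_tends\<close>.\<close>

lemma haar_limit_exists: "\<exists>I. haar (CN N) I"
proof -
  define A where "A = (\<Union>i\<in>E. CN (L i))"
  \<comment> \<open>The choice of the index is immaterial by \<open>II_consistent\<close>.\<close>
  define \<Phi> where "\<Phi> f = II (SOME i. i \<in> E \<and> f \<in> CN (L i)) f" for f
  have \<Phi>: "\<Phi> f = II i f" if "i \<in> E" "f \<in> CN (L i)" for i f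
  proof -
    have "\<exists>i. i \<in> E \<and> f \<in> CN (L i)" using that by blast
    from someI_ex[OF this] show ?thesis unfolding \<Phi>_def using that II_consistent by blast
  qed
  have two: "\<exists>i\<in>E. f \<in> CN (L i) \<and> g \<in> CN (L i)" if fgA: "f \<in> A" "g \<in> A" for f g
  proof -
    obtain i j where ij: "i \<in> E" "j \<in> E" "f \<in> CN (L i)" "g \<in> CN (L j)" using fgA unfolding A_def by blast
    have "i \<le> j \<or> j \<le> i" by auto
    then show ?thesis using CN_chain[of i j] CN_chain[of j i] ij by blast
  qed
  have coneA: "fun_cone A"
    unfolding fun_cone_def
  proof (intro conjI ballI allI impI)
    show "(\<lambda>x. 0) \<in> A" unfolding A_def using fun_cone_zero[OF fun_cone_CN] e0 by blast
    fix f assume f: "f \<in> A"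
    then obtain i where i: "i \<in> E" "f \<in> CN (L i)" unfolding A_def by blast
    show "0 \<le> f x" for x by (rule CN_nonneg[OF i(2)])
    show "(\<lambda>x. c * f x) \<in> A" if "0 \<le> c" for c
      unfolding A_def using fun_cone_scale[OF fun_cone_CN i(2) that] i(1) by blast
    fix g assume "g \<in> A"
    then obtain j where j: "j \<in> E" "f \<in> CN (L j)" "g \<in> CN (L j)" using two[OF f] by blast
    show "(\<lambda>x. f x + g x) \<in> A"
      unfolding A_def using fun_cone_add[OF fun_cone_CN j(2,3)] j(1) by blast
    assume "\<forall>x. g x \<le> f x"
    then have "(\<lambda>x. f x - g x) \<in> CN (L j)" by (intro fun_cone_diff[OF fun_cone_CN j(2,3)]) simp
    then show "(\<lambda>x. f x - g x) \<in> A" unfolding A_def using j(1) by blast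
  qed
  have haarA: "haar A \<Phi>"
    unfolding haar_def pos_functional_def
  proof (intro conjI ballI allI impI)
    fix f assume f: "f \<in> A"
    then obtain i where i: "i \<in> E" "f \<in> CN (L i)" unfolding A_def by blast
    note P = haar_pos_functional[OF II(1)[OF i(1)]]
    show "0 \<le> \<Phi> f" using pos_functional_nonneg[OF P i(2)] \<Phi>[OF i] by simp
    show "\<Phi> (\<lambda>x. c * f x) = c * \<Phi> f" if "0 \<le> c" for c
      using pos_functional_scale[OF P i(2) that] \<Phi>[OF i] \<Phi>[OF i(1) fun_cone_scale[OF fun_cone_CN i(2) that]] by simp
    show "\<Phi> (rt s f) = \<Phi> f" if "s \<in> carrier G" for s
      using haar_rt[OF II(1)[OF i(1)] i(2) that] \<Phi>[OF i] \<Phi>[OF i(1) rt_CN[OF i(2) nL[OF i(1)] that]] by simp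
    fix g assume "g \<in> A"
    then obtain j where j: "j \<in> E" "f \<in> CN (L j)" "g \<in> CN (L j)" using two[OF f] by blast
    show "\<Phi> (\<lambda>x. f x + g x) = \<Phi> f + \<Phi> g"
      using pos_functional_add[OF haar_pos_functional[OF II(1)[OF j(1)]] j(2,3)]
        \<Phi>[OF j(1,2)] \<Phi>[OF j(1,3)] \<Phi>[OF j(1) fun_cone_add[OF fun_cone_CN j(2,3)]] by simp
  next
    show "\<exists>f\<in>A. \<Phi> f \<noteq> 0"
      using ref(1) e0 II(2)[OF e0] \<Phi>[OF e0 ref(1)] unfolding A_def by (intro bexI[of _ ref]) auto
  qed
  show ?thesis
  proof (rule haar_extend[OF coneA fun_cone_CN _ _ rt_CN[OF _ nN] _ haarA])
    show "A \<subseteq> CN N" unfolding A_def using CN_limit by blast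
    show "rt s f \<in> A" if "f \<in> A" "s \<in> carrier G" for f s
      using that rt_CN nL unfolding A_def by blast
    fix f assume f: "f \<in> CN N"
    obtain u where u: "u \<in> CN (L e0)" "\<And>e. e > 0 \<Longrightarrow> \<exists>i\<in>E. \<forall>x. \<bar>coset_sup (L i) f x - f x\<bar> \<le> e * u x"
      using uniform_tends[OF proper_limit f] by blast
    show "\<exists>u\<in>A. \<forall>e>0. \<exists>h\<in>A. \<forall>x. \<bar>h x - f x\<bar> \<le> e * u x"
    proof (rule bexI[of _ u], intro allI impI)
      show "u \<in> A" using u(1) e0 unfolding A_def by blast
      fix e :: real assume "e > 0"
      then obtain i where i: "i \<in> E" "\<forall>x. \<bar>coset_sup (L i) f x - f x\<bar> \<le> e * u x" using u(2) by blast
      have "coset_sup (L i) f \<in> A" using sup_CN[OF f i(1)] i(1) unfolding A_def by blast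
      then show "\<exists>h\<in>A. \<forall>x. \<bar>h x - f x\<bar> \<le> e * u x" using i(2) by blast
    qed
  qed
qed

text \<open>On each \<open>CN (L i)\<close> the two functionals are proportional with the same
  factor, fixed by their values at \<open>ref\<close>; uniform density carries this relation to
  \<open>CN N\<close>.\<close>

lemma haar_limit_unique: "unique_haar (CN N)"
  unfolding unique_haar_def
proof (intro allI impI ballI)
  fix I J f g assume I: "haar (CN N) I" and J: "haar (CN N) J" and fg: "f \<in> CN N" "g \<in> CN N"
  note PI = haar_pos_functional[OF I] and PJ = haar_pos_functional[OF J]
  have refN: "ref \<in> CN N" using ref(1) CN_limit[OF e0] by blast
  have I0: "I ref > 0" by (rule haar_strictly_pos[OF nN I refN, of \<one>]) (use ref(2) in simp)
  have on_dense: "J h * I ref = J ref * I h" if i: "i \<in> E" and h: "h \<in> CN (L i)" for i h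
  proof -
    have "haar (CN (L i)) I" "haar (CN (L i)) J"
      by (rule haar_restrict[OF _ nN admL[OF i] CN_limit[OF i]], rule I J)+
    then show ?thesis using uniqueL[OF i] h ref_in[OF i] unfolding unique_haar_def by blast
  qed
  have J0: "0 \<le> J ref" by (rule pos_functional_nonneg[OF PJ refN])
  have all: "J f * I ref = J ref * I f" if f: "f \<in> CN N" for f
  proof -
    obtain u where u: "u \<in> CN (L e0)" "\<And>e. e > 0 \<Longrightarrow> \<exists>i\<in>E. \<forall>x. \<bar>coset_sup (L i) f x - f x\<bar> \<le> e * u x"
      using uniform_tends[OF proper_limit f] by blast
    have uN: "u \<in> CN N" using u(1) CN_limit[OF e0] by blast
    define k where "k = J u * I ref + J ref * I u"
    have k: "0 \<le> k"
      unfolding k_def using pos_functional_nonneg[OF PI uN] pos_functional_nonneg[OF PJ uN] I0 J0 by simp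
    have "\<bar>J f * I ref - J ref * I f\<bar> \<le> 0 + r" if r: "r > 0" for r
    proof -
      define e where "e = r / (k + 1)"
      have e: "e > 0" unfolding e_def using r k by simp
      obtain i where i: "i \<in> E" "\<forall>x. \<bar>coset_sup (L i) f x - f x\<bar> \<le> e * u x" using u(2)[OF e] by blast
      let ?h = "coset_sup (L i) f"
      have hi: "?h \<in> CN (L i)" by (rule sup_CN[OF f i(1)])
      have h: "?h \<in> CN N" using hi CN_limit[OF i(1)] by blast
      have 1: "\<bar>I ?h - I f\<bar> \<le> e * I u"
        by (rule pos_functional_approx[OF fun_cone_CN PI h f uN]) (use e i in auto)
      have 2: "\<bar>J ?h - J f\<bar> \<le> e * J u"
        by (rule pos_functional_approx[OF fun_cone_CN PJ h f uN]) (use e i in auto)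
      have "J f * I ref - J ref * I f = J ref * (I ?h - I f) - (J ?h - J f) * I ref"
        using on_dense[OF i(1) hi] by (simp add: algebra_simps)
      then have "\<bar>J f * I ref - J ref * I f\<bar> \<le> J ref * \<bar>I ?h - I f\<bar> + \<bar>J ?h - J f\<bar> * I ref"
        using abs_triangle_ineq4[of "J ref * (I ?h - I f)" "(J ?h - J f) * I ref"] I0 J0
        by (simp add: abs_mult)
      also have "\<dots> \<le> J ref * (e * I u) + e * J u * I ref"
        using 1 2 I0 J0 by (intro add_mono mult_left_mono mult_right_mono) auto
      also have "\<dots> = e * k" unfolding k_def by (simp add: algebra_simps)
      also have "\<dots> \<le> r" using r k unfolding e_def by (simp add: field_simps)
      finally show ?thesis by simp
    qed
    then have "\<bar>J f * I ref - J ref * I f\<bar> \<le> 0" by (rule field_le_epsilon)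
    then show ?thesis by simp
  qed
  have "I f * J g * I ref = I f * (J ref * I g)" using all[OF fg(2)] by (simp add: mult.assoc)
  also have "\<dots> = I g * (J ref * I f)" by simp
  also have "\<dots> = I g * J f * I ref" using all[OF fg(1)] by (simp add: mult.assoc)
  finally show "I f * J g = I g * J f" using I0 by simp
qed

end

section \<open>Radon measures and positive functionals\<close>

text \<open>The relation written f \<prec> U in the Riesz representation theorem, with the compact
  support required to lie inside \<open>U\<close>.\<close>

definition subordinate :: "'a topology \<Rightarrow> 'a set \<Rightarrow> ('a \<Rightarrow> real) set" where
  "subordinate X U = {f \<in> Cc X. (\<forall>x. f x \<le> 1) \<and> (\<exists>C. compactin X C \<and> C \<subseteq> U \<and> (\<forall>x. x \<notin> C \<longrightarrow> f x = 0))}"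

lemma subordinateI:
  assumes "f \<in> Cc X" "\<And>x. f x \<le> 1" "compactin X C" "C \<subseteq> U" "\<And>x. x \<notin> C \<Longrightarrow> f x = 0"
  shows "f \<in> subordinate X U"
  using assms unfolding subordinate_def by blast

lemma subordinate_Cc: "f \<in> subordinate X U \<Longrightarrow> f \<in> Cc X"
  and subordinate_le: "f \<in> subordinate X U \<Longrightarrow> f x \<le> 1"
  unfolding subordinate_def by auto

lemma subordinate_support:
  assumes "f \<in> subordinate X U"
  obtains C where "compactin X C" "C \<subseteq> U" "\<And>x. x \<notin> C \<Longrightarrow> f x = 0"
  using assms unfolding subordinate_def by blast

lemma subordinate_mono: "U \<subseteq> V \<Longrightarrow> subordinate X U \<subseteq> subordinate X V"
  unfolding subordinate_def by blast

lemma zero_subordinate: "(\<lambda>x. 0) \<in> subordinate X U"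
  by (rule subordinateI[of _ _ "{}"]) (auto intro: fun_cone_zero fun_cone_Cc)

section \<open>The Radon measure of a positive functional\<close>

locale riesz =
  fixes X :: "'a topology" and I :: "('a \<Rightarrow> real) \<Rightarrow> real"
  assumes lc: "locally_compact_space X" and haus: "Hausdorff_space X" and I: "pos_functional (Cc X) I"
begin

definition open_mass :: "'a set \<Rightarrow> ennreal" where
  "open_mass U = (SUP f\<in>subordinate X U. ennreal (I f))"

definition outer_mass :: "'a set \<Rightarrow> ennreal" where
  "outer_mass A = (INF U\<in>{U. openin X U \<and> A \<subseteq> U}. open_mass U)"

definition riesz_measure :: "'a measure" where
  "riesz_measure = measure_of (topspace X) {U. openin X U} outer_mass"

lemma I_nonneg: "f \<in> Cc X \<Longrightarrow> 0 \<le> I f"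
  by (rule pos_functional_nonneg[OF I])

lemma open_mass_upper: "f \<in> subordinate X U \<Longrightarrow> ennreal (I f) \<le> open_mass U"
  unfolding open_mass_def by (rule SUP_upper)

lemma open_mass_mono: "U \<subseteq> V \<Longrightarrow> open_mass U \<le> open_mass V"
  unfolding open_mass_def by (rule SUP_subset_mono[OF subordinate_mono]) auto

lemma outer_mass_open: "openin X U \<Longrightarrow> outer_mass U = open_mass U"
  unfolding outer_mass_def by (rule antisym) (auto intro: INF_lower INF_greatest open_mass_mono)

lemma outer_mass_mono: "A \<subseteq> B \<Longrightarrow> outer_mass A \<le> outer_mass B"
  unfolding outer_mass_def by (rule INF_superset_mono) auto

lemma outer_mass_le: "openin X U \<Longrightarrow> A \<subseteq> U \<Longrightarrow> outer_mass A \<le> open_mass U"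
  unfolding outer_mass_def by (rule INF_lower) auto

lemma outer_mass_empty: "outer_mass {} = 0"
proof -
  have "I f = 0" if f: "f \<in> subordinate X {}" for f
  proof -
    have "f = (\<lambda>x. 0)" using subordinate_support[OF f] by (metis empty_iff subset_empty)
    then show ?thesis using pos_functional_zero[OF I fun_cone_Cc] by simp
  qed
  then have "open_mass {} = 0"
    unfolding open_mass_def using zero_subordinate by (intro SUP_eq_const) auto
  then show ?thesis using outer_mass_open[of "{}"] by simp
qed

text \<open>A function subordinate to the union has compact support, hence meets only finitely many
  of the sets essentially; a partition of unity splits it into functions subordinate to
  these.\<close>

lemma open_mass_UN:
  assumes U: "\<And>n::nat. openin X (U n)"
  shows "open_mass (\<Union>n. U n) \<le> (\<Sum>n. open_mass (U n))"
  unfolding open_mass_def[of "\<Union>n. U n"]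
proof (rule SUP_least)
  fix f assume f: "f \<in> subordinate X (\<Union>n. U n)"
  note fC = subordinate_Cc[OF f]
  obtain C where C: "compactin X C" "C \<subseteq> (\<Union>n. U n)" "\<And>x. x \<notin> C \<Longrightarrow> f x = 0"
    using subordinate_support[OF f] by metis
  have "openin X T" if "T \<in> range U" for T using that U by blast
  then obtain \<F> where F: "finite \<F>" "\<F> \<subseteq> range U" "C \<subseteq> \<Union>\<F>"
    using compactinD[OF C(1), of "range U"] C(2) by blast
  obtain D where D: "finite D" "\<F> = U ` D" using finite_subset_image[OF F(1,2)] by blast
  have CD: "C \<subseteq> (\<Union>n\<in>D. U n)" using F(3) D(2) by simp
  obtain p K where p: "\<And>i. i \<in> D \<Longrightarrow> p i \<in> Cc X" "\<And>i. i \<in> D \<Longrightarrow> compactin X (K i)"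
      "\<And>i. i \<in> D \<Longrightarrow> K i \<subseteq> U i" "\<And>i x. i \<in> D \<Longrightarrow> x \<notin> K i \<Longrightarrow> p i x = 0"
      "\<And>x. (\<Sum>i\<in>D. p i x) \<le> (1::real)" "\<And>x. x \<in> C \<Longrightarrow> (\<Sum>i\<in>D. p i x) = 1"
  proof (rule Cc_partition_of_unity[OF lc haus C(1) D(1) U CD], goal_cases)
    case (1 p K)
    from 1(1)[OF 1(2-7)] show ?case .
  qed
  define fp where "fp i = (\<lambda>x. f x * p i x)" for i
  have fp: "fp i \<in> subordinate X (U i)" if i: "i \<in> D" for i
  proof (rule subordinateI[OF _ _ p(2,3)[OF i]])
    show "fp i \<in> Cc X"
      unfolding fp_def by (rule Cc_mult[OF fC Cc_cont[OF p(1)[OF i]] Cc_nonneg[OF p(1)[OF i]]])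
    have "p i x \<le> 1" for x
      using member_le_sum[OF i, of "\<lambda>i. p i x"] p(5)[of x] Cc_nonneg[OF p(1)] D(1) by force
    then show "fp i x \<le> 1" for x
      unfolding fp_def using subordinate_le[OF f] Cc_nonneg[OF fC] Cc_nonneg[OF p(1)[OF i]]
      by (simp add: mult_le_one)
    show "fp i x = 0" if "x \<notin> K i" for x using p(4)[OF i that] by (simp add: fp_def)
  qed
  have "f = (\<lambda>x. \<Sum>i\<in>D. fp i x)"
  proof
    fix x show "f x = (\<Sum>i\<in>D. fp i x)"
      using p(6)[of x] C(3)[of x] unfolding fp_def sum_distrib_left[symmetric] by (cases "x \<in> C") auto
  qed
  then have "I f = (\<Sum>i\<in>D. I (fp i))"
    using pos_functional_sum[OF fun_cone_Cc I, of D fp] subordinate_Cc[OF fp] by simp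
  then have "ennreal (I f) = (\<Sum>i\<in>D. ennreal (I (fp i)))"
    using I_nonneg[OF subordinate_Cc[OF fp]] by (simp add: sum_ennreal)
  also have "\<dots> \<le> (\<Sum>i\<in>D. open_mass (U i))"
    by (intro sum_mono open_mass_upper fp)
  also have "\<dots> \<le> (\<Sum>n. open_mass (U n))"
    by (rule sum_le_suminf[OF summableI D(1)]) auto
  finally show "ennreal (I f) \<le> (\<Sum>n. open_mass (U n))" .
qed

lemma outer_mass_subadditive: "outer_mass (\<Union>n::nat. A n) \<le> (\<Sum>n. outer_mass (A n))"
proof (cases "\<exists>n. outer_mass (A n) = \<infinity>")
  case True
  then obtain n where n: "outer_mass (A n) = \<infinity>" by blast
  have "(\<Sum>n. outer_mass (A n)) = \<infinity>"
    using sum_le_suminf[OF summableI, of "{n}" "\<lambda>n. outer_mass (A n)"] n by (simp add: top_unique)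
  then show ?thesis by simp
next
  case False
  show ?thesis
  proof (rule ennreal_le_epsilon)
    fix e :: real assume e: "0 < e"
    have "\<exists>U\<in>{U. openin X U \<and> A n \<subseteq> U}. open_mass U < outer_mass (A n) + ennreal (e * (1/2) ^ Suc n)" for n
      by (rule INF_approx_ennreal[OF _ outer_mass_def]) (use e False in auto)
    then obtain U where U: "\<And>n. openin X (U n)" "\<And>n. A n \<subseteq> U n"
      "\<And>n. open_mass (U n) < outer_mass (A n) + ennreal (e * (1/2) ^ Suc n)"
      by (simp only: Bex_def mem_Collect_eq) metis
    have "outer_mass (\<Union>n. A n) \<le> open_mass (\<Union>n. U n)"
      by (rule outer_mass_le) (use U in blast)+
    also have "\<dots> \<le> (\<Sum>n. open_mass (U n))" by (rule open_mass_UN[OF U(1)])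
    also have "\<dots> \<le> (\<Sum>n. outer_mass (A n) + ennreal (e * (1/2) ^ Suc n))"
      by (rule suminf_le) (use U(3) in \<open>auto intro: less_imp_le\<close>)
    also have "\<dots> = (\<Sum>n. outer_mass (A n)) + (\<Sum>n. ennreal (e * (1/2) ^ Suc n))"
      by (rule suminf_add[symmetric]) auto
    also have "(\<Sum>n. ennreal (e * (1/2) ^ Suc n)) = ennreal e"
    proof -
      have "(\<lambda>n. e * (1/2) ^ Suc n) sums (e * 1)"
        by (rule sums_mult) (rule power_half_series)
      then show ?thesis using e by (intro suminf_ennreal_eq) auto
    qed
    finally show "outer_mass (\<Union>n. A n) \<le> (\<Sum>n. outer_mass (A n)) + ennreal e" .
  qed
qed

lemma outer_mass_Un: "outer_mass (A \<union> B) \<le> outer_mass A + outer_mass B"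
proof -
  have "outer_mass (\<Union>n::nat. if n = 0 then A else if n = 1 then B else {}) \<le>
      (\<Sum>n::nat. outer_mass (if n = 0 then A else if n = 1 then B else {}))"
    by (rule outer_mass_subadditive)
  also have "(\<Union>n::nat. if n = 0 then A else if n = 1 then B else {}) = A \<union> B"
    by (auto split: if_splits)
  also have "(\<Sum>n::nat. outer_mass (if n = 0 then A else if n = 1 then B else {})) =
      (\<Sum>n\<in>{0, 1::nat}. outer_mass (if n = 0 then A else if n = 1 then B else {}))"
    by (rule suminf_finite) (auto simp: outer_mass_empty)
  finally show ?thesis by simp
qed

text \<open>Caratheodory's condition for \<open>U\<close>; the nontrivial inequality is checked on
  open \<open>V\<close> containing \<open>A\<close>. If \<open>f\<close> is subordinate to
  \<open>V \<inter> U\<close> with support \<open>C\<close>, and \<open>g\<close> to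
  \<open>V - C\<close>, then \<open>f + g\<close> is subordinate to \<open>V\<close> because the
  supports are disjoint. Suprema are taken first over \<open>g\<close>, then over
  \<open>f\<close>.\<close>

lemma open_in_lambda_system:
  assumes U: "openin X U"
  shows "U \<in> lambda_system (topspace X) (Pow (topspace X)) outer_mass"
  unfolding lambda_system_def
proof (intro CollectI conjI ballI)
  show "U \<in> Pow (topspace X)" using openin_subset[OF U] by blast
  fix A assume A: "A \<in> Pow (topspace X)"
  let ?B = "(topspace X - U) \<inter> A"
  show "outer_mass (U \<inter> A) + outer_mass ?B = outer_mass A"
  proof (rule antisym)
    have "A = (U \<inter> A) \<union> ?B" using A by blast
    then show "outer_mass A \<le> outer_mass (U \<inter> A) + outer_mass ?B"
      using outer_mass_Un by metis
    show "outer_mass (U \<inter> A) + outer_mass ?B \<le> outer_mass A"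
      unfolding outer_mass_def[of A]
    proof (rule INF_greatest)
      fix V assume "V \<in> {U. openin X U \<and> A \<subseteq> U}"
      then have V: "openin X V" "A \<subseteq> V" by auto
      have "ennreal (I f) + outer_mass ?B \<le> open_mass V" if f: "f \<in> subordinate X (V \<inter> U)" for f
      proof -
        obtain C where C: "compactin X C" "C \<subseteq> V \<inter> U" "\<And>x. x \<notin> C \<Longrightarrow> f x = 0"
          using subordinate_support[OF f] by metis
        \<comment> \<open>Since \<open>C\<close> lies in \<open>U\<close>, this open set contains
          the part of \<open>A\<close> outside \<open>U\<close>, so its mass bounds the second outer
          mass.\<close>
        have W: "openin X (V - C)" using V(1) compactin_imp_closedin[OF haus C(1)] by (rule openin_diff)
        have "ennreal (I f) + ennreal (I g) \<le> open_mass V" if g: "g \<in> subordinate X (V - C)" for g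
        proof -
          obtain D where D: "compactin X D" "D \<subseteq> V - C" "\<And>x. x \<notin> D \<Longrightarrow> g x = 0"
            using subordinate_support[OF g] by metis
          have fg: "(\<lambda>x. f x + g x) \<in> subordinate X V"
          proof (rule subordinateI[OF _ _ compactin_Un[OF C(1) D(1)]])
            show "(\<lambda>x. f x + g x) \<in> Cc X"
              by (rule fun_cone_add[OF fun_cone_Cc subordinate_Cc[OF f] subordinate_Cc[OF g]])
            show "f x + g x \<le> 1" for x
            proof (cases "x \<in> C")
              case True
              then have "x \<notin> D" using D(2) by blast
              then show ?thesis using D(3) subordinate_le[OF f] by simp
            next
              case False
              then show ?thesis using C(3) subordinate_le[OF g] by simp
            qed
            show "C \<union> D \<subseteq> V" using C(2) D(2) by blast
            show "f x + g x = 0" if "x \<notin> C \<union> D" for x using that C(3) D(3) by simp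
          qed
          have "ennreal (I f) + ennreal (I g) = ennreal (I (\<lambda>x. f x + g x))"
            using pos_functional_add[OF I subordinate_Cc[OF f] subordinate_Cc[OF g]]
              I_nonneg subordinate_Cc[OF f] subordinate_Cc[OF g] by (simp add: ennreal_plus)
          then show ?thesis using open_mass_upper[OF fg] by simp
        qed
        then have "ennreal (I f) + open_mass (V - C) \<le> open_mass V"
          unfolding open_mass_def[of "V - C"] using zero_subordinate[of X "V - C"]
          by (subst ennreal_SUP_add_right) (blast, blast intro: SUP_least)
        moreover have "outer_mass ?B \<le> open_mass (V - C)"
          by (rule outer_mass_le[OF W]) (use V C in blast)
        ultimately show ?thesis by (meson add_left_mono order_trans)
      qed
      then have "open_mass (V \<inter> U) + outer_mass ?B \<le> open_mass V"
        unfolding open_mass_def[of "V \<inter> U"] using zero_subordinate[of X "V \<inter> U"]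
        by (subst ennreal_SUP_add_left[symmetric]) (auto intro: SUP_least)
      moreover have "outer_mass (U \<inter> A) \<le> open_mass (V \<inter> U)"
        by (rule outer_mass_le) (use V U in auto)
      ultimately show "outer_mass (U \<inter> A) + outer_mass ?B \<le> open_mass V"
        by (meson add_right_mono order_trans)
    qed
  qed
qed

lemma sets_riesz: "sets riesz_measure = sigma_sets (topspace X) {U. openin X U}"
  unfolding riesz_measure_def by (rule sets_measure_of) (auto dest: openin_subset)

text \<open>By Caratheodory's lemma the outer mass is countably additive on its measurable sets;
  these contain the open sets and so all Borel sets.\<close>

lemma emeasure_riesz:
  assumes "A \<in> sets riesz_measure"
  shows "emeasure riesz_measure A = outer_mass A"
proof -
  let ?L = "lambda_system (topspace X) (Pow (topspace X)) outer_mass"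
  interpret P: sigma_algebra "topspace X" "Pow (topspace X)" by (rule sigma_algebra_Pow)
  have oms: "outer_measure_space (Pow (topspace X)) outer_mass"
    unfolding outer_measure_space_def positive_def increasing_def countably_subadditive_def
    using outer_mass_empty outer_mass_mono outer_mass_subadditive by auto
  have ms: "measure_space (topspace X) ?L outer_mass" by (rule P.caratheodory_lemma[OF oms])
  then have sa: "sigma_algebra (topspace X) ?L" and ca: "countably_additive ?L outer_mass"
    unfolding measure_space_def by auto
  have sub: "sigma_sets (topspace X) {U. openin X U} \<subseteq> ?L"
    by (rule sigma_algebra.sigma_sets_subset[OF sa]) (use open_in_lambda_system in blast)
  show ?thesis
  proof (rule emeasure_measure_of[OF riesz_measure_def])
    show "{U. openin X U} \<subseteq> Pow (topspace X)" by (auto dest: openin_subset)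
    show "positive (sets riesz_measure) outer_mass" unfolding positive_def by (rule outer_mass_empty)
    show "countably_additive (sets riesz_measure) outer_mass"
      using ca sub unfolding sets_riesz countably_additive_def by blast
  qed (rule assms)
qed

lemma open_sets: "openin X U \<Longrightarrow> U \<in> sets riesz_measure"
  unfolding sets_riesz by (rule sigma_sets.Basic) simp

lemma compact_sets: "compactin X K \<Longrightarrow> K \<in> sets riesz_measure"
proof -
  assume K: "compactin X K"
  have "openin X (topspace X - K)" using compactin_imp_closedin[OF haus K] by blast
  then have "topspace X - (topspace X - K) \<in> sets riesz_measure"
    unfolding sets_riesz by (intro sigma_sets.Compl sigma_sets.Basic) simp
  then show ?thesis using compactin_subset_topspace[OF K] by (simp add: double_diff)
qed

lemma radon_riesz: "radon_measure X riesz_measure"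
  unfolding radon_measure_def
proof (intro conjI allI impI ballI)
  show "sets riesz_measure = sigma_sets (topspace X) {U. openin X U}" by (rule sets_riesz)
  fix K assume K: "compactin X K"
  obtain f where f: "f \<in> Cc X" "\<And>x. x \<in> K \<Longrightarrow> f x = 1"
    using Cc_urysohn[OF lc haus K openin_topspace compactin_subset_topspace[OF K]] by metis
  \<comment> \<open>On this neighbourhood of \<open>K\<close> every subordinate function is at most
    \<open>2 * f\<close>, so the mass of \<open>V\<close> is at most \<open>2 * I f\<close>.\<close>
  define V where "V = {x \<in> topspace X. f x \<in> {1/2<..}}"
  have V: "openin X V" unfolding V_def by (rule openin_continuous_map_preimage[OF Cc_cont[OF f(1)]]) auto
  have KV: "K \<subseteq> V" using f(2) compactin_subset_topspace[OF K] unfolding V_def by auto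
  have "I g \<le> 2 * I f" if g: "g \<in> subordinate X V" for g
  proof -
    have "g x \<le> 2 * f x" for x
    proof (cases "x \<in> V")
      case True
      then show ?thesis using subordinate_le[OF g, of x] unfolding V_def by simp
    next
      case False
      then show ?thesis
        using subordinate_support[OF g] Cc_nonneg[OF f(1), of x]
        by (metis mult_nonneg_nonneg subsetD zero_le_numeral)
    qed
    then have "I g \<le> I (\<lambda>x. 2 * f x)"
      by (intro pos_functional_mono[OF fun_cone_Cc I subordinate_Cc[OF g]] fun_cone_scale[OF fun_cone_Cc f(1)]) auto
    then show ?thesis using pos_functional_scale[OF I f(1), of 2] by simp
  qed
  then have "open_mass V \<le> ennreal (2 * I f)"
    unfolding open_mass_def by (intro SUP_least ennreal_leI)
  then have "outer_mass K \<le> ennreal (2 * I f)" using outer_mass_le[OF V KV] by (rule order_trans[rotated])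
  then show "emeasure riesz_measure K < \<infinity>"
    using emeasure_riesz[OF compact_sets[OF K]] by (simp add: order_le_less_trans)
next
  fix A assume A: "A \<in> sets riesz_measure"
  show "emeasure riesz_measure A = (INF U\<in>{U. openin X U \<and> A \<subseteq> U}. emeasure riesz_measure U)"
    unfolding emeasure_riesz[OF A] outer_mass_def
    by (rule INF_cong) (auto simp: emeasure_riesz[OF open_sets] outer_mass_open[symmetric] outer_mass_def)
next
  fix U assume U: "openin X U"
  show "emeasure riesz_measure U = (SUP K\<in>{K. compactin X K \<and> K \<subseteq> U}. emeasure riesz_measure K)"
  proof (rule antisym)
    show "(SUP K\<in>{K. compactin X K \<and> K \<subseteq> U}. emeasure riesz_measure K) \<le> emeasure riesz_measure U"
      by (rule SUP_least) (auto intro: emeasure_mono open_sets[OF U])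
    have "ennreal (I f) \<le> (SUP K\<in>{K. compactin X K \<and> K \<subseteq> U}. emeasure riesz_measure K)"
      if f: "f \<in> subordinate X U" for f
    proof -
      obtain C where C: "compactin X C" "C \<subseteq> U" "\<And>x. x \<notin> C \<Longrightarrow> f x = 0"
        using subordinate_support[OF f] by metis
      have "ennreal (I f) \<le> outer_mass C"
        unfolding outer_mass_def
      proof (rule INF_greatest)
        fix V assume V: "V \<in> {U. openin X U \<and> C \<subseteq> U}"
        show "ennreal (I f) \<le> open_mass V"
          by (rule open_mass_upper, rule subordinateI[OF subordinate_Cc[OF f] subordinate_le[OF f] C(1) _ C(3)])
             (use V in auto)
      qed
      also have "\<dots> = emeasure riesz_measure C" using emeasure_riesz[OF compact_sets[OF C(1)]] by simp
      also have "\<dots> \<le> (SUP K\<in>{K. compactin X K \<and> K \<subseteq> U}. emeasure riesz_measure K)"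
        by (rule SUP_upper) (use C in simp)
      finally show ?thesis .
    qed
    then show "emeasure riesz_measure U \<le> (SUP K\<in>{K. compactin X K \<and> K \<subseteq> U}. emeasure riesz_measure K)"
      unfolding emeasure_riesz[OF open_sets[OF U]] outer_mass_open[OF U] open_mass_def
      by (intro SUP_least)
  qed
qed

end

section \<open>Integration of compactly supported functions against a Radon measure\<close>

locale radon =
  fixes X :: "'a topology" and M :: "'a measure"
  assumes lc: "locally_compact_space X" and haus: "Hausdorff_space X" and M: "radon_measure X M"
begin

lemma sets_M: "sets M = sigma_sets (topspace X) {U. openin X U}"
  and finite_compact: "compactin X K \<Longrightarrow> emeasure M K < \<infinity>"
  and outer_regular: "A \<in> sets M \<Longrightarrow> emeasure M A = (INF U\<in>{U. openin X U \<and> A \<subseteq> U}. emeasure M U)"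
  and inner_regular: "openin X U \<Longrightarrow> emeasure M U = (SUP K\<in>{K. compactin X K \<and> K \<subseteq> U}. emeasure M K)"
  using M unfolding radon_measure_def by blast+

lemma open_sets: "openin X U \<Longrightarrow> U \<in> sets M"
  unfolding sets_M by (rule sigma_sets.Basic) simp

lemma space_M: "space M = topspace X"
proof
  have "space M \<in> sigma_sets (topspace X) {U. openin X U}" using sets.top[of M] unfolding sets_M .
  then show "space M \<subseteq> topspace X"
    by (rule sigma_sets_into_sp[rotated]) (auto dest: openin_subset)
  show "topspace X \<subseteq> space M" using sets.sets_into_space[OF open_sets[OF openin_topspace]] .
qed

lemma compact_sets: "compactin X K \<Longrightarrow> K \<in> sets M"
proof -
  assume K: "compactin X K"
  have "openin X (topspace X - K)" using compactin_imp_closedin[OF haus K] by blast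
  then have "space M - (topspace X - K) \<in> sets M" using open_sets by blast
  then show ?thesis using compactin_subset_topspace[OF K] by (simp add: double_diff space_M)
qed

text \<open>\<open>enn2real\<close> would send an infinite integral to 0; this does not happen on
  \<open>Cc X\<close>, by \<open>nn_integral_Cc\<close>.\<close>

definition int :: "('a \<Rightarrow> real) \<Rightarrow> real" where
  "int f = enn2real (\<integral>\<^sup>+x. ennreal (f x) \<partial>M)"

lemma borel_Cc:
  assumes f: "f \<in> Cc X"
  shows "f \<in> borel_measurable M"
proof (rule borel_measurableI)
  fix S :: "real set" assume "open S"
  then have "openin X {x \<in> topspace X. f x \<in> S}"
    by (intro openin_continuous_map_preimage[OF Cc_cont[OF f]]) auto
  moreover have "f -` S \<inter> space M = {x \<in> topspace X. f x \<in> S}" by (auto simp: space_M)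
  ultimately show "f -` S \<inter> space M \<in> sets M" using open_sets by simp
qed

lemma nn_integral_Cc:
  assumes f: "f \<in> Cc X"
  shows "(\<integral>\<^sup>+x. ennreal (f x) \<partial>M) = ennreal (int f)"
proof -
  obtain B where B: "B > 0" "\<And>x. f x \<le> B" using Cc_bounded[OF f] by metis
  obtain C where C: "compactin X C" "\<And>x. x \<notin> C \<Longrightarrow> f x = 0" using Cc_support[OF f] by metis
  have "(\<integral>\<^sup>+x. ennreal (f x) \<partial>M) \<le> (\<integral>\<^sup>+x. ennreal B * indicator C x \<partial>M)"
    by (rule nn_integral_mono) (use B C in \<open>auto simp: indicator_def ennreal_leI\<close>)
  also have "\<dots> = ennreal B * emeasure M C"
    by (rule nn_integral_cmult_indicator[OF compact_sets[OF C(1)]])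
  also have "\<dots> < \<infinity>" using finite_compact[OF C(1)] by (simp add: ennreal_mult_less_top)
  finally show ?thesis unfolding int_def by simp
qed

lemma int_nonneg: "0 \<le> int f"
  unfolding int_def by simp

lemma pos_functional_int: "pos_functional (Cc X) int"
  unfolding pos_functional_def
proof (intro conjI ballI allI impI int_nonneg)
  fix f assume f: "f \<in> Cc X"
  show "int (\<lambda>x. c * f x) = c * int f" if c: "0 \<le> c" for c
  proof -
    have "(\<integral>\<^sup>+x. ennreal (c * f x) \<partial>M) = ennreal c * (\<integral>\<^sup>+x. ennreal (f x) \<partial>M)"
      using borel_Cc[OF f] c Cc_nonneg[OF f]
      by (simp add: ennreal_mult nn_integral_cmult)
    then show ?thesis
      unfolding int_def using c by (simp add: enn2real_mult)
  qed
  fix g assume g: "g \<in> Cc X"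
  have "(\<integral>\<^sup>+x. ennreal (f x + g x) \<partial>M) = (\<integral>\<^sup>+x. ennreal (f x) \<partial>M) + (\<integral>\<^sup>+x. ennreal (g x) \<partial>M)"
    using borel_Cc[OF f] borel_Cc[OF g] Cc_nonneg[OF f] Cc_nonneg[OF g]
    by (simp add: ennreal_plus nn_integral_add)
  then show "int (\<lambda>x. f x + g x) = int f + int g"
    unfolding int_def[of "\<lambda>x. f x + g x"] nn_integral_Cc[OF f] nn_integral_Cc[OF g]
    by (simp add: int_nonneg flip: ennreal_plus)
qed

text \<open>Inner regularity on open sets and Urysohn functions: the integrals of compactly
  supported functions determine the measure of every open set.\<close>

lemma open_eq_SUP_int:
  assumes U: "openin X U"
  shows "emeasure M U = (SUP f\<in>subordinate X U. ennreal (int f))"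
proof (rule antisym)
  show "emeasure M U \<le> (SUP f\<in>subordinate X U. ennreal (int f))"
    unfolding inner_regular[OF U]
  proof (rule SUP_least)
    fix K assume "K \<in> {K. compactin X K \<and> K \<subseteq> U}"
    then have K: "compactin X K" "K \<subseteq> U" by auto
    obtain f C where f: "f \<in> Cc X" "\<And>x. f x \<le> 1" "\<And>x. x \<in> K \<Longrightarrow> f x = 1"
        "compactin X C" "C \<subseteq> U" "\<And>x. x \<notin> C \<Longrightarrow> f x = 0"
      using Cc_urysohn[OF lc haus K(1) U K(2)] by metis
    have "emeasure M K = (\<integral>\<^sup>+x. indicator K x \<partial>M)" using compact_sets[OF K(1)] by simp
    also have "\<dots> \<le> (\<integral>\<^sup>+x. ennreal (f x) \<partial>M)"
      by (rule nn_integral_mono) (use f(3) in \<open>auto simp: indicator_def\<close>)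
    also have "\<dots> = ennreal (int f)" by (rule nn_integral_Cc[OF f(1)])
    also have "\<dots> \<le> (SUP f\<in>subordinate X U. ennreal (int f))"
      by (rule SUP_upper) (rule subordinateI[OF f(1,2,4,5,6)])
    finally show "emeasure M K \<le> (SUP f\<in>subordinate X U. ennreal (int f))" .
  qed
  show "(SUP f\<in>subordinate X U. ennreal (int f)) \<le> emeasure M U"
  proof (rule SUP_least)
    fix f assume f: "f \<in> subordinate X U"
    obtain C where C: "C \<subseteq> U" "\<And>x. x \<notin> C \<Longrightarrow> f x = 0"
      using subordinate_support[OF f] by metis
    have "ennreal (int f) = (\<integral>\<^sup>+x. ennreal (f x) \<partial>M)"
      using nn_integral_Cc[OF subordinate_Cc[OF f]] by simp
    also have "\<dots> \<le> (\<integral>\<^sup>+x. indicator U x \<partial>M)"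
    proof (rule nn_integral_mono)
      fix x show "ennreal (f x) \<le> indicator U x"
      proof (cases "x \<in> U")
        case False
        then have "f x = 0" using C by blast
        then show ?thesis by simp
      qed (use subordinate_le[OF f, of x] in simp)
    qed
    also have "\<dots> = emeasure M U" using open_sets[OF U] by simp
    finally show "ennreal (int f) \<le> emeasure M U" .
  qed
qed

end

text \<open>The integrals determine the measures on open sets, and outer regularity then determines
  them on all Borel sets.\<close>

lemma radon_eq_if_int_eq:
  assumes M: "radon X M" and M': "radon X M'" and c: "c > 0"
    and eq: "\<And>f. f \<in> Cc X \<Longrightarrow> radon.int M' f = c * radon.int M f"
  shows "M' = scale_measure (ennreal c) M"
proof -
  interpret M: radon X M by (rule M)
  interpret M': radon X M' by (rule M')
  have op: "emeasure M' U = ennreal c * emeasure M U" if U: "openin X U" for U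
  proof -
    have "emeasure M' U = (SUP f\<in>subordinate X U. ennreal c * ennreal (M.int f))"
      unfolding M'.open_eq_SUP_int[OF U]
      by (rule SUP_cong) (use c in \<open>auto simp: eq subordinate_Cc M.int_nonneg ennreal_mult\<close>)
    then show ?thesis unfolding M.open_eq_SUP_int[OF U] SUP_mult_left_ennreal .
  qed
  \<comment> \<open>Cancellation of the finite positive factor in the extended reals; it brings the
    factor out of the infimum over open sets.\<close>
  have cc: "ennreal (1 / c) * (ennreal c * y) = y" for y
  proof -
    have "ennreal (1 / c) * ennreal c = 1" using c by (simp flip: ennreal_mult)
    then show ?thesis by (simp flip: mult.assoc)
  qed
  show ?thesis
  proof (rule measure_eqI)
    show s: "sets M' = sets (scale_measure (ennreal c) M)" by (simp add: M.sets_M M'.sets_M)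
    fix A assume A: "A \<in> sets M'"
    then have A': "A \<in> sets M" by (simp add: M.sets_M M'.sets_M)
    have "emeasure M' A = (INF U\<in>{U. openin X U \<and> A \<subseteq> U}. ennreal c * emeasure M U)"
      unfolding M'.outer_regular[OF A] by (rule INF_cong) (auto simp: op)
    also have "\<dots> = ennreal c * emeasure M A"
    proof (rule antisym)
      have le: "ennreal (1 / c) * (INF U\<in>{U. openin X U \<and> A \<subseteq> U}. ennreal c * emeasure M U) \<le> emeasure M A"
        unfolding M.outer_regular[OF A']
      proof (rule INF_greatest)
        fix U assume U: "U \<in> {U. openin X U \<and> A \<subseteq> U}"
        have "ennreal (1 / c) * (INF U\<in>{U. openin X U \<and> A \<subseteq> U}. ennreal c * emeasure M U)
            \<le> ennreal (1 / c) * (ennreal c * emeasure M U)"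
          by (intro mult_left_mono INF_lower U) simp
        then show "ennreal (1 / c) * (INF U\<in>{U. openin X U \<and> A \<subseteq> U}. ennreal c * emeasure M U) \<le> emeasure M U"
          unfolding cc .
      qed
      have "ennreal c * (ennreal (1 / c) * y) = y" for y
        using cc[of y] by (simp add: mult.left_commute)
      then show "(INF U\<in>{U. openin X U \<and> A \<subseteq> U}. ennreal c * emeasure M U) \<le> ennreal c * emeasure M A"
        using mult_left_mono[OF le, of "ennreal c"] by simp
      show "ennreal c * emeasure M A \<le> (INF U\<in>{U. openin X U \<and> A \<subseteq> U}. ennreal c * emeasure M U)"
        by (intro INF_greatest mult_left_mono emeasure_mono) (auto intro: M.open_sets)
    qed
    finally show "emeasure M' A = emeasure (scale_measure (ennreal c) M) A"
      by (simp add: emeasure_scale_measure)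
  qed
qed

section \<open>Correspondence between right Haar measures and Haar functionals\<close>

context rt_group
begin

lemma rcos_preimage:
  assumes "E \<subseteq> carrier G" "g \<in> carrier G"
  shows "(\<lambda>x. x \<otimes> inv g) -` E \<inter> carrier G = E #> g"
proof (intro equalityI subsetI)
  fix x assume x: "x \<in> (\<lambda>x. x \<otimes> inv g) -` E \<inter> carrier G"
  then have "x = x \<otimes> inv g \<otimes> g" using assms by (simp add: m_assoc)
  then show "x \<in> E #> g" using x unfolding rcos_image by blast
next
  fix x assume "x \<in> E #> g"
  then obtain y where y: "y \<in> E" "x = y \<otimes> g" unfolding rcos_image by blast
  then have "y \<in> carrier G" using assms by blast
  then show "x \<in> (\<lambda>x. x \<otimes> inv g) -` E \<inter> carrier G" using y assms by (simp add: m_assoc)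
qed

lemma rcos_inv_cancel: "E \<subseteq> carrier G \<Longrightarrow> g \<in> carrier G \<Longrightarrow> E #> g #> inv g = E"
  by (simp add: coset_mult_assoc)

lemma right_mult_measurable:
  assumes M: "radon X M" and g: "g \<in> carrier G"
  shows "(\<lambda>x. x \<otimes> g) \<in> measurable M M"
proof -
  interpret M: radon X M by (rule M)
  show ?thesis
  proof (rule measurable_sigma_sets[OF M.sets_M])
    show "{U. openin X U} \<subseteq> Pow (topspace X)" using openin_subset[of X] by blast
    show "(\<lambda>x. x \<otimes> g) \<in> space M \<rightarrow> topspace X" using g by (simp add: M.space_M)
    fix U assume "U \<in> {U. openin X U}"
    then have U: "openin X U" by simp
    have "(\<lambda>x. x \<otimes> g) -` U \<inter> space M = U #> inv g"
      using rcos_preimage[OF open_carrier[OF U], of "inv g"] g by (simp add: M.space_M)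
    then show "(\<lambda>x. x \<otimes> g) -` U \<inter> space M \<in> sets M"
      using M.open_sets[OF openin_rcos[OF U]] g by simp
  qed
qed

lemma rcos_sets:
  assumes M: "radon X M" and g: "g \<in> carrier G" and E: "E \<in> sets M"
  shows "E #> g \<in> sets M"
proof -
  interpret M: radon X M by (rule M)
  have "E \<subseteq> carrier G" using sets.sets_into_space[OF E] by (simp add: M.space_M)
  then have "E #> g = (\<lambda>x. x \<otimes> inv g) -` E \<inter> space M"
    using rcos_preimage g by (simp add: M.space_M)
  then show ?thesis using measurable_sets[OF right_mult_measurable[OF M inv_closed[OF g]] E] by simp
qed

lemma rt_subordinate:
  assumes f: "f \<in> subordinate X U" and s: "s \<in> carrier G"
  shows "rt (inv s) f \<in> subordinate X (U #> s)"
proof -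
  obtain C where C: "compactin X C" "C \<subseteq> U" "\<And>x. x \<notin> C \<Longrightarrow> f x = 0"
    using subordinate_support[OF f] by metis
  show ?thesis
  proof (rule subordinateI[OF _ _ compactin_rcos[OF C(1) s]])
    show "rt (inv s) f \<in> Cc X" by (rule rt_Cc[OF subordinate_Cc[OF f]]) (simp add: s)
    show "rt (inv s) f x \<le> 1" for x unfolding rt_def using subordinate_le[OF f] by simp
    show "C #> s \<subseteq> U #> s" using C(2) unfolding rcos_image by blast
    fix x assume x: "x \<notin> C #> s"
    show "rt (inv s) f x = 0"
    proof (cases "x \<in> carrier G")
      case True
      then have "x \<otimes> inv s \<notin> C" using x rcos_preimage[OF compact_carrier[OF C(1)] s] by blast
      then show ?thesis using C(3) True by (simp add: rt_def)
    qed (simp add: rt_def)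
  qed
qed

text \<open>Right translation maps functions subordinate to U to functions subordinate to U s with
  the same value of \<open>I\<close>. Masses therefore do not decrease under translation, and
  applying this to the inverse element gives equality.\<close>

lemma right_haar_of_functional:
  assumes I: "haar (Cc X) I"
  shows "right_haar_measure G X (riesz.riesz_measure X I)"
proof -
  interpret R: riesz X I
    by unfold_locales (rule lc, rule haus, rule haar_pos_functional[OF I])
  have radon: "radon X R.riesz_measure"
    by unfold_locales (rule lc, rule haus, rule R.radon_riesz)
  interpret M: radon X R.riesz_measure by (rule radon)
  have le: "R.open_mass U \<le> R.open_mass (U #> s)" if s: "s \<in> carrier G" for U s
    unfolding R.open_mass_def[of U]
  proof (rule SUP_least)
    fix f assume f: "f \<in> subordinate X U"
    have "I (rt (inv s) f) = I f" by (rule haar_rt[OF I subordinate_Cc[OF f]]) (simp add: s)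
    then show "ennreal (I f) \<le> R.open_mass (U #> s)"
      using R.open_mass_upper[OF rt_subordinate[OF f s]] by simp
  qed
  have outer_le: "R.outer_mass A \<le> R.outer_mass (A #> s)" if A: "A \<subseteq> carrier G" and s: "s \<in> carrier G" for A s
    unfolding R.outer_mass_def[of "A #> s"]
  proof (rule INF_greatest)
    fix U assume "U \<in> {U. openin X U \<and> A #> s \<subseteq> U}"
    then have U: "openin X U" "A #> s \<subseteq> U" by auto
    have si: "inv s \<in> carrier G" using s by simp
    have "A #> s #> inv s \<subseteq> U #> inv s" using U(2) unfolding rcos_image[of _ "inv s"] by blast
    then have "R.outer_mass A \<le> R.open_mass (U #> inv s)"
      using R.outer_mass_le[OF openin_rcos[OF U(1) si]] rcos_inv_cancel[OF A s] by simp
    also have "\<dots> \<le> R.open_mass (U #> inv s #> s)" by (rule le[OF s])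
    also have "U #> inv s #> s = U" using rcos_inv_cancel[OF open_carrier[OF U(1)] si] s by simp
    finally show "R.outer_mass A \<le> R.open_mass U" .
  qed
  show ?thesis
    unfolding right_haar_measure_def
  proof (intro conjI ballI)
    show "radon_measure X R.riesz_measure" by (rule R.radon_riesz)
    fix g E assume g: "g \<in> carrier G" and E: "E \<in> sets R.riesz_measure"
    have Ec: "E \<subseteq> carrier G" using sets.sets_into_space[OF E] by (simp add: M.space_M)
    have Eg: "E #> g \<subseteq> carrier G" using r_coset_subset_G[OF Ec g] .
    have "R.outer_mass (E #> g) \<le> R.outer_mass (E #> g #> inv g)"
      by (rule outer_le[OF Eg]) (simp add: g)
    then have "R.outer_mass (E #> g) = R.outer_mass E"
      using outer_le[OF Ec g] rcos_inv_cancel[OF Ec g] by simp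
    then show "emeasure R.riesz_measure (E #> g) = emeasure R.riesz_measure E"
      using R.emeasure_riesz[OF E] R.emeasure_riesz[OF rcos_sets[OF radon g E]] by simp
  next
    obtain f where f: "f \<in> Cc X" "I f \<noteq> 0" using I unfolding haar_def by blast
    obtain B where B: "B > 0" "\<And>x. f x \<le> B" using Cc_bounded[OF f(1)] by metis
    obtain C where C: "compactin X C" "\<And>x. x \<notin> C \<Longrightarrow> f x = 0" using Cc_support[OF f(1)] by metis
    have Bi: "0 \<le> 1 / B" using B by simp
    \<comment> \<open>Dividing a function of nonzero integral by its bound makes it subordinate to
      the whole space, which shows that the total mass is positive.\<close>
    have "(\<lambda>x. 1 / B * f x) \<in> subordinate X (topspace X)"
      by (rule subordinateI[OF fun_cone_scale[OF fun_cone_Cc f(1) Bi] _ C(1) compactin_subset_topspace[OF C(1)]])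
        (use B C(2) in \<open>auto simp: field_simps\<close>)
    then have "ennreal (I (\<lambda>x. 1 / B * f x)) \<le> R.open_mass (topspace X)" by (rule R.open_mass_upper)
    moreover have "I (\<lambda>x. 1 / B * f x) = 1 / B * I f"
      by (rule pos_functional_scale[OF R.I f(1) Bi])
    moreover have "0 < 1 / B * I f" using B(1) f(2) R.I_nonneg[OF f(1)] by simp
    ultimately have "0 < R.open_mass (topspace X)"
      by (metis ennreal_less_zero_iff less_le_trans)
    then show "emeasure R.riesz_measure (space R.riesz_measure) \<noteq> 0"
      using R.emeasure_riesz[OF R.open_sets[OF openin_topspace]] R.outer_mass_open[OF openin_topspace]
      by (simp add: M.space_M)
  qed
qed

text \<open>Invariance of sets becomes invariance of integrals by transport of measure. If all
  integrals vanished, so would the total mass, being a supremum of integrals.\<close>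

lemma haar_of_measure:
  assumes M: "right_haar_measure G X M"
  shows "radon X M" "haar (Cc X) (radon.int M)"
proof -
  show rM: "radon X M"
    by unfold_locales (rule lc, rule haus, use M in \<open>simp add: right_haar_measure_def\<close>)
  interpret M: radon X M by (rule rM)
  have inv: "emeasure M (E #> g) = emeasure M E" if "g \<in> carrier G" "E \<in> sets M" for g E
    using M that unfolding right_haar_measure_def by blast
  show "haar (Cc X) M.int"
    unfolding haar_def
  proof (intro conjI ballI)
    show "pos_functional (Cc X) M.int" by (rule M.pos_functional_int)
    fix f s assume f: "f \<in> Cc X" and s: "s \<in> carrier G"
    note ms = right_mult_measurable[OF rM s]
    \<comment> \<open>The preimage of a set under right multiplication by s is its right translate
      by inv s.\<close>
    have "distr M M (\<lambda>x. x \<otimes> s) = M"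
    proof (rule measure_eqI)
      fix E assume "E \<in> sets (distr M M (\<lambda>x. x \<otimes> s))"
      then have E: "E \<in> sets M" by simp
      have Ec: "E \<subseteq> carrier G" using sets.sets_into_space[OF E] by (simp add: M.space_M)
      have "emeasure (distr M M (\<lambda>x. x \<otimes> s)) E = emeasure M ((\<lambda>x. x \<otimes> s) -` E \<inter> space M)"
        by (rule emeasure_distr[OF ms E])
      also have "(\<lambda>x. x \<otimes> s) -` E \<inter> space M = E #> inv s"
        using rcos_preimage[OF Ec, of "inv s"] s by (simp add: M.space_M)
      also have "emeasure M (E #> inv s) = emeasure M E" by (rule inv) (use s E in auto)
      finally show "emeasure (distr M M (\<lambda>x. x \<otimes> s)) E = emeasure M E" .
    qed simp
    then have "(\<integral>\<^sup>+x. ennreal (f x) \<partial>M) = (\<integral>\<^sup>+x. ennreal (f x) \<partial>distr M M (\<lambda>x. x \<otimes> s))" by simp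
    also have "\<dots> = (\<integral>\<^sup>+x. ennreal (f (x \<otimes> s)) \<partial>M)"
      using M.borel_Cc[OF f] by (intro nn_integral_distr[OF ms]) simp
    also have "\<dots> = (\<integral>\<^sup>+x. ennreal (rt s f x) \<partial>M)"
      by (rule nn_integral_cong) (simp add: M.space_M rt_def)
    finally show "M.int (rt s f) = M.int f" unfolding M.int_def by simp
  next
    show "\<exists>f\<in>Cc X. M.int f \<noteq> 0"
    proof (rule ccontr)
      assume "\<not> ?thesis"
      then have z: "M.int f = 0" if "f \<in> Cc X" for f using that by blast
      have "emeasure M (topspace X) = 0"
        unfolding M.open_eq_SUP_int[OF openin_topspace]
        using zero_subordinate by (intro SUP_eq_const) (auto simp: z subordinate_Cc)
      then show False using M unfolding right_haar_measure_def by (simp add: M.space_M)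
    qed
  qed
qed

lemma right_haar_unique:
  assumes u: "unique_haar (Cc X)" and M: "right_haar_measure G X M" "right_haar_measure G X M'"
  shows "\<exists>c>0. M' = scale_measure (ennreal c) M"
proof -
  note r = haar_of_measure(1)[OF M(1)] haar_of_measure(1)[OF M(2)]
  note h = haar_of_measure(2)[OF M(1)] haar_of_measure(2)[OF M(2)]
  define J where "J = radon.int M"
  define J' where "J' = radon.int M'"
  have J: "haar (Cc X) J" "haar (Cc X) J'" using h unfolding J_def J'_def by auto
  have eq: "J f * J' g = J g * J' f" if "f \<in> Cc X" "g \<in> Cc X" for f g
    using u J that unfolding unique_haar_def by blast
  obtain f0 where f0: "f0 \<in> Cc X" "J f0 \<noteq> 0" using J(1) unfolding haar_def by blast
  have p: "J f0 > 0" using f0 pos_functional_nonneg[OF haar_pos_functional[OF J(1)] f0(1)] by simp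
  define c where "c = J' f0 / J f0"
  have Jc: "J' f = c * J f" if "f \<in> Cc X" for f
    using eq[OF that f0(1)] p unfolding c_def by (simp add: field_simps)
  obtain f1 where f1: "f1 \<in> Cc X" "J' f1 \<noteq> 0" using J(2) unfolding haar_def by blast
  have "c \<noteq> 0" using Jc[OF f1(1)] f1(2) by auto
  moreover have "0 \<le> c"
    unfolding c_def using p pos_functional_nonneg[OF haar_pos_functional[OF J(2)] f0(1)] by simp
  ultimately have c: "c > 0" by simp
  have "M' = scale_measure (ennreal c) M"
    by (rule radon_eq_if_int_eq[OF r c]) (use Jc in \<open>simp add: J_def J'_def\<close>)
  then show ?thesis using c by blast
qed

end

section \<open>Induction along a compact strong normal system\<close>

lemma ord_zero_le: "ord_zero \<le> (\<xi>::'i::wellorder)"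
  unfolding ord_zero_def by (rule Least_le) simp

lemma ord_succ_le: "\<xi> < \<zeta> \<Longrightarrow> ord_succ \<xi> \<le> (\<zeta>::'i::wellorder)"
  unfolding ord_succ_def by (rule Least_le)

locale normal_system = rt_group +
  fixes \<xi>\<^sub>0 :: "'i::wellorder" and L :: "'i \<Rightarrow> 'a set"
  assumes csns: "compact_strong_normal_system G X \<xi>\<^sub>0 L"
begin

abbreviation o1 :: 'i where "o1 \<equiv> ord_succ ord_zero"

lemma zero_less: "ord_zero < \<xi>\<^sub>0"
  and L_top: "L \<xi>\<^sub>0 = {\<one>}"
  and L_succ: "\<xi> < \<xi>\<^sub>0 \<Longrightarrow> L (ord_succ \<xi>) \<subseteq> L \<xi>"
  and L_limit: "\<xi> \<le> \<xi>\<^sub>0 \<Longrightarrow> ord_limit \<xi> \<Longrightarrow> L \<xi> = (\<Inter>\<eta>\<in>{..<\<xi>}. L \<eta>)"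
  and L_compact: "o1 \<le> \<xi> \<Longrightarrow> \<xi> \<le> \<xi>\<^sub>0 \<Longrightarrow> compactin X (L \<xi>)"
  using csns unfolding compact_strong_normal_system_def by simp_all

lemma base_group: "lc_group (G Mod L o1) (coset_topology G X (L o1))"
  using csns unfolding compact_strong_normal_system_def by (intro lc_group_of_topological_group) simp_all

text \<open>The map (x, y) \<mapsto> inv x y is continuous into the \<sigma>-topology by the
  definition of the latter as a quotient topology.\<close>

lemma L_adm:
  assumes "\<xi> \<le> \<xi>\<^sub>0"
  shows "adm (L \<xi>)"
proof -
  have n: "L \<xi> \<lhd> G" and cl: "closedin (sigma_topology G X) (L \<xi>)"
    using csns assms unfolding compact_strong_normal_system_def by blast+
  have "continuous_map (prod_topology X X) (sigma_topology G X) (\<lambda>(x, y). inv x \<otimes> y)"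
    unfolding sigma_topology_def by (rule quotient_imp_continuous_map[OF quotient_map_quotient_topology])
  then have "closedin (prod_topology X X) {p \<in> topspace (prod_topology X X). (\<lambda>(x, y). inv x \<otimes> y) p \<in> L \<xi>}"
    using cl by (rule closedin_continuous_map_preimage)
  moreover have "{p \<in> topspace (prod_topology X X). (\<lambda>(x, y). inv x \<otimes> y) p \<in> L \<xi>} =
      {(x, y). x \<in> carrier G \<and> y \<in> carrier G \<and> inv x \<otimes> y \<in> L \<xi>}"
    by auto
  ultimately show ?thesis using n unfolding adm_def by simp
qed

text \<open>The axioms compare only neighbours and limits with what precedes them; transfinite
  induction gives the full antitone chain.\<close>

lemma L_anti:
  assumes "\<zeta> \<le> \<xi>\<^sub>0" "\<eta> \<le> \<zeta>"
  shows "L \<zeta> \<subseteq> L \<eta>"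
  using assms
proof (induction \<zeta> rule: less_induct)
  case (less \<zeta>)
  show ?case
  proof (cases "\<eta> = \<zeta>")
    case False
    then have lt: "\<eta> < \<zeta>" using less.prems by simp
    show ?thesis
    proof (cases "ord_limit \<zeta>")
      case True
      then show ?thesis using L_limit[OF less.prems(1)] lt by blast
    next
      case False
      moreover have "\<zeta> \<noteq> ord_zero" using lt ord_zero_le[of \<eta>] by auto
      ultimately obtain \<theta> where \<theta>: "\<theta> < \<zeta>" "ord_succ \<theta> = \<zeta>" unfolding ord_limit_def by blast
      have "\<eta> \<le> \<theta>"
      proof (rule ccontr)
        assume "\<not> \<eta> \<le> \<theta>"
        then have "ord_succ \<theta> \<le> \<eta>" by (intro ord_succ_le) simp
        then show False using \<theta>(2) lt by simp
      qed
      then have "L \<theta> \<subseteq> L \<eta>" using less.IH[OF \<theta>(1)] \<theta>(1) less.prems(1) by simp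
      moreover have "L \<zeta> \<subseteq> L \<theta>" using L_succ[of \<theta>] \<theta> less.prems(1) by simp
      ultimately show ?thesis by blast
    qed
  qed simp
qed

lemma successor_step:
  assumes \<eta>: "o1 \<le> \<eta>" "\<eta> < \<xi>\<^sub>0"
  shows "compact_step G X (L \<eta>) (L (ord_succ \<eta>))"
proof -
  have s: "ord_succ \<eta> \<le> \<xi>\<^sub>0" by (rule ord_succ_le[OF \<eta>(2)])
  show ?thesis
  proof (unfold_locales)
    show "adm (L \<eta>)" "adm (L (ord_succ \<eta>))" using L_adm \<eta>(2) s by auto
    show "L (ord_succ \<eta>) \<subseteq> L \<eta>" by (rule L_succ[OF \<eta>(2)])
  qed (use csns \<eta> in \<open>simp_all add: compact_strong_normal_system_def Let_def\<close>)
qed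

text \<open>Properness relative to \<open>L o1\<close> is part of the statement because the limit
  case needs it for all earlier indices; it makes the cones below a limit increase.\<close>

lemma main_induction:
  assumes "o1 \<le> \<xi>" "\<xi> \<le> \<xi>\<^sub>0"
  shows "proper_over (L o1) (L \<xi>) \<and> (\<exists>I. haar (CN (L \<xi>)) I) \<and> unique_haar (CN (L \<xi>))"
  using assms
proof (induction \<xi> rule: less_induct)
  case (less \<xi>)
  consider "\<xi> = o1" | "\<xi> \<noteq> o1" "ord_limit \<xi>" | "\<xi> \<noteq> o1" "\<not> ord_limit \<xi>" by blast
  then show ?case
  proof cases
    case 1
    have n: "L o1 \<lhd> G" using adm_normal[OF L_adm] less.prems 1 by simp
    have "proper_over (L o1) (L o1)" unfolding proper_over_def by blast
    then show ?thesis using haar_quotient_group[OF n base_group] 1 by simp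
  next
    case 2
    \<comment> \<open>The chain starts at \<open>o1\<close>: the member at \<open>ord_zero\<close>
      is the whole group, for which compactness is not assumed.\<close>
    define E where "E = {\<eta>. o1 \<le> \<eta> \<and> \<eta> < \<xi>}"
    have o1: "o1 \<in> E" using 2 less.prems unfolding E_def by simp
    have E: "\<eta> \<le> \<xi>\<^sub>0" "o1 \<le> \<eta>" "\<eta> < \<xi>" if "\<eta> \<in> E" for \<eta> using that less.prems unfolding E_def by auto
    \<comment> \<open>Since the system decreases, dropping the indices before \<open>o1\<close>
      leaves the intersection unchanged.\<close>
    have Lxi: "L \<xi> = (\<Inter>\<eta>\<in>E. L \<eta>)"
    proof
      show "L \<xi> \<subseteq> (\<Inter>\<eta>\<in>E. L \<eta>)" using L_anti[OF less.prems(2)] E(3) by (auto intro: less_imp_le)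
      show "(\<Inter>\<eta>\<in>E. L \<eta>) \<subseteq> L \<xi>"
        unfolding L_limit[OF less.prems(2) 2(2)]
      proof (intro INT_greatest)
        fix \<eta> assume "\<eta> \<in> {..<\<xi>}"
        then have "max o1 \<eta> \<in> E" using o1 unfolding E_def by (auto simp: max_def)
        moreover from this have "L (max o1 \<eta>) \<subseteq> L \<eta>" by (intro L_anti E(1)) auto
        ultimately show "(\<Inter>\<eta>\<in>E. L \<eta>) \<subseteq> L \<eta>" by blast
      qed
    qed
    have IH: "proper_over (L o1) (L \<eta>) \<and> (\<exists>I. haar (CN (L \<eta>)) I) \<and> unique_haar (CN (L \<eta>))"
      if "\<eta> \<in> E" for \<eta>
      by (rule less.IH[OF E(3)[OF that] E(2)[OF that] E(1)[OF that]])
    interpret C: normal_chain G X E L "L \<xi>" o1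
    proof (unfold_locales)
      fix \<eta> assume \<eta>: "\<eta> \<in> E"
      show "o1 \<le> \<eta>" by (rule E(2)[OF \<eta>])
      show "adm (L \<eta>)" by (rule L_adm[OF E(1)[OF \<eta>]])
      show "compactin X (L \<eta>)" by (rule L_compact[OF E(2)[OF \<eta>] E(1)[OF \<eta>]])
      show "proper_over (L o1) (L \<eta>)" "\<exists>I. haar (CN (L \<eta>)) I" "unique_haar (CN (L \<eta>))"
        using IH[OF \<eta>] by auto
      show "L \<zeta> \<subseteq> L \<eta>" if "\<zeta> \<in> E" "\<eta> \<le> \<zeta>" for \<zeta>
        by (rule L_anti[OF E(1)[OF that(1)] that(2)])
    qed (fact o1, fact Lxi, rule L_adm[OF less.prems(2)])
    show ?thesis using C.proper_limit C.haar_limit_exists C.haar_limit_unique by blast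
  next
    case 3
    have "o1 < \<xi>" using 3 less.prems by simp
    then have "\<xi> \<noteq> ord_zero" using ord_zero_le[of o1] by auto
    then obtain \<eta> where \<eta>: "\<eta> < \<xi>" "ord_succ \<eta> = \<xi>" using 3(2) unfolding ord_limit_def by blast
    have "\<eta> \<noteq> ord_zero" using \<eta>(2) 3(1) by auto
    then have o1: "o1 \<le> \<eta>" using ord_zero_le[of \<eta>] by (intro ord_succ_le) simp
    have lt: "\<eta> < \<xi>\<^sub>0" using \<eta>(1) less.prems(2) by simp
    have IH: "proper_over (L o1) (L \<eta>)" "\<exists>I. haar (CN (L \<eta>)) I" "unique_haar (CN (L \<eta>))"
      using less.IH[OF \<eta>(1) o1] lt by auto
    interpret S: compact_step G X "L \<eta>" "L \<xi>"
      "coset_topology G X (L \<xi>)" "coset_topology (G\<lparr>carrier := L \<eta>\<rparr>) (subtopology X (L \<eta>)) (L \<xi>)"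
      using successor_step[OF o1 lt] unfolding \<eta>(2) by simp_all
    show ?thesis
      using proper_over_trans[OF IH(1) S.proper_step] IH(2) S.haar_step S.unique_haar_step[OF IH(3)] by blast
  qed
qed

lemma haar_Cc: "\<exists>I. haar (Cc X) I" "unique_haar (Cc X)"
  using main_induction[of \<xi>\<^sub>0] ord_succ_le[OF zero_less] unfolding L_top CN_one by auto

end

theorem theorem2p7:
  fixes G :: "('a, 'b) monoid_scheme" and \<tau> :: "'a topology"
    and \<xi>\<^sub>0 :: "'i::wellorder" and L :: "'i \<Rightarrow> 'a set"
  assumes "right_topological_group G \<tau>"
    and "locally_compact_space \<tau>" and "Hausdorff_space \<tau>"
    and "compact_strong_normal_system G \<tau> \<xi>\<^sub>0 L"
  shows "(\<exists>\<mu>. right_haar_measure G \<tau> \<mu>) \<and>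
    (\<forall>\<mu> \<mu>'. right_haar_measure G \<tau> \<mu> \<and> right_haar_measure G \<tau> \<mu>' \<longrightarrow>
       (\<exists>c::real. c > 0 \<and> \<mu>' = scale_measure (ennreal c) \<mu>))"
proof -
  interpret group G using assms(1) unfolding right_topological_group_def by blast
  interpret normal_system G \<tau> \<xi>\<^sub>0 L
    using assms unfolding right_topological_group_def by unfold_locales auto
  show ?thesis using right_haar_of_functional right_haar_unique haar_Cc by blast
qed

end
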